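(* Consider the linear autoregressive model with $K$ lags, $Y_{1t}^N=\rho_0+\sum_{j=1}^K\rho_jY_{1,t-j}^N+u_t$. Suppose that $\{u_t\}_{t=1}^T$ is an i.i.d. sequence with $E(u_1)=0$ and $E(u_1^4)$ uniformly bounded, and that the roots of $1-\sum_{j=1}^K\rho_jL^j=0$ are uniformly bounded away from the unit circle. Let $P_t^N=y_t'\rho$ and $\hat P_t^N=y_t'\hat\rho$, where $y_t=(1,Y_{1,t-1}^N,\dots,Y_{1,t-K}^N)'\in\mathbb R^{K+1}$, $\rho=(\rho_0,\dots,\rho_K)'\in\mathbb R^{K+1}$ and $\hat\rho=\big(\sum_{t=K+1}^Ty_ty_t'\big)^{-1}\big(\sum_{t=K+1}^Ty_tY_{1t}^N\big)$. Then, for any $T_0+1\le t\le T$, $$\hat P_t^N-P_t^N=o_P(1)\quad\text{and}\quad\frac1T\sum_{t=K+1}^T(\hat P_t^N-P_t^N)^2=o_P(1).$$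
   Context: $Y_{1t}^N$ is the outcome of the treated unit in the absence of the policy in period $t$, $P_t^N$ is its counterfactual mean proxy, and $\hat P_t^N$ is the least squares estimate of the proxy. $T=T_0+T_*$, where $T_0$ and $T_*$ are the numbers of pre- and post-treatment periods, and asymptotics are as $T_0\to\infty$. $L$ denotes the argument of the lag polynomial.
   Formalization: The roots are required to lie outside the unit circle, uniformly (|z| ≥ 1+δ), not merely bounded away from it; with a root inside (K=1, ρ_1=2, Y_1=0, Gaussian u_t) the first claim fails at t=T. *)

theory Defs
  imports "HOL-Probability.Probability" "Jordan_Normal_Form.Gauss_Jordan_Elimination"
begin

unbundle no vec_syntax

text \<open>
  \<open>X\<^sub>n = o\<^sub>P(1)\<close> along a sequence of probability spaces. The outer measure equals the measure on
  measurable events; using it avoids that \<^const>\<open>measure\<close> is 0 on every non-measurable set.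
\<close>

definition small_oP1 :: "(nat \<Rightarrow> 'a measure) \<Rightarrow> (nat \<Rightarrow> 'a \<Rightarrow> real) \<Rightarrow> bool" where
  "small_oP1 M X \<longleftrightarrow>
     (\<forall>\<epsilon>>0. (\<lambda>n. outer_measure_of (M n) {\<omega> \<in> space (M n). \<bar>X n \<omega>\<bar> > \<epsilon>}) \<longlonglongrightarrow> 0)"

definition (in prob_space) iid_vars :: "('i \<Rightarrow> 'a \<Rightarrow> real) \<Rightarrow> 'i set \<Rightarrow> bool" where
  "iid_vars X I \<longleftrightarrow> indep_vars (\<lambda>_. borel) X I \<and>
     (\<forall>s\<in>I. \<forall>t\<in>I. distr M borel (X s) = distr M borel (X t))"

text \<open>
  A path is a function \<open>Y\<close> of time with periods \<open>1, 2, \<dots>\<close>; coordinates of vectors in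
  \<open>\<real>\<^bsup>K+1\<^esup>\<close> are indexed by \<open>0, \<dots>, K\<close>.
\<close>

definition regressor :: "nat \<Rightarrow> (nat \<Rightarrow> real) \<Rightarrow> nat \<Rightarrow> real vec" where
  "regressor K Y t = vec (K + 1) (\<lambda>j. if j = 0 then 1 else Y (t - j))"

definition gram :: "nat \<Rightarrow> nat \<Rightarrow> (nat \<Rightarrow> real) \<Rightarrow> real mat" where
  "gram K T Y = mat (K + 1) (K + 1)
     (\<lambda>(i, j). \<Sum>t=K+1..T. regressor K Y t $ i * regressor K Y t $ j)"

definition cross_moment :: "nat \<Rightarrow> nat \<Rightarrow> (nat \<Rightarrow> real) \<Rightarrow> real vec" where
  "cross_moment K T Y = vec (K + 1) (\<lambda>i. \<Sum>t=K+1..T. regressor K Y t $ i * Y t)"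

text \<open>
  If the Gram matrix is singular, its inverse does not exist and the least squares coefficient is
  not unique; an arbitrary solution of the normal equations (which always exists) is used then.
  The fitted values at \<open>t = K+1, \<dots>, T\<close> do not depend on the choice.
\<close>

definition ols :: "nat \<Rightarrow> nat \<Rightarrow> (nat \<Rightarrow> real) \<Rightarrow> real vec" where
  "ols K T Y =
     (case mat_inverse (gram K T Y) of
        Some G' \<Rightarrow> G' *\<^sub>v cross_moment K T Y
      | None \<Rightarrow> (SOME r. r \<in> carrier_vec (K + 1) \<and> gram K T Y *\<^sub>v r = cross_moment K T Y))"

definition proxy :: "nat \<Rightarrow> real vec \<Rightarrow> (nat \<Rightarrow> real) \<Rightarrow> nat \<Rightarrow> real" where
  "proxy K r Y t = scalar_prod (regressor K Y t) r"

end

theory Submission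
  imports Defs "Jordan_Normal_Form.Char_Poly" "HOL-Real_Asymp.Real_Asymp"
begin

text \<open>
  Write \<open>e = (x\<^sub>t \<bullet> a)\<^sub>t\<close> for the vector of fitted minus true proxies. The normal equations give
  \<open>\<parallel>e\<parallel>\<^sup>2 = \<langle>e, u\<rangle>\<close>, so it suffices to bound \<open>\<langle>v, u\<rangle>\<close> and \<open>v\<^sub>t\<close> by \<open>\<parallel>v\<parallel>\<close>, uniformly over all
  vectors \<open>v\<close> in the span of the regressors. Applying the lag polynomial to such a \<open>v\<close> yields
  \<open>g\<^sub>t = b + \<Sum>\<^sub>j \<alpha>\<^sub>j y\<^bsub>t-j\<^esub>\<close> for \<open>t > 2 K\<close>, where \<open>y\<close> is the studentized noise (centred at its sample
  mean, with sample norm 1), and the inverse filter, whose coefficients decay geometrically at a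
  rate depending only on \<open>K\<close> and \<open>\<delta>\<close>, recovers \<open>v\<close> from \<open>g\<close> and its first \<open>K\<close> values. This makes the
  initial values of the process irrelevant. Off an event of small probability the constant and the
  shifts of \<open>y\<close> are nearly orthogonal, so \<open>N b\<^sup>2 + \<parallel>\<alpha>\<parallel>\<^sup>2 \<le> const * \<parallel>v\<parallel>\<^sup>2\<close>.

  The noise may degenerate along the array (its variance is not bounded below), so laws of large
  numbers at the scale of the variance are not available. Instead the studentized noise is
  exchangeable, and exchangeability together with \<open>\<Sum>y = 0\<close> and \<open>\<Sum>y\<^sup>2 \<le> 1\<close> alone controls all mixed
  fourth moments of \<open>y\<close>.
\<close>

section \<open>Exchangeability of the studentized noise\<close>

text \<open>The estimated coefficients depend on the whole noise path, so moment bounds for a fixed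
  \<open>v\<close> are of no use. Every estimate therefore splits into coefficients, bounded by the
  norm of \<open>v\<close>, and statistics of \<open>y\<close> alone that have bounded expectation
  after scaling by powers of \<open>N\<close>. Markov's inequality for the sum of these statistics
  gives one event for all \<open>v\<close>, with failure probability at most \<open>D / k\<close>
  and \<open>D\<close> free of \<open>T0\<close>. On its complement the norm of \<open>e\<close> has
  a bound free of \<open>N\<close>: the sample mean is of order \<open>1 / sqrt N\<close> against an
  inner product with the constant of order \<open>sqrt N\<close>, and the noise norm is of order
  \<open>sqrt N\<close> against \<open><v, y>\<close> of order \<open>1 / sqrt N\<close>. So the
  mean square error is of order \<open>1 / T\<close>. At a single date the error is at most of the
  order of the filter weight left from the first \<open>K\<close> filtered values plus
  \<open>1 / sqrt N\<close>; the weight vanishes only because the date diverges. Slopes are bounded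
  only after multiplication by the noise norm, so consistency of the coefficients themselves is
  never claimed. The pure fourth moment of \<open>y i\<close> is avoided: it can be of order
  \<open>1 / N\<close>, which is too large.\<close>

lemma (in prob_space) indep_vars_reindex_bij:
  assumes indep: "indep_vars M' X I" and bij: "bij_betw f J I"
  shows "indep_vars (\<lambda>i. M' (f i)) (\<lambda>i. X (f i)) J"
  unfolding indep_vars_def2 indep_sets_def
proof (intro conjI ballI allI impI)
  have fI: "\<And>i. i \<in> J \<Longrightarrow> f i \<in> I" using bij by (auto simp: bij_betw_def)
  show "random_variable (M' (f i)) (X (f i))" if "i \<in> J" for i
    using indep fI[OF that] by (auto simp: indep_vars_def)
  show "{X (f i) -` A \<inter> space M |A. A \<in> sets (M' (f i))} \<subseteq> events" if "i \<in> J" for i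
    using indep fI[OF that] unfolding indep_vars_def2 indep_sets_def by blast
  fix L A
  assume L: "L \<subseteq> J" "L \<noteq> {}" "finite L"
    and A: "A \<in> (\<Pi> i\<in>L. {X (f i) -` A \<inter> space M |A. A \<in> sets (M' (f i))})"
  let ?g = "the_inv_into J f"
  have inj: "inj_on f J" using bij by (simp add: bij_betw_def)
  have injL: "inj_on f L" using inj L(1) by (rule inj_on_subset)
  have g: "\<And>i. i \<in> L \<Longrightarrow> ?g (f i) = i" using the_inv_into_f_f[OF inj] L(1) by auto
  have "prob (\<Inter>j\<in>f ` L. A (?g j)) = (\<Prod>j\<in>f ` L. prob (A (?g j)))"
  proof (rule indep_setsD[of "\<lambda>i. {X i -` A \<inter> space M |A. A \<in> sets (M' i)}" I])
    show "indep_sets (\<lambda>i. {X i -` A \<inter> space M |A. A \<in> sets (M' i)}) I"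
      using indep unfolding indep_vars_def2 by blast
    show "f ` L \<subseteq> I" using fI L(1) by auto
    show "\<forall>j\<in>f ` L. A (?g j) \<in> {X j -` A \<inter> space M |A. A \<in> sets (M' j)}"
      using A g by (auto simp: Pi_iff)
  qed (use L in auto)
  then show "prob (\<Inter> (A ` L)) = (\<Prod>j\<in>L. prob (A j))"
    using g by (simp add: prod.reindex[OF injL] image_image cong: prod.cong)
qed

text \<open>The joint law is the product of the marginals, which all coincide, so permuting the
  coordinates leaves it unchanged. Transpositions are enough: the moment bounds only ever swap one
  index for another.\<close>

lemma (in prob_space) iid_vars_transpose_integral:
  fixes X :: "'i \<Rightarrow> 'a \<Rightarrow> real" and H :: "('i \<Rightarrow> real) \<Rightarrow> real"
  assumes iid: "iid_vars X I" and pq: "p \<in> I" "q \<in> I"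
    and H: "H \<in> borel_measurable (Pi\<^sub>M I (\<lambda>_. borel))"
  shows "expectation (\<lambda>\<omega>. H (\<lambda>i\<in>I. X (Transposition.transpose p q i) \<omega>))
    = expectation (\<lambda>\<omega>. H (\<lambda>i\<in>I. X i \<omega>))"
proof -
  let ?\<tau> = "Transposition.transpose p q"
  have bij: "bij_betw ?\<tau> I I" using pq by simp
  have indep: "indep_vars (\<lambda>_. borel) X I" and
    id: "\<And>s t. s \<in> I \<Longrightarrow> t \<in> I \<Longrightarrow> distr M borel (X s) = distr M borel (X t)"
    using iid unfolding iid_vars_def by blast+
  have rv: "\<And>i. i \<in> I \<Longrightarrow> random_variable borel (X i)"
    using indep by (auto simp: indep_vars_def)
  have I0: "I \<noteq> {}" using pq by auto
  have \<tau>I: "\<And>i. i \<in> I \<Longrightarrow> ?\<tau> i \<in> I" using bij by (auto simp: bij_betw_def)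
  have indep': "indep_vars (\<lambda>_. borel) (\<lambda>i. X (?\<tau> i)) I"
    using indep_vars_reindex_bij[OF indep bij] .
  have "distr M (\<Pi>\<^sub>M i\<in>I. borel) (\<lambda>\<omega>. \<lambda>i\<in>I. X (?\<tau> i) \<omega>)
      = (\<Pi>\<^sub>M i\<in>I. distr M borel (X (?\<tau> i)))"
    by (rule indep_vars_iff_distr_eq_PiM'[OF I0, THEN iffD1, OF _ indep']) (rule rv[OF \<tau>I])
  also have "\<dots> = (\<Pi>\<^sub>M i\<in>I. distr M borel (X i))"
    by (intro PiM_cong refl id \<tau>I)
  also have "\<dots> = distr M (\<Pi>\<^sub>M i\<in>I. borel) (\<lambda>\<omega>. \<lambda>i\<in>I. X i \<omega>)"
    by (rule indep_vars_iff_distr_eq_PiM'[OF I0, THEN iffD1, OF _ indep, symmetric]) (rule rv)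
  finally have eq: "distr M (\<Pi>\<^sub>M i\<in>I. borel) (\<lambda>\<omega>. \<lambda>i\<in>I. X (?\<tau> i) \<omega>)
      = distr M (\<Pi>\<^sub>M i\<in>I. borel) (\<lambda>\<omega>. \<lambda>i\<in>I. X i \<omega>)" .
  have "expectation (\<lambda>\<omega>. H (\<lambda>i\<in>I. X (?\<tau> i) \<omega>))
      = integral\<^sup>L (distr M (\<Pi>\<^sub>M i\<in>I. borel) (\<lambda>\<omega>. \<lambda>i\<in>I. X (?\<tau> i) \<omega>)) H"
    using rv \<tau>I by (intro integral_distr[symmetric] H measurable_restrict) auto
  also have "\<dots> = expectation (\<lambda>\<omega>. H (\<lambda>i\<in>I. X i \<omega>))"
    unfolding eq using rv by (intro integral_distr H measurable_restrict) auto
  finally show ?thesis .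
qed

text \<open>If all entries of \<open>x\<close> coincide, the division by 0 makes all studentized values 0.\<close>

definition studentized :: "'i set \<Rightarrow> ('i \<Rightarrow> real) \<Rightarrow> 'i \<Rightarrow> real" where
  "studentized I x i = (x i - (\<Sum>j\<in>I. x j) / card I)
     / sqrt (\<Sum>k\<in>I. (x k - (\<Sum>j\<in>I. x j) / card I)\<^sup>2)"

lemma studentized_cong:
  "(\<And>i. i \<in> I \<Longrightarrow> x i = y i) \<Longrightarrow> i \<in> I \<Longrightarrow> studentized I x i = studentized I y i"
  by (simp add: studentized_def)

text \<open>Sample mean and centred norm are symmetric in the entries.\<close>

lemma studentized_transpose:
  assumes "p \<in> I" "q \<in> I"
  shows "studentized I (\<lambda>i. x (Transposition.transpose p q i)) i
    = studentized I x (Transposition.transpose p q i)"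
proof -
  have b: "bij_betw (Transposition.transpose p q) I I" using assms by simp
  have s: "(\<Sum>j\<in>I. x (Transposition.transpose p q j)) = (\<Sum>j\<in>I. x j)"
    using sum.reindex_bij_betw[OF b, of x] .
  have "(\<Sum>k\<in>I. (x (Transposition.transpose p q k) - m)\<^sup>2) = (\<Sum>k\<in>I. (x k - m)\<^sup>2)" for m
    using sum.reindex_bij_betw[OF b, of "\<lambda>k. (x k - m)\<^sup>2"] .
  then show ?thesis by (simp add: studentized_def s)
qed

lemma sum_studentized:
  assumes "finite I" "I \<noteq> {}"
  shows "(\<Sum>i\<in>I. studentized I x i) = 0"
  using assms by (simp add: studentized_def sum_divide_distrib[symmetric] sum_subtractf)

lemma sum_sq_diff_eq_0D:
  fixes m :: real
  shows "finite I \<Longrightarrow> (\<Sum>k\<in>I. (x k - m)\<^sup>2) = 0 \<Longrightarrow> i \<in> I \<Longrightarrow> x i = m"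
  by (simp add: sum_nonneg_eq_0_iff)

text \<open>A zero norm forces every entry to equal the mean; otherwise dividing by the norm gives
  norm 1. The second alternative is stated for \<open>x\<close> so that it also shows that the scale
  of the sample vanishes.\<close>

lemma sum_studentized_sq:
  assumes "finite I"
  shows "(\<Sum>i\<in>I. (studentized I x i)\<^sup>2) = 1 \<or> (\<forall>i\<in>I. x i = (\<Sum>j\<in>I. x j) / card I)"
proof -
  let ?m = "(\<Sum>j\<in>I. x j) / card I"
  let ?Q = "\<Sum>k\<in>I. (x k - ?m)\<^sup>2"
  have Q0: "?Q \<ge> 0" by (simp add: sum_nonneg)
  show ?thesis
  proof (cases "?Q = 0")
    case True
    show ?thesis by (intro disjI2 ballI sum_sq_diff_eq_0D[OF assms True])
  next
    case False
    then show ?thesis using Q0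
      by (simp add: studentized_def power_divide sum_divide_distrib[symmetric])
  qed
qed

text \<open>For a constant sample the scale is 0 and the entry is the mean, so the representation
  \<open>u = m + s y\<close> needs no case distinction.\<close>

lemma studentized_scale:
  assumes "finite I" "i \<in> I"
  shows "x i = (\<Sum>j\<in>I. x j) / card I
    + sqrt (\<Sum>k\<in>I. (x k - (\<Sum>j\<in>I. x j) / card I)\<^sup>2) * studentized I x i"
proof -
  let ?m = "(\<Sum>j\<in>I. x j) / card I"
  let ?Q = "\<Sum>k\<in>I. (x k - ?m)\<^sup>2"
  show ?thesis
  proof (cases "?Q = 0")
    case True
    then have "x i = ?m" using sum_sq_diff_eq_0D[of I x ?m i] assms by blast
    then show ?thesis unfolding True by simp
  next
    case False
    then have "sqrt ?Q \<noteq> 0" by simp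
    then show ?thesis by (simp add: studentized_def)
  qed
qed

lemma measurable_studentized:
  assumes "finite I" "i \<in> I" "\<And>j. j \<in> I \<Longrightarrow> (\<lambda>\<omega>. X j \<omega>) \<in> borel_measurable M"
  shows "(\<lambda>\<omega>. studentized I (\<lambda>j. X j \<omega>) i) \<in> borel_measurable M"
  using assms unfolding studentized_def by measurable

text \<open>Invariance is required only for the moments of orders two and four, the only ones that
  are computed. \<open>sum1\<close> is an inequality because the studentized vector is 0 for a
  constant sample; \<open>card4\<close> makes four distinct indices available and bounds
  \<open>N / (N - 3)\<close> by 4.\<close>

locale exchangeable = prob_space +
  fixes I :: "'i set" and y :: "'i \<Rightarrow> 'a \<Rightarrow> real"
  assumes fin: "finite I" and card4: "card I \<ge> 4"
    and meas[measurable]: "\<And>i. i \<in> I \<Longrightarrow> y i \<in> borel_measurable M"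
    and sum0: "\<And>\<omega>. \<omega> \<in> space M \<Longrightarrow> (\<Sum>i\<in>I. y i \<omega>) = 0"
    and sum1: "\<And>\<omega>. \<omega> \<in> space M \<Longrightarrow> (\<Sum>i\<in>I. (y i \<omega>)\<^sup>2) \<le> 1"
    and exch2: "\<And>p q i j. \<lbrakk>p \<in> I; q \<in> I; i \<in> I; j \<in> I\<rbrakk> \<Longrightarrow>
      expectation (\<lambda>\<omega>. y (Transposition.transpose p q i) \<omega> * y (Transposition.transpose p q j) \<omega>)
      = expectation (\<lambda>\<omega>. y i \<omega> * y j \<omega>)"
    and exch4: "\<And>p q i j k l. \<lbrakk>p \<in> I; q \<in> I; i \<in> I; j \<in> I; k \<in> I; l \<in> I\<rbrakk> \<Longrightarrow>
      expectation (\<lambda>\<omega>. y (Transposition.transpose p q i) \<omega> * y (Transposition.transpose p q j) \<omega>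
        * y (Transposition.transpose p q k) \<omega> * y (Transposition.transpose p q l) \<omega>)
      = expectation (\<lambda>\<omega>. y i \<omega> * y j \<omega> * y k \<omega> * y l \<omega>)"

lemma (in prob_space) exchangeable_studentized:
  fixes X :: "'b \<Rightarrow> 'a \<Rightarrow> real"
  assumes iid: "iid_vars X I" and I: "finite I" "card I \<ge> 4"
  shows "exchangeable M I (\<lambda>i \<omega>. studentized I (\<lambda>j. X j \<omega>) i)"
proof -
  have rv: "\<And>i. i \<in> I \<Longrightarrow> random_variable borel (X i)"
    using iid unfolding iid_vars_def indep_vars_def by blast
  have I0: "I \<noteq> {}" using I by auto
  \<comment> \<open>Equality of laws concerns samples restricted to \<open>I\<close>.
    \<open>cong\<close> makes the functional ignore values outside \<open>I\<close>, and
    \<open>studentized_transpose\<close> moves the swap from the sample to the studentized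
    vector.\<close>
  have *: "expectation (\<lambda>\<omega>. F (\<lambda>i. studentized I (\<lambda>j. X j \<omega>) (Transposition.transpose p q i)))
      = expectation (\<lambda>\<omega>. F (studentized I (\<lambda>j. X j \<omega>)))"
    if pq: "p \<in> I" "q \<in> I"
      and F: "(\<lambda>x. F (studentized I x)) \<in> borel_measurable (Pi\<^sub>M I (\<lambda>_. borel))"
      and cong: "\<And>v w. (\<And>i. i \<in> I \<Longrightarrow> v i = w i) \<Longrightarrow> F v = F w" for p q and F :: "('b \<Rightarrow> real) \<Rightarrow> real"
  proof -
    have "expectation (\<lambda>\<omega>. F (studentized I (\<lambda>i\<in>I. X (Transposition.transpose p q i) \<omega>)))
        = expectation (\<lambda>\<omega>. F (studentized I (\<lambda>i\<in>I. X i \<omega>)))"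
      using iid_vars_transpose_integral[OF iid pq F] .
    moreover have "F (studentized I (\<lambda>i\<in>I. X i \<omega>)) = F (studentized I (\<lambda>j. X j \<omega>))" for \<omega>
      by (rule cong) (rule studentized_cong; simp)
    moreover have "F (studentized I (\<lambda>i\<in>I. X (Transposition.transpose p q i) \<omega>))
       = F (\<lambda>i. studentized I (\<lambda>j. X j \<omega>) (Transposition.transpose p q i))" for \<omega>
      by (rule cong, subst studentized_transpose[OF pq, symmetric]) (rule studentized_cong; simp)
    ultimately show ?thesis by simp
  qed
  have m: "(\<lambda>x. studentized I x i) \<in> borel_measurable (Pi\<^sub>M I (\<lambda>_. borel))" if "i \<in> I" for i
    using measurable_studentized[OF I(1) that, of "\<lambda>j x. x j" "Pi\<^sub>M I (\<lambda>_. borel)"]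
    by (simp add: measurable_component_singleton)
  show ?thesis
  proof
    show "finite I" "4 \<le> card I" by fact+
    show "(\<lambda>\<omega>. studentized I (\<lambda>j. X j \<omega>) i) \<in> borel_measurable M" if "i \<in> I" for i
      by (rule measurable_studentized[OF I(1) that]) (simp add: rv)
    show "(\<Sum>i\<in>I. studentized I (\<lambda>j. X j \<omega>) i) = 0" for \<omega>
      using sum_studentized[OF I(1) I0] .
    show "(\<Sum>i\<in>I. (studentized I (\<lambda>j. X j \<omega>) i)\<^sup>2) \<le> 1" for \<omega>
      using sum_studentized_sq[OF I(1), of "\<lambda>j. X j \<omega>"]
    proof
      assume c: "\<forall>i\<in>I. X i \<omega> = (\<Sum>j\<in>I. X j \<omega>) / card I"
      have "studentized I (\<lambda>j. X j \<omega>) i = 0" if "i \<in> I" for i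
        unfolding studentized_def bspec[OF c that, symmetric] by simp
      then show ?thesis by simp
    qed simp
  next
    fix p q i j assume "p \<in> I" "q \<in> I" "i \<in> I" "j \<in> I"
    then show "expectation (\<lambda>\<omega>. studentized I (\<lambda>j. X j \<omega>) (Transposition.transpose p q i)
        * studentized I (\<lambda>j. X j \<omega>) (Transposition.transpose p q j))
      = expectation (\<lambda>\<omega>. studentized I (\<lambda>j. X j \<omega>) i * studentized I (\<lambda>j. X j \<omega>) j)"
      by (intro *[of p q "\<lambda>f. f i * f j"]) (assumption | intro borel_measurable_times m | metis)+
  next
    fix p q i j k l assume "p \<in> I" "q \<in> I" "i \<in> I" "j \<in> I" "k \<in> I" "l \<in> I"
    then show "expectation (\<lambda>\<omega>. studentized I (\<lambda>j. X j \<omega>) (Transposition.transpose p q i)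
        * studentized I (\<lambda>j. X j \<omega>) (Transposition.transpose p q j)
        * studentized I (\<lambda>j. X j \<omega>) (Transposition.transpose p q k)
        * studentized I (\<lambda>j. X j \<omega>) (Transposition.transpose p q l))
      = expectation (\<lambda>\<omega>. studentized I (\<lambda>j. X j \<omega>) i * studentized I (\<lambda>j. X j \<omega>) j
        * studentized I (\<lambda>j. X j \<omega>) k * studentized I (\<lambda>j. X j \<omega>) l)"
      by (intro *[of p q "\<lambda>f. f i * f j * f k * f l"]) (assumption | intro borel_measurable_times m | metis)+
  qed
qed

section \<open>Mixed moments of orders two and four\<close>

lemma mult_scale_le: "a \<le> c * b \<Longrightarrow> 0 \<le> e \<Longrightarrow> a * e \<le> c * (b * e)" for a b c e :: real
  using mult_right_mono[of a "c * b" e] by (simp add: mult.assoc)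

context exchangeable
begin

lemma abs_le_1: "i \<in> I \<Longrightarrow> \<omega> \<in> space M \<Longrightarrow> \<bar>y i \<omega>\<bar> \<le> 1"
proof -
  assume i: "i \<in> I" and w: "\<omega> \<in> space M"
  have "(y i \<omega>)\<^sup>2 \<le> (\<Sum>i\<in>I. (y i \<omega>)\<^sup>2)"
    by (rule member_le_sum) (use i fin in auto)
  also have "\<dots> \<le> 1" using sum1[OF w] .
  finally show ?thesis by (simp add: abs_square_le_1)
qed

lemma integrable_mult2: "i \<in> I \<Longrightarrow> j \<in> I \<Longrightarrow> integrable M (\<lambda>\<omega>. y i \<omega> * y j \<omega>)"
  by (rule integrable_const_bound[where B=1])
    (auto intro!: AE_I2 mult_le_one simp: abs_mult abs_le_1)

lemma abs_mult4_le_1: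
  assumes "i \<in> I" "j \<in> I" "k \<in> I" "l \<in> I" "\<omega> \<in> space M"
  shows "\<bar>y i \<omega> * y j \<omega> * y k \<omega> * y l \<omega>\<bar> \<le> 1"
  unfolding abs_mult using assms by (intro mult_le_one abs_le_1) auto

lemma integrable_mult4: "i \<in> I \<Longrightarrow> j \<in> I \<Longrightarrow> k \<in> I \<Longrightarrow> l \<in> I \<Longrightarrow>
    integrable M (\<lambda>\<omega>. y i \<omega> * y j \<omega> * y k \<omega> * y l \<omega>)"
  by (rule integrable_const_bound[where B=1]) (auto intro!: AE_I2 abs_mult4_le_1)

abbreviation "N \<equiv> real (card I)"

lemma card_real_ge_4: "N \<ge> 4" using card4 by simp

text \<open>All \<open>N\<close> second moments agree by exchangeability, and their sum is at most
  1.\<close>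

lemma moment2:
  assumes i: "i \<in> I" shows "expectation (\<lambda>\<omega>. (y i \<omega>)\<^sup>2) \<le> 1 / N"
proof -
  have "(\<Sum>j\<in>I. expectation (\<lambda>\<omega>. y j \<omega> * y j \<omega>)) = N * expectation (\<lambda>\<omega>. y i \<omega> * y i \<omega>)"
    using exch2[OF i _ i i] by (subst sum.cong[OF refl, where h="\<lambda>_. expectation (\<lambda>\<omega>. y i \<omega> * y i \<omega>)"]) auto
  moreover have "(\<Sum>j\<in>I. expectation (\<lambda>\<omega>. y j \<omega> * y j \<omega>)) = expectation (\<lambda>\<omega>. \<Sum>j\<in>I. y j \<omega> * y j \<omega>)"
    by (rule Bochner_Integration.integral_sum[symmetric]) (auto intro: integrable_mult2)
  moreover have "expectation (\<lambda>\<omega>. \<Sum>j\<in>I. y j \<omega> * y j \<omega>) \<le> expectation (\<lambda>\<omega>. 1)"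
    by (intro integral_mono Bochner_Integration.integrable_sum integrable_mult2)
      (use sum1 in \<open>auto simp: power2_eq_square\<close>)
  ultimately have "N * expectation (\<lambda>\<omega>. y i \<omega> * y i \<omega>) \<le> 1" by (simp add: prob_space)
  then show ?thesis using card_real_ge_4 by (simp add: field_simps power2_eq_square)
qed

text \<open>
  The mixed moments are obtained by summing over one index: the full sum vanishes because
  \<open>\<Sum>y = 0\<close>, and by exchangeability all terms with a new index are equal.
\<close>

lemma moment11:
  assumes i: "i \<in> I" and j: "j \<in> I" and ij: "i \<noteq> j"
  shows "\<bar>expectation (\<lambda>\<omega>. y i \<omega> * y j \<omega>)\<bar> \<le> 2 / N\<^sup>2"
proof -
  let ?e = "expectation (\<lambda>\<omega>. y i \<omega> * y j \<omega>)"
  have eq: "expectation (\<lambda>\<omega>. y i \<omega> * y k \<omega>) = ?e" if "k \<in> I - {i}" for k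
    using exch2[OF j _ i j, of k] that ij by (auto simp: Transposition.transpose_def)
  have "0 = expectation (\<lambda>\<omega>. y i \<omega> * (\<Sum>k\<in>I. y k \<omega>))"
    using sum0 by (subst Bochner_Integration.integral_cong[OF refl, where g="\<lambda>_. 0"]) auto
  also have "\<dots> = (\<Sum>k\<in>I. expectation (\<lambda>\<omega>. y i \<omega> * y k \<omega>))"
    unfolding sum_distrib_left by (rule Bochner_Integration.integral_sum) (auto intro: integrable_mult2 i)
  also have "\<dots> = expectation (\<lambda>\<omega>. y i \<omega> * y i \<omega>) + (\<Sum>k\<in>I-{i}. expectation (\<lambda>\<omega>. y i \<omega> * y k \<omega>))"
    using fin i by (rule sum.remove)
  also have "(\<Sum>k\<in>I-{i}. expectation (\<lambda>\<omega>. y i \<omega> * y k \<omega>)) = (N - 1) * ?e"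
    using fin i card4 by (subst sum.cong[OF refl eq]) (simp_all add: card_Diff_singleton of_nat_diff)
  finally have "(N - 1) * ?e = - expectation (\<lambda>\<omega>. (y i \<omega>)\<^sup>2)" by (simp add: power2_eq_square)
  then have "\<bar>(N - 1) * ?e\<bar> = expectation (\<lambda>\<omega>. (y i \<omega>)\<^sup>2)" by simp
  then have *: "(N - 1) * \<bar>?e\<bar> = expectation (\<lambda>\<omega>. (y i \<omega>)\<^sup>2)" using card_real_ge_4 by (simp add: abs_mult)
  \<comment> \<open>\<open>N \<ge> 4\<close> gives \<open>N \<le> 2 (N - 1)\<close>; this is the
    factor 2 of the bound.\<close>
  have "N * \<bar>?e\<bar> \<le> 2 * ((N - 1) * \<bar>?e\<bar>)"
    using card_real_ge_4 by (intro mult_scale_le) auto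
  also have "\<dots> \<le> 2 * (1 / N)" unfolding * using moment2[OF i] by simp
  finally show ?thesis using card_real_ge_4 by (simp add: field_simps power2_eq_square)
qed

text \<open>Squares do not cancel, so the sum over the second index is bounded by
  \<open>\<Sum>y\<^sup>2 \<le> 1\<close> instead: the \<open>N - 1\<close> equal terms add up to at
  most the second moment of \<open>y i\<close>.\<close>

lemma moment22:
  assumes i: "i \<in> I" and j: "j \<in> I" and ij: "i \<noteq> j"
  shows "expectation (\<lambda>\<omega>. (y i \<omega>)\<^sup>2 * (y j \<omega>)\<^sup>2) \<le> 2 / N\<^sup>2"
proof -
  let ?e = "expectation (\<lambda>\<omega>. y i \<omega> * y i \<omega> * y j \<omega> * y j \<omega>)"
  have "y i \<omega> * y i \<omega> * y j \<omega> * y j \<omega> = (y i \<omega> * y j \<omega>)\<^sup>2" for \<omega>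
    by (simp add: power2_eq_square mult_ac)
  then have e0: "?e \<ge> 0" by (simp add: Bochner_Integration.integral_nonneg)
  have eq: "expectation (\<lambda>\<omega>. y i \<omega> * y i \<omega> * y k \<omega> * y k \<omega>) = ?e" if "k \<in> I - {i}" for k
    using exch4[OF j _ i i j j, of k] that ij by (auto simp: Transposition.transpose_def)
  have "(N - 1) * ?e = (\<Sum>k\<in>I-{i}. expectation (\<lambda>\<omega>. y i \<omega> * y i \<omega> * y k \<omega> * y k \<omega>))"
    using fin i card4 by (subst sum.cong[OF refl eq]) (simp_all add: card_Diff_singleton of_nat_diff)
  also have "\<dots> = expectation (\<lambda>\<omega>. \<Sum>k\<in>I-{i}. y i \<omega> * y i \<omega> * y k \<omega> * y k \<omega>)"
    by (rule Bochner_Integration.integral_sum[symmetric]) (auto intro: integrable_mult4 i)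
  also have "\<dots> \<le> expectation (\<lambda>\<omega>. y i \<omega> * y i \<omega>)"
  proof (intro integral_mono Bochner_Integration.integrable_sum integrable_mult4 integrable_mult2 i)
    fix \<omega> assume w: "\<omega> \<in> space M"
    have "(\<Sum>k\<in>I-{i}. (y k \<omega>)\<^sup>2) \<le> 1"
      using sum_mono2[of I "I-{i}" "\<lambda>k. (y k \<omega>)\<^sup>2"] sum1[OF w] fin by auto
    then have "y i \<omega> * y i \<omega> * (\<Sum>k\<in>I-{i}. (y k \<omega>)\<^sup>2) \<le> y i \<omega> * y i \<omega> * 1"
      by (intro mult_left_mono) auto
    then show "(\<Sum>k\<in>I-{i}. y i \<omega> * y i \<omega> * y k \<omega> * y k \<omega>) \<le> y i \<omega> * y i \<omega>"
      by (simp add: sum_distrib_left power2_eq_square mult.assoc)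
  qed auto
  also have "\<dots> \<le> 1 / N" using moment2[OF i] by (simp add: power2_eq_square)
  finally have *: "(N - 1) * ?e \<le> 1 / N" .
  have "N * ?e \<le> 2 * ((N - 1) * ?e)"
    using card_real_ge_4 e0 by (intro mult_scale_le) auto
  also have "\<dots> \<le> 2 * (1 / N)" using * by simp
  finally have "?e \<le> 2 / N\<^sup>2" using card_real_ge_4 by (simp add: field_simps power2_eq_square)
  then show ?thesis by (simp add: power2_eq_square mult.assoc)
qed

text \<open>\<open>2 a b \<le> a\<^sup>2 + b\<^sup>2\<close>, with one product per pair, reduces the
  claim to two instances of \<open>moment22\<close>. The two pairs may overlap; distinct indices
  within each pair are what keeps the pure fourth moment out.\<close>

lemma moment_pairs:
  assumes "i \<in> I" "j \<in> I" "i \<noteq> j" "k \<in> I" "l \<in> I" "k \<noteq> l"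
  shows "\<bar>expectation (\<lambda>\<omega>. y i \<omega> * y j \<omega> * y k \<omega> * y l \<omega>)\<bar> \<le> 2 / N\<^sup>2"
proof -
  have int: "integrable M (\<lambda>\<omega>. (y i \<omega>)\<^sup>2 * (y j \<omega>)\<^sup>2)" "integrable M (\<lambda>\<omega>. (y k \<omega>)\<^sup>2 * (y l \<omega>)\<^sup>2)"
    using integrable_mult4[of i i j j] integrable_mult4[of k k l l] assms by (auto simp: power2_eq_square mult.assoc)
  have "\<bar>expectation (\<lambda>\<omega>. y i \<omega> * y j \<omega> * y k \<omega> * y l \<omega>)\<bar>
      \<le> expectation (\<lambda>\<omega>. \<bar>y i \<omega> * y j \<omega> * y k \<omega> * y l \<omega>\<bar>)"
    by (rule integral_abs_bound)
  also have "\<dots> \<le> expectation (\<lambda>\<omega>. ((y i \<omega>)\<^sup>2 * (y j \<omega>)\<^sup>2 + (y k \<omega>)\<^sup>2 * (y l \<omega>)\<^sup>2) / 2)"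
  proof (rule integral_mono)
    show "integrable M (\<lambda>\<omega>. \<bar>y i \<omega> * y j \<omega> * y k \<omega> * y l \<omega>\<bar>)" by (intro integrable_abs integrable_mult4 assms)
    show "integrable M (\<lambda>\<omega>. ((y i \<omega>)\<^sup>2 * (y j \<omega>)\<^sup>2 + (y k \<omega>)\<^sup>2 * (y l \<omega>)\<^sup>2) / 2)" using int by simp
    fix \<omega>
    have "0 \<le> (\<bar>y i \<omega> * y j \<omega>\<bar> - \<bar>y k \<omega> * y l \<omega>\<bar>)\<^sup>2" by simp
    then show "\<bar>y i \<omega> * y j \<omega> * y k \<omega> * y l \<omega>\<bar> \<le> ((y i \<omega>)\<^sup>2 * (y j \<omega>)\<^sup>2 + (y k \<omega>)\<^sup>2 * (y l \<omega>)\<^sup>2) / 2"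
      by (simp add: power2_diff power_mult_distrib abs_mult mult_ac)
  qed
  also have "\<dots> = (expectation (\<lambda>\<omega>. (y i \<omega>)\<^sup>2 * (y j \<omega>)\<^sup>2) + expectation (\<lambda>\<omega>. (y k \<omega>)\<^sup>2 * (y l \<omega>)\<^sup>2)) / 2"
    using int by simp
  also have "\<dots> \<le> 2 / N\<^sup>2" using moment22[of i j] moment22[of k l] assms by simp
  finally show ?thesis .
qed

text \<open>Summed over the last index, the \<open>N - 3\<close> new indices give equal terms, and
  the three old ones give products with one squared factor, of order \<open>1 / N\<^sup>2\<close>.
  As the total vanishes, one more power of \<open>N\<close> is gained.\<close>

lemma moment1111:
  assumes I4: "i \<in> I" "j \<in> I" "k \<in> I" "l \<in> I"
    and d: "i \<noteq> j" "i \<noteq> k" "i \<noteq> l" "j \<noteq> k" "j \<noteq> l" "k \<noteq> l"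
  shows "\<bar>expectation (\<lambda>\<omega>. y i \<omega> * y j \<omega> * y k \<omega> * y l \<omega>)\<bar> \<le> 24 / N ^ 3"
proof -
  let ?E = "\<lambda>m. expectation (\<lambda>\<omega>. y i \<omega> * y j \<omega> * y k \<omega> * y m \<omega>)"
  have eq: "?E m = ?E l" if "m \<in> I - {i,j,k}" for m
    using exch4[of l m i j k l] that d I4 by (auto simp: Transposition.transpose_def)
  have "0 = expectation (\<lambda>\<omega>. y i \<omega> * y j \<omega> * y k \<omega> * (\<Sum>m\<in>I. y m \<omega>))"
    using sum0 by (subst Bochner_Integration.integral_cong[OF refl, where g="\<lambda>_. 0"]) auto
  also have "\<dots> = (\<Sum>m\<in>I. ?E m)"
    unfolding sum_distrib_left by (rule Bochner_Integration.integral_sum) (auto intro: integrable_mult4 I4)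
  also have "\<dots> = (\<Sum>m\<in>I - {i,j,k}. ?E m) + (\<Sum>m\<in>{i,j,k}. ?E m)"
    using fin I4 by (intro sum.subset_diff) auto
  also have "(\<Sum>m\<in>I - {i,j,k}. ?E m) = (N - 3) * ?E l"
    using fin I4 d card4 by (subst sum.cong[OF refl eq]) (simp_all add: card_Diff_subset of_nat_diff)
  also have "(\<Sum>m\<in>{i,j,k}. ?E m) = ?E i + ?E j + ?E k" using d by simp
  finally have *: "(N - 3) * ?E l = - ?E i - ?E j - ?E k" by simp
  \<comment> \<open>Factors are paired so that the two copies of the repeated index fall into
    different pairs; for \<open>?E k\<close> this means regrouping to \<open>j k\<close> and
    \<open>i k\<close>.\<close>
  have "\<bar>?E i\<bar> \<le> 2 / N\<^sup>2" "\<bar>?E j\<bar> \<le> 2 / N\<^sup>2" "\<bar>?E k\<bar> \<le> 2 / N\<^sup>2"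
    using moment_pairs[of i j k i] moment_pairs[of i j k j] moment_pairs[of j k i k] d I4
    by (auto simp: mult_ac)
  then have "\<bar>(N - 3) * ?E l\<bar> \<le> 6 / N\<^sup>2" unfolding * by auto
  then have b: "(N - 3) * \<bar>?E l\<bar> \<le> 6 / N\<^sup>2" using card_real_ge_4 by (simp add: abs_mult)
  \<comment> \<open>\<open>N \<ge> 4\<close> gives \<open>N \<le> 4 (N - 3)\<close>, and 4 times 6
    is 24.\<close>
  have "N * \<bar>?E l\<bar> \<le> 4 * ((N - 3) * \<bar>?E l\<bar>)"
    using card_real_ge_4 by (intro mult_scale_le) auto
  also have "\<dots> \<le> 24 / N\<^sup>2" using b by simp
  finally show ?thesis using card_real_ge_4 by (simp add: field_simps power2_eq_square power3_eq_cube)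
qed

end

section \<open>Second moments of linear and quadratic forms\<close>

lemma abs_mult_abs_right: "\<bar>a * \<bar>b\<bar>\<bar> = \<bar>a * b\<bar>" for a b :: real
  by (simp add: abs_mult)

lemma sum_mult_affine:
  fixes a A C :: real
  shows "(\<Sum>z\<in>J. a * c z * (A * D z + C)) = a * (A * (\<Sum>z\<in>J. c z * D z) + C * (\<Sum>z\<in>J. c z))"
  by (simp add: sum_distrib_left sum.distrib[symmetric] algebra_simps)

text \<open>Cauchy-Schwarz with \<open>c\<close> as weights, so that the total weight enters and not
  the number of terms.\<close>

lemma weighted_sum_sq_le:
  fixes c g :: "'b \<Rightarrow> real"
  assumes "\<And>x. x \<in> J \<Longrightarrow> 0 \<le> c x"
  shows "(\<Sum>x\<in>J. c x * g x)\<^sup>2 \<le> (\<Sum>x\<in>J. c x) * (\<Sum>x\<in>J. c x * (g x)\<^sup>2)"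
proof -
  have "(\<Sum>x\<in>J. c x * g x) = (\<Sum>x\<in>J. sqrt (c x) * (sqrt (c x) * g x))"
    using assms by (intro sum.cong) (auto simp: mult.assoc[symmetric])
  also have "\<dots>\<^sup>2 \<le> (\<Sum>x\<in>J. (sqrt (c x))\<^sup>2) * (\<Sum>x\<in>J. (sqrt (c x) * g x)\<^sup>2)"
    by (rule Cauchy_Schwarz_ineq_sum)
  also have "\<dots> = (\<Sum>x\<in>J. c x) * (\<Sum>x\<in>J. c x * (g x)\<^sup>2)"
    using assms by (intro arg_cong2[where f="(*)"] sum.cong) (auto simp: power_mult_distrib)
  finally show ?thesis .
qed

lemma (in prob_space) integrable_bounded_sq:
  fixes g :: "'a \<Rightarrow> real"
  assumes "g \<in> borel_measurable M" "\<And>\<omega>. \<omega> \<in> space M \<Longrightarrow> \<bar>g \<omega>\<bar> \<le> B"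
  shows "integrable M (\<lambda>\<omega>. (g \<omega>)\<^sup>2)"
proof (rule integrable_const_bound[where B="B\<^sup>2"])
  show "AE \<omega> in M. norm ((g \<omega>)\<^sup>2) \<le> B\<^sup>2"
  proof (rule AE_I2)
    fix \<omega> assume "\<omega> \<in> space M"
    then have "\<bar>g \<omega>\<bar>\<^sup>2 \<le> B\<^sup>2" by (intro power_mono assms) auto
    then show "norm ((g \<omega>)\<^sup>2) \<le> B\<^sup>2" by simp
  qed
qed (use assms(1) in measurable)

lemma (in prob_space) expectation_sq_sum_le:
  fixes g :: "'b \<Rightarrow> 'a \<Rightarrow> real"
  assumes int: "\<And>x z. x \<in> J \<Longrightarrow> z \<in> J \<Longrightarrow> integrable M (\<lambda>\<omega>. g x \<omega> * g z \<omega>)"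
    and b: "\<And>x z. x \<in> J \<Longrightarrow> z \<in> J \<Longrightarrow> \<bar>expectation (\<lambda>\<omega>. g x \<omega> * g z \<omega>)\<bar> \<le> b x z"
  shows "expectation (\<lambda>\<omega>. (\<Sum>x\<in>J. c x * g x \<omega>)\<^sup>2) \<le> (\<Sum>x\<in>J. \<Sum>z\<in>J. \<bar>c x\<bar> * \<bar>c z\<bar> * b x z)"
proof -
  have "(\<Sum>x\<in>J. c x * g x \<omega>)\<^sup>2 = (\<Sum>x\<in>J. \<Sum>z\<in>J. (c x * c z) * (g x \<omega> * g z \<omega>))" for \<omega>
    unfolding power2_eq_square sum_product by (intro sum.cong refl) (simp add: mult_ac)
  then have "expectation (\<lambda>\<omega>. (\<Sum>x\<in>J. c x * g x \<omega>)\<^sup>2)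
      = expectation (\<lambda>\<omega>. \<Sum>x\<in>J. \<Sum>z\<in>J. (c x * c z) * (g x \<omega> * g z \<omega>))" by simp
  also have "\<dots> = (\<Sum>x\<in>J. expectation (\<lambda>\<omega>. \<Sum>z\<in>J. (c x * c z) * (g x \<omega> * g z \<omega>)))"
    by (rule Bochner_Integration.integral_sum)
      (intro Bochner_Integration.integrable_sum integrable_mult_right int)
  also have "\<dots> = (\<Sum>x\<in>J. \<Sum>z\<in>J. expectation (\<lambda>\<omega>. (c x * c z) * (g x \<omega> * g z \<omega>)))"
    by (intro sum.cong refl Bochner_Integration.integral_sum integrable_mult_right int)
  also have "\<dots> = (\<Sum>x\<in>J. \<Sum>z\<in>J. (c x * c z) * expectation (\<lambda>\<omega>. g x \<omega> * g z \<omega>))"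
    by simp
  also have "\<dots> \<le> (\<Sum>x\<in>J. \<Sum>z\<in>J. \<bar>c x\<bar> * \<bar>c z\<bar> * b x z)"
  proof (intro sum_mono)
    fix x z assume xz: "x \<in> J" "z \<in> J"
    have "(c x * c z) * expectation (\<lambda>\<omega>. g x \<omega> * g z \<omega>)
       \<le> \<bar>c x\<bar> * \<bar>c z\<bar> * \<bar>expectation (\<lambda>\<omega>. g x \<omega> * g z \<omega>)\<bar>"
      unfolding abs_mult[symmetric] by (rule abs_ge_self)
    also have "\<dots> \<le> \<bar>c x\<bar> * \<bar>c z\<bar> * b x z"
      by (intro mult_left_mono b xz) simp
    finally show "(c x * c z) * expectation (\<lambda>\<omega>. g x \<omega> * g z \<omega>) \<le> \<bar>c x\<bar> * \<bar>c z\<bar> * b x z" .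
  qed
  finally show ?thesis .
qed

context exchangeable
begin

lemma abs_mult_le: "i \<in> I \<Longrightarrow> \<omega> \<in> space M \<Longrightarrow> \<bar>a * y i \<omega>\<bar> \<le> \<bar>a\<bar>"
  unfolding abs_mult by (rule mult_left_le[OF abs_le_1]) auto

lemma integrable_sq: "i \<in> I \<Longrightarrow> integrable M (\<lambda>\<omega>. (y i \<omega>)\<^sup>2)"
  using integrable_mult2[of i i] by (simp add: power2_eq_square)

text \<open>Absolute values offer no cancellation, so Cauchy-Schwarz and \<open>moment2\<close> have
  to do the work. A bounded total weight is what produces \<open>1 / N\<close>.\<close>

lemma expectation_abs_combination:
  assumes c: "\<And>x. x \<in> J \<Longrightarrow> 0 \<le> c x" and f: "\<And>x. x \<in> J \<Longrightarrow> f x \<in> I" and B: "(\<Sum>x\<in>J. c x) \<le> B"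
  shows "integrable M (\<lambda>\<omega>. (\<Sum>x\<in>J. c x * \<bar>y (f x) \<omega>\<bar>)\<^sup>2)"
    and "expectation (\<lambda>\<omega>. (\<Sum>x\<in>J. c x * \<bar>y (f x) \<omega>\<bar>)\<^sup>2) \<le> B\<^sup>2 / N"
proof -
  have c0: "0 \<le> (\<Sum>x\<in>J. c x)" using c by (rule sum_nonneg)
  show int: "integrable M (\<lambda>\<omega>. (\<Sum>x\<in>J. c x * \<bar>y (f x) \<omega>\<bar>)\<^sup>2)"
  proof (rule integrable_bounded_sq)
    show "(\<lambda>\<omega>. \<Sum>x\<in>J. c x * \<bar>y (f x) \<omega>\<bar>) \<in> borel_measurable M"
      using f by (intro borel_measurable_sum borel_measurable_times borel_measurable_abs) auto
    fix \<omega> assume "\<omega> \<in> space M"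
    then have "(\<Sum>x\<in>J. \<bar>c x * \<bar>y (f x) \<omega>\<bar>\<bar>) \<le> (\<Sum>x\<in>J. c x)"
      by (intro sum_mono order_trans[OF eq_refl[OF abs_mult_abs_right] order_trans[OF abs_mult_le]]) (simp_all add: f c)
    then show "\<bar>\<Sum>x\<in>J. c x * \<bar>y (f x) \<omega>\<bar>\<bar> \<le> (\<Sum>x\<in>J. c x)"
      by (rule order_trans[OF sum_abs])
  qed
  have "expectation (\<lambda>\<omega>. (\<Sum>x\<in>J. c x * \<bar>y (f x) \<omega>\<bar>)\<^sup>2)
      \<le> expectation (\<lambda>\<omega>. (\<Sum>x\<in>J. c x) * (\<Sum>x\<in>J. c x * (y (f x) \<omega>)\<^sup>2))"
  proof (rule integral_mono[OF int])
    show "integrable M (\<lambda>\<omega>. (\<Sum>x\<in>J. c x) * (\<Sum>x\<in>J. c x * (y (f x) \<omega>)\<^sup>2))"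
      using f by (intro integrable_mult_right Bochner_Integration.integrable_sum integrable_sq) auto
    show "(\<Sum>x\<in>J. c x * \<bar>y (f x) \<omega>\<bar>)\<^sup>2 \<le> (\<Sum>x\<in>J. c x) * (\<Sum>x\<in>J. c x * (y (f x) \<omega>)\<^sup>2)" for \<omega>
      using weighted_sum_sq_le[of J c "\<lambda>x. \<bar>y (f x) \<omega>\<bar>"] c by simp
  qed
  also have "\<dots> = (\<Sum>x\<in>J. c x) * (\<Sum>x\<in>J. c x * expectation (\<lambda>\<omega>. (y (f x) \<omega>)\<^sup>2))"
    using f integrable_sq by (simp add: Bochner_Integration.integral_sum)
  also have "\<dots> \<le> (\<Sum>x\<in>J. c x) * (\<Sum>x\<in>J. c x * (1 / N))"
    using c f c0 moment2 by (intro mult_left_mono sum_mono) auto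
  also have "\<dots> = (\<Sum>x\<in>J. c x)\<^sup>2 / N"
    by (simp add: sum_distrib_right[symmetric] sum_divide_distrib[symmetric] power2_eq_square)
  also have "\<dots> \<le> B\<^sup>2 / N" using c0 B by (intro divide_right_mono power_mono) auto
  finally show "expectation (\<lambda>\<omega>. (\<Sum>x\<in>J. c x * \<bar>y (f x) \<omega>\<bar>)\<^sup>2) \<le> B\<^sup>2 / N" .
qed

text \<open>The coefficients are bounded one by one and there may be \<open>N\<close> of them. Up to
  \<open>B\<^sup>2\<close>, the diagonal contributes at most \<open>N * (1 / N)\<close> and all
  pairs together at most \<open>N\<^sup>2 * (2 / N\<^sup>2)\<close>, distinct entries being nearly
  uncorrelated; hence the 3.\<close>

lemma expectation_linear_combination:
  assumes J: "finite J" and inj: "inj_on f J" and f: "\<And>x. x \<in> J \<Longrightarrow> f x \<in> I"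
    and c: "\<And>x. x \<in> J \<Longrightarrow> \<bar>c x\<bar> \<le> B"
  shows "integrable M (\<lambda>\<omega>. (\<Sum>x\<in>J. c x * y (f x) \<omega>)\<^sup>2)"
    and "expectation (\<lambda>\<omega>. (\<Sum>x\<in>J. c x * y (f x) \<omega>)\<^sup>2) \<le> 3 * B\<^sup>2"
proof -
  show "integrable M (\<lambda>\<omega>. (\<Sum>x\<in>J. c x * y (f x) \<omega>)\<^sup>2)"
  proof (rule integrable_bounded_sq)
    show "(\<lambda>\<omega>. \<Sum>x\<in>J. c x * y (f x) \<omega>) \<in> borel_measurable M"
      using f by (intro borel_measurable_sum borel_measurable_times) auto
    fix \<omega> assume "\<omega> \<in> space M"
    then have "(\<Sum>x\<in>J. \<bar>c x * y (f x) \<omega>\<bar>) \<le> (\<Sum>x\<in>J. \<bar>c x\<bar>)"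
      by (intro sum_mono abs_mult_le f)
    then show "\<bar>\<Sum>x\<in>J. c x * y (f x) \<omega>\<bar> \<le> (\<Sum>x\<in>J. \<bar>c x\<bar>)"
      by (rule order_trans[OF sum_abs])
  qed
  have cJ: "card J \<le> card I" using card_inj_on_le[OF inj _ fin] f by auto
  have e: "\<bar>expectation (\<lambda>\<omega>. y (f x) \<omega> * y (f z) \<omega>)\<bar> \<le> (if x = z then 1 / N else 0) + 2 / N\<^sup>2"
    if "x \<in> J" "z \<in> J" for x z
  proof (cases "x = z")
    case True
    have "0 \<le> expectation (\<lambda>\<omega>. (y (f x) \<omega>)\<^sup>2)" by (simp add: Bochner_Integration.integral_nonneg)
    then show ?thesis using True moment2[OF f[OF that(1)]] card_real_ge_4 by (simp add: power2_eq_square[symmetric] add_increasing2)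
  next
    case False
    then have "f x \<noteq> f z" using inj that by (auto dest: inj_onD)
    then show ?thesis using False moment11[of "f x" "f z"] f that by simp
  qed
  have "expectation (\<lambda>\<omega>. (\<Sum>x\<in>J. c x * y (f x) \<omega>)\<^sup>2)
     \<le> (\<Sum>x\<in>J. \<Sum>z\<in>J. \<bar>c x\<bar> * \<bar>c z\<bar> * ((if x = z then 1 / N else 0) + 2 / N\<^sup>2))"
    by (intro expectation_sq_sum_le integrable_mult2 f e)
  also have "\<dots> \<le> (\<Sum>x\<in>J. \<Sum>z\<in>J. B * B * ((if x = z then 1 / N else 0) + 2 / N\<^sup>2))"
    using c by (intro sum_mono mult_right_mono mult_mono) (auto intro: order_trans[OF abs_ge_zero])
  also have "\<dots> = B\<^sup>2 * (card J * (1 / N + card J * (2 / N\<^sup>2)))"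
    using J by (simp add: sum_distrib_left[symmetric] sum.distrib power2_eq_square)
  also have "\<dots> \<le> B\<^sup>2 * (N * (1 / N + N * (2 / N\<^sup>2)))"
    using cJ by (intro mult_left_mono mult_mono add_mono) auto
  also have "\<dots> = 3 * B\<^sup>2" using card_real_ge_4 by (simp add: field_simps power2_eq_square)
  finally show "expectation (\<lambda>\<omega>. (\<Sum>x\<in>J. c x * y (f x) \<omega>)\<^sup>2) \<le> 3 * B\<^sup>2" .
qed

text \<open>As in Schur's test, row and column sums of the coefficients are at most
  \<open>B\<close>. For fixed \<open>x\<close>, terms sharing an index with it weigh at most
  \<open>4 B\<close> and have moments up to \<open>2 / N\<^sup>2\<close>; the others weigh at most
  \<open>N B\<close> in total and have moments up to \<open>24 / N ^ 3\<close>. This gives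
  \<open>8 + 24 = 32\<close>. \<open>fh\<close> excludes squares, whose means would not
  cancel.\<close>

lemma expectation_quadratic_form:
  assumes J: "finite J" and f: "\<And>x. x \<in> J \<Longrightarrow> f x \<in> I" and h: "\<And>x. x \<in> J \<Longrightarrow> h x \<in> I"
    and fh: "\<And>x. x \<in> J \<Longrightarrow> f x \<noteq> h x" and B: "B \<ge> 0"
    and cf: "\<And>p. p \<in> I \<Longrightarrow> (\<Sum>x | x \<in> J \<and> f x = p. \<bar>c x\<bar>) \<le> B"
    and ch: "\<And>p. p \<in> I \<Longrightarrow> (\<Sum>x | x \<in> J \<and> h x = p. \<bar>c x\<bar>) \<le> B"
  shows "integrable M (\<lambda>\<omega>. (\<Sum>x\<in>J. c x * y (f x) \<omega> * y (h x) \<omega>)\<^sup>2)"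
    and "expectation (\<lambda>\<omega>. (\<Sum>x\<in>J. c x * y (f x) \<omega> * y (h x) \<omega>)\<^sup>2) \<le> 32 * B\<^sup>2 / N"
proof -
  show "integrable M (\<lambda>\<omega>. (\<Sum>x\<in>J. c x * y (f x) \<omega> * y (h x) \<omega>)\<^sup>2)"
  proof (rule integrable_bounded_sq)
    show "(\<lambda>\<omega>. \<Sum>x\<in>J. c x * y (f x) \<omega> * y (h x) \<omega>) \<in> borel_measurable M"
      using f h by (intro borel_measurable_sum borel_measurable_times) auto
    fix \<omega> assume "\<omega> \<in> space M"
    then have "(\<Sum>x\<in>J. \<bar>c x * y (f x) \<omega> * y (h x) \<omega>\<bar>) \<le> (\<Sum>x\<in>J. \<bar>c x\<bar>)"
      by (intro sum_mono order_trans[OF abs_mult_le abs_mult_le] f h)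
    then show "\<bar>\<Sum>x\<in>J. c x * y (f x) \<omega> * y (h x) \<omega>\<bar> \<le> (\<Sum>x\<in>J. \<bar>c x\<bar>)"
      by (rule order_trans[OF sum_abs])
  qed
  let ?E = "\<lambda>x z. expectation (\<lambda>\<omega>. y (f x) \<omega> * y (h x) \<omega> * y (f z) \<omega> * y (h z) \<omega>)"
  let ?d = "\<lambda>a b. if a = b then 1 else (0::real)"
  \<comment> \<open>Counts the coincidences between the index pairs of \<open>x\<close> and
    \<open>z\<close>.\<close>
  let ?D = "\<lambda>x z. ?d (f z) (f x) + ?d (h z) (f x) + ?d (f z) (h x) + ?d (h z) (h x)"
  have e: "\<bar>?E x z\<bar> \<le> 2 / N\<^sup>2 * ?D x z + 24 / N ^ 3" if "x \<in> J" "z \<in> J" for x z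
  proof (cases "f z = f x \<or> h z = f x \<or> f z = h x \<or> h z = h x")
    case True
    then have "2 / N\<^sup>2 * 1 \<le> 2 / N\<^sup>2 * ?D x z" by (intro mult_left_mono) auto
    moreover have "0 \<le> 24 / N ^ 3" by simp
    moreover have "\<bar>?E x z\<bar> \<le> 2 / N\<^sup>2" by (intro moment_pairs f h fh that)
    ultimately show ?thesis by linarith
  next
    case False
    then have "\<bar>?E x z\<bar> \<le> 24 / N ^ 3"
      using fh[OF that(1)] fh[OF that(2)] by (intro moment1111 f h that) metis+
    then show ?thesis using False by simp
  qed
  have row: "(\<Sum>z\<in>J. \<bar>c z\<bar> * ?d (g z) p) \<le> B" if "p \<in> I" "g = f \<or> g = h" for g p
  proof -
    have "(\<Sum>z\<in>J. \<bar>c z\<bar> * ?d (g z) p) = (\<Sum>z | z \<in> J \<and> g z = p. \<bar>c z\<bar>)"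
      by (rule sum.mono_neutral_cong_right) (use J in auto)
    then show ?thesis using that(2) cf[OF that(1)] ch[OF that(1)] by metis
  qed
  have const: "2 / N\<^sup>2 * (4 * B) + 24 / N ^ 3 * (N * B) = 32 * B / N\<^sup>2"
    using card_real_ge_4 by (simp add: field_simps power2_eq_square power3_eq_cube)
  have tot: "(\<Sum>x\<in>J. \<bar>c x\<bar>) \<le> N * B"
  proof -
    have "(\<Sum>x\<in>J. \<bar>c x\<bar>) = (\<Sum>p\<in>I. \<Sum>x | x \<in> J \<and> f x = p. \<bar>c x\<bar>)"
      by (rule sum.group[OF J fin image_subsetI[OF f], symmetric])
    also have "\<dots> \<le> (\<Sum>p\<in>I. B)" by (intro sum_mono cf)
    finally show ?thesis by simp
  qed
  have "expectation (\<lambda>\<omega>. (\<Sum>x\<in>J. c x * (y (f x) \<omega> * y (h x) \<omega>))\<^sup>2)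
     \<le> (\<Sum>x\<in>J. \<Sum>z\<in>J. \<bar>c x\<bar> * \<bar>c z\<bar> * (2 / N\<^sup>2 * ?D x z + 24 / N ^ 3))"
    by (intro expectation_sq_sum_le; unfold mult.assoc[symmetric]; intro e integrable_mult4 f h)
  also have "\<dots> = (\<Sum>x\<in>J. \<bar>c x\<bar> * (2 / N\<^sup>2 * (\<Sum>z\<in>J. \<bar>c z\<bar> * ?D x z) + 24 / N ^ 3 * (\<Sum>z\<in>J. \<bar>c z\<bar>)))"
    by (simp only: sum_mult_affine)
  also have "\<dots> \<le> (\<Sum>x\<in>J. \<bar>c x\<bar> * (2 / N\<^sup>2 * (4 * B) + 24 / N ^ 3 * (N * B)))"
  proof (intro sum_mono mult_left_mono add_mono tot)
    fix x assume x: "x \<in> J"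
    show "(\<Sum>z\<in>J. \<bar>c z\<bar> * ?D x z) \<le> 4 * B"
      using row[OF f[OF x] disjI1[OF refl]] row[OF f[OF x] disjI2[OF refl]]
        row[OF h[OF x] disjI1[OF refl]] row[OF h[OF x] disjI2[OF refl]]
      unfolding distrib_left sum.distrib by linarith
  qed auto
  also have "\<dots> = (\<Sum>x\<in>J. \<bar>c x\<bar>) * (32 * B / N\<^sup>2)"
    unfolding const sum_distrib_right ..
  also have "\<dots> \<le> N * B * (32 * B / N\<^sup>2)" using tot B by (intro mult_right_mono) auto
  also have "\<dots> = 32 * B\<^sup>2 / N" using card_real_ge_4 by (simp add: field_simps power2_eq_square)
  finally show "expectation (\<lambda>\<omega>. (\<Sum>x\<in>J. c x * y (f x) \<omega> * y (h x) \<omega>)\<^sup>2) \<le> 32 * B\<^sup>2 / N"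
    unfolding mult.assoc .
qed

end

section \<open>The inverse of a lag polynomial\<close>

text \<open>The inverse of \<open>1 - c X\<close> is a geometric series. Convolving with it adds
  \<open>n + 1\<close> terms of the same geometric size, so each factor costs one power of
  \<open>n + 1\<close>. Repeated roots need no special treatment, and the factors enter the bound
  only through their number and \<open>\<mu>\<close>.\<close>

lemma fps_inverse_prod_linear:
  assumes "\<And>c. c \<in> set cs \<Longrightarrow> cmod c \<le> \<mu>" and \<mu>: "0 \<le> \<mu>"
  shows "\<exists>\<Psi>. \<Psi> * fps_of_poly (\<Prod>c\<leftarrow>cs. [:1, - c:]) = 1
    \<and> (\<forall>n. cmod (fps_nth \<Psi> n) \<le> real (n + 1) ^ length cs * \<mu> ^ n)"
  using assms(1)
proof (induction cs)
  case Nil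
  have "cmod (fps_nth 1 n) \<le> \<mu> ^ n" for n using \<mu> by (cases n) auto
  then show ?case by (intro exI[of _ 1]) auto
next
  case (Cons c cs)
  then obtain \<Psi> where \<Psi>: "\<Psi> * fps_of_poly (\<Prod>c\<leftarrow>cs. [:1, - c:]) = 1"
    and b: "\<And>n. cmod (fps_nth \<Psi> n) \<le> real (n + 1) ^ length cs * \<mu> ^ n" by auto
  have c: "cmod c \<le> \<mu>" using Cons.prems by simp
  define E where "E = Abs_fps (\<lambda>n. c ^ n)"
  have E: "E * fps_of_poly [:1, - c:] = 1"
  proof (rule fps_ext)
    fix n
    have "E * fps_of_poly [:1, - c:] = E - fps_const c * (fps_X * E)"
      by (simp add: fps_of_poly_pCons fps_const_neg[symmetric] algebra_simps del: fps_const_neg)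
    then show "fps_nth (E * fps_of_poly [:1, - c:]) n = fps_nth 1 n"
      by (cases n) (auto simp: E_def)
  qed
  have "(\<Psi> * E) * fps_of_poly (\<Prod>c\<leftarrow>c # cs. [:1, - c:])
     = (\<Psi> * fps_of_poly (\<Prod>c\<leftarrow>cs. [:1, - c:])) * (E * fps_of_poly [:1, - c:])"
    by (simp only: list.map prod_list.Cons fps_of_poly_mult mult_ac)
  then have 1: "(\<Psi> * E) * fps_of_poly (\<Prod>c\<leftarrow>c # cs. [:1, - c:]) = 1" using E \<Psi> by simp
  have "cmod (fps_nth (\<Psi> * E) n) \<le> real (n + 1) ^ length (c # cs) * \<mu> ^ n" for n
  proof -
    have "cmod (fps_nth (\<Psi> * E) n) \<le> (\<Sum>i=0..n. cmod (fps_nth \<Psi> i * c ^ (n - i)))"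
      unfolding fps_mult_nth E_def by (simp add: norm_sum)
    also have "\<dots> \<le> (\<Sum>i=0..n. real (n + 1) ^ length cs * \<mu> ^ n)"
    proof (rule sum_mono)
      fix i assume i: "i \<in> {0..n}"
      have "cmod (fps_nth \<Psi> i * c ^ (n - i)) \<le> (real (i + 1) ^ length cs * \<mu> ^ i) * \<mu> ^ (n - i)"
        unfolding norm_mult norm_power using b c \<mu> by (intro mult_mono power_mono) auto
      also have "\<dots> = real (i + 1) ^ length cs * \<mu> ^ n"
        using i by (simp add: mult.assoc power_add[symmetric])
      also have "\<dots> \<le> real (n + 1) ^ length cs * \<mu> ^ n"
        using i \<mu> by (intro mult_right_mono power_mono) auto
      finally show "cmod (fps_nth \<Psi> i * c ^ (n - i)) \<le> real (n + 1) ^ length cs * \<mu> ^ n" .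
    qed
    finally show ?thesis by simp
  qed
  then show ?case using 1 by blast
qed

text \<open>A factor with \<open>cmod c \<le> 1\<close> adds to each coefficient at most the size of
  its lower neighbour, so the bound doubles.\<close>

lemma cmod_coeff_prod_linear_le:
  assumes "\<And>c. c \<in> set cs \<Longrightarrow> cmod c \<le> 1"
  shows "cmod (coeff (\<Prod>c\<leftarrow>cs. [:1, - c:]) n) \<le> 2 ^ length cs"
  using assms
proof (induction cs arbitrary: n)
  case (Cons c cs)
  let ?q = "\<Prod>c\<leftarrow>cs. [:1, - c:]"
  have IH: "cmod (coeff ?q m) \<le> 2 ^ length cs" for m using Cons by simp
  have c: "cmod c \<le> 1" using Cons.prems by simp
  have "(\<Prod>c\<leftarrow>c # cs. [:1, - c:]) = ?q + pCons 0 (Polynomial.smult (- c) ?q)" by simp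
  then have "coeff (\<Prod>c\<leftarrow>c # cs. [:1, - c:]) n
      = coeff ?q n + (case n of 0 \<Rightarrow> 0 | Suc m \<Rightarrow> - c * coeff ?q m)"
    by (cases n) simp_all
  also have "cmod \<dots> \<le> 2 ^ length cs + 2 ^ length cs"
  proof (rule norm_triangle_mono[OF IH])
    have "cmod c * cmod (coeff ?q m) \<le> 1 * 2 ^ length cs" for m
      using c IH by (intro mult_mono) auto
    then show "cmod (case n of 0 \<Rightarrow> 0 | Suc m \<Rightarrow> - c * coeff ?q m) \<le> 2 ^ length cs"
      by (cases n) (simp_all add: norm_mult)
  qed
  finally show ?case by simp
qed (cases n; simp)

text \<open>The \<open>c\<close> are the reciprocals of the roots. \<open>R > 0\<close> keeps the
  roots away from 0, and the constant term 1 forces the leftover scalar to be 1.\<close>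

lemma poly_prod_linear_factorization:
  fixes p :: "complex poly"
  assumes p0: "coeff p 0 = 1" and R: "R > 0" and roots: "\<And>z. poly p z = 0 \<Longrightarrow> cmod z \<ge> R"
  obtains cs where "p = (\<Prod>c\<leftarrow>cs. [:1, - c:])" "length cs = degree p"
    "\<And>c. c \<in> set cs \<Longrightarrow> cmod c \<le> 1 / R"
proof -
  obtain as where as: "Polynomial.smult (coeff p (degree p)) (\<Prod>a\<leftarrow>as. [:- a, 1:]) = p" "length as = degree p"
    using fundamental_theorem_algebra_factorized[of p] by blast
  have R': "cmod a \<ge> R" if "a \<in> set as" for a
  proof (rule roots)
    have "poly (\<Prod>a\<leftarrow>as. [:- a, 1:]) a = 0"
      using that by (force simp: poly_prod_list prod_list_zero_iff)
    then show "poly p a = 0" using as(1) by (metis mult_zero_right poly_smult)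
  qed
  have "\<exists>k. (\<Prod>a\<leftarrow>as. [:- a, 1:]) = Polynomial.smult k (\<Prod>c\<leftarrow>map inverse as. [:1, - c:])"
    using R'
  proof (induction as)
    case (Cons a as)
    then obtain k where k: "(\<Prod>a\<leftarrow>as. [:- a, 1:]) = Polynomial.smult k (\<Prod>c\<leftarrow>map inverse as. [:1, - c:])" by auto
    have "a \<noteq> 0" using Cons.prems[of a] R by auto
    then have "[:- a, 1:] = Polynomial.smult (- a) [:1, - inverse a:]" by simp
    then have "(\<Prod>a\<leftarrow>a # as. [:- a, 1:])
        = Polynomial.smult (k * - a) (\<Prod>c\<leftarrow>map inverse (a # as). [:1, - c:])"
      by (simp only: list.map prod_list.Cons k mult_smult_left mult_smult_right Polynomial.smult_smult)
    then show ?case by blast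
  qed (auto intro: exI[of _ 1])
  then obtain k' where k': "(\<Prod>a\<leftarrow>as. [:- a, 1:])
    = Polynomial.smult k' (\<Prod>c\<leftarrow>map inverse as. [:1, - c:])" by blast
  define k'' where "k'' = coeff p (degree p) * k'"
  have k'': "p = Polynomial.smult k'' (\<Prod>c\<leftarrow>map inverse as. [:1, - c:])"
    using as(1) unfolding k' k''_def Polynomial.smult_smult by (rule sym)
  have "poly (\<Prod>c\<leftarrow>map inverse as. [:1, - c:]) 0 = 1"
    by (induction as) auto
  then have "poly p 0 = k''" by (subst k'') (simp only: poly_smult mult_1_right)
  then have "k'' = 1" using p0 by (simp add: poly_0_coeff_0)
  then have "p = (\<Prod>c\<leftarrow>map inverse as. [:1, - c:])" using k'' by simp
  moreover have "cmod c \<le> 1 / R" if c: "c \<in> set (map inverse as)" for c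
  proof -
    obtain a where a: "a \<in> set as" "c = inverse a" using c unfolding set_map by blast
    have "inverse (cmod a) \<le> inverse R" by (rule le_imp_inverse_le[OF R'[OF a(1)] R])
    then show ?thesis unfolding a(2) norm_inverse by (simp add: inverse_eq_divide)
  qed
  ultimately show ?thesis using as(2) by (intro that[of "map inverse as"]) simp_all
qed

text \<open>The coefficients vary with the sample size while \<open>\<delta>\<close> is fixed, so
  the decay of \<open>\<psi>\<close> and the bound \<open>2 ^ K\<close> on the coefficients are both
  extracted from the roots. The limit \<open>min m K\<close> expresses the filter acting on a
  sequence continued by 0 to negative times.\<close>

lemma lag_polynomial_inverse:
  fixes r :: "nat \<Rightarrow> real" and \<delta> :: real
  assumes \<delta>: "\<delta> > 0"
    and roots: "\<And>z :: complex. 1 - (\<Sum>j=1..K. complex_of_real (r j) * z ^ j) = 0 \<Longrightarrow> cmod z \<ge> 1 + \<delta>"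
  obtains \<psi> :: "nat \<Rightarrow> real" where
    "\<And>n. \<bar>\<psi> n\<bar> \<le> real (n + 1) ^ K * (1 / (1 + \<delta>)) ^ n"
    "\<And>j. j \<in> {1..K} \<Longrightarrow> \<bar>r j\<bar> \<le> 2 ^ K"
    "\<And>v n. v n = (\<Sum>m\<le>n. \<psi> (n - m) * (v m - (\<Sum>j=1..min m K. r j * v (m - j))))"
proof -
  define p :: "complex poly" where "p = 1 - (\<Sum>j=1..K. monom (complex_of_real (r j)) j)"
  let ?\<mu> = "1 / (1 + \<delta>)"
  have coeff: "coeff p i = (if i = 0 then 1 else if i \<le> K then - complex_of_real (r i) else 0)" for i
    unfolding p_def by (simp add: coeff_sum)
  have deg: "degree p \<le> K" by (rule degree_le) (auto simp: coeff)
  have "poly p z = 1 - (\<Sum>j=1..K. complex_of_real (r j) * z ^ j)" for z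
    unfolding p_def by (simp add: poly_sum poly_monom)
  then have rt: "cmod z \<ge> 1 + \<delta>" if "poly p z = 0" for z using roots that by simp
  have p0: "coeff p 0 = 1" and \<delta>1: "1 + \<delta> > 0" using \<delta> by (simp_all add: coeff)
  obtain cs where cs: "p = (\<Prod>c\<leftarrow>cs. [:1, - c:])" "length cs = degree p"
    "\<And>c. c \<in> set cs \<Longrightarrow> cmod c \<le> ?\<mu>"
    using poly_prod_linear_factorization[OF p0 \<delta>1 rt] by blast
  have \<mu>: "0 \<le> ?\<mu>" "?\<mu> \<le> 1" using \<delta> by auto
  obtain \<Psi> where \<Psi>: "\<Psi> * fps_of_poly p = 1"
    and b: "\<And>n. cmod (fps_nth \<Psi> n) \<le> real (n + 1) ^ degree p * ?\<mu> ^ n"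
    using fps_inverse_prod_linear[of cs ?\<mu>, OF cs(3) \<mu>(1)] unfolding cs(1)[symmetric] cs(2) by blast
  show ?thesis
  proof
    show "\<bar>Re (fps_nth \<Psi> n)\<bar> \<le> real (n + 1) ^ K * ?\<mu> ^ n" for n
    proof -
      have "\<bar>Re (fps_nth \<Psi> n)\<bar> \<le> real (n + 1) ^ degree p * ?\<mu> ^ n"
        using b abs_Re_le_cmod order_trans by blast
      also have "\<dots> \<le> real (n + 1) ^ K * ?\<mu> ^ n"
        using deg \<mu> by (intro mult_right_mono power_increasing) auto
      finally show ?thesis .
    qed
    show "\<bar>r j\<bar> \<le> 2 ^ K" if j: "j \<in> {1..K}" for j
    proof -
      have "\<bar>r j\<bar> = cmod (coeff p j)" using j by (simp add: coeff)
      also have "\<dots> \<le> 2 ^ degree p"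
        using cmod_coeff_prod_linear_le[of cs j, OF order_trans[OF cs(3) \<mu>(2)]]
        unfolding cs(1)[symmetric] cs(2) by blast
      also have "\<dots> \<le> 2 ^ K" using deg by (intro power_increasing) auto
      finally show ?thesis .
    qed
    fix v :: "nat \<Rightarrow> real" and n
    let ?V = "Abs_fps (\<lambda>n. complex_of_real (v n))"
    have g: "fps_nth (fps_of_poly p * ?V) m = of_real (v m - (\<Sum>j=1..min m K. r j * v (m - j)))" for m
    proof -
      have "fps_nth (fps_of_poly p * ?V) m = (\<Sum>i=0..m. coeff p i * of_real (v (m - i)))"
        by (simp add: fps_mult_nth)
      also have "\<dots> = of_real (v m) + (\<Sum>i=1..m. coeff p i * of_real (v (m - i)))"
        by (simp add: sum.atLeast_Suc_atMost coeff)
      also have "(\<Sum>i=1..m. coeff p i * of_real (v (m - i)))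
          = (\<Sum>i=1..min m K. - of_real (r i * v (m - i)))"
        by (rule sum.mono_neutral_cong_right) (auto simp: coeff)
      finally show ?thesis by (simp add: sum_negf)
    qed
    have "complex_of_real (v n) = fps_nth (\<Psi> * (fps_of_poly p * ?V)) n"
      using \<Psi> by (simp add: mult.assoc[symmetric])
    also have "\<dots> = (\<Sum>i=0..n. fps_nth \<Psi> i
        * of_real (v (n - i) - (\<Sum>j=1..min (n - i) K. r j * v (n - i - j))))"
      unfolding fps_mult_nth[of \<Psi>] g ..
    also have "\<dots> = (\<Sum>m\<le>n. fps_nth \<Psi> (n - m) * of_real (v m - (\<Sum>j=1..min m K. r j * v (m - j))))"
      by (rule sum.reindex_bij_witness[of _ "\<lambda>i. n - i" "\<lambda>i. n - i"]) auto
    \<comment> \<open>The filtered values are real, so \<open>Re\<close> acts on the series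
      coefficient alone; that the series itself is real need not be shown.\<close>
    finally have "Re (complex_of_real (v n))
      = (\<Sum>m\<le>n. Re (fps_nth \<Psi> (n - m) * of_real (v m - (\<Sum>j=1..min m K. r j * v (m - j)))))"
      by simp
    then show "v n = (\<Sum>m\<le>n. Re (fps_nth \<Psi> (n - m)) * (v m - (\<Sum>j=1..min m K. r j * v (m - j))))"
      by (simp del: of_real_diff of_real_sum)
  qed
qed

section \<open>Normal equations\<close>

text \<open>One Gram-Schmidt step per regressor: with \<open>e\<close> and \<open>w\<close> the
  residuals of \<open>y\<close> and of the new regressor on the first \<open>n\<close> ones,
  \<open>e\<close> is regressed on \<open>w\<close>. This covers linearly dependent regressors, and
  thereby singular Gram matrices.\<close>

lemma normal_equations_solvable:
  fixes x :: "nat \<Rightarrow> 's \<Rightarrow> real" and y :: "'s \<Rightarrow> real"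
  assumes "finite S"
  shows "\<exists>c. \<forall>i<n. (\<Sum>t\<in>S. x i t * (y t - (\<Sum>j<n. c j * x j t))) = 0"
proof (induction n arbitrary: y)
  case (Suc n)
  obtain c where c: "\<And>i. i < n \<Longrightarrow> (\<Sum>t\<in>S. x i t * (y t - (\<Sum>j<n. c j * x j t))) = 0"
    using Suc.IH[of y] by blast
  obtain d where d: "\<And>i. i < n \<Longrightarrow> (\<Sum>t\<in>S. x i t * (x n t - (\<Sum>j<n. d j * x j t))) = 0"
    using Suc.IH[of "x n"] by blast
  define e where "e t = y t - (\<Sum>j<n. c j * x j t)" for t
  define w where "w t = x n t - (\<Sum>j<n. d j * x j t)" for t
  \<comment> \<open>If \<open>w\<close> vanishes on \<open>S\<close>, division by 0 yields
    \<open>k = 0\<close>, and any value would do.\<close>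
  define k where "k = (\<Sum>t\<in>S. w t * e t) / (\<Sum>t\<in>S. w t * w t)"
  define c' where "c' j = (if j = n then k else c j - k * d j)" for j
  have res: "y t - (\<Sum>j<Suc n. c' j * x j t) = e t - k * w t" for t
  proof -
    have "(\<Sum>j<Suc n. c' j * x j t) = (\<Sum>j<n. (c j - k * d j) * x j t) + k * x n t"
      by (simp add: c'_def)
    also have "(\<Sum>j<n. (c j - k * d j) * x j t) = (\<Sum>j<n. c j * x j t) - k * (\<Sum>j<n. d j * x j t)"
      by (simp add: sum_subtractf sum_distrib_left left_diff_distrib mult.assoc)
    finally show ?thesis by (simp add: e_def w_def algebra_simps)
  qed
  have orth: "(\<Sum>t\<in>S. x i t * (e t - k * w t)) = 0" if "i < n" for i
  proof -
    have "(\<Sum>t\<in>S. x i t * (e t - k * w t)) = (\<Sum>t\<in>S. x i t * e t) - k * (\<Sum>t\<in>S. x i t * w t)"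
      by (simp add: sum_subtractf sum_distrib_left algebra_simps)
    then show ?thesis using c[OF that] d[OF that] by (simp add: e_def w_def)
  qed
  have w: "(\<Sum>t\<in>S. w t * (e t - k * w t)) = 0"
  proof -
    have *: "(\<Sum>t\<in>S. w t * (e t - k * w t)) = (\<Sum>t\<in>S. w t * e t) - k * (\<Sum>t\<in>S. w t * w t)"
      by (simp add: sum_subtractf sum_distrib_left algebra_simps)
    show ?thesis
    proof (cases "(\<Sum>t\<in>S. w t * w t) = 0")
      case True
      then have "\<forall>t\<in>S. w t = 0" using assms by (simp add: sum_nonneg_eq_0_iff)
      then show ?thesis by simp
    next
      case False
      then show ?thesis unfolding * by (simp add: k_def)
    qed
  qed
  have "(\<Sum>t\<in>S. x n t * (e t - k * w t))
      = (\<Sum>t\<in>S. w t * (e t - k * w t)) + (\<Sum>t\<in>S. \<Sum>j<n. d j * x j t * (e t - k * w t))"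
    unfolding sum.distrib[symmetric] sum_distrib_right[symmetric]
    by (intro sum.cong) (simp_all add: w_def algebra_simps)
  also have "(\<Sum>t\<in>S. \<Sum>j<n. d j * x j t * (e t - k * w t))
      = (\<Sum>j<n. d j * (\<Sum>t\<in>S. x j t * (e t - k * w t)))"
    by (subst sum.swap) (simp add: sum_distrib_left mult.assoc)
  also have "\<dots> = 0" using orth by simp
  finally have "(\<Sum>t\<in>S. x n t * (e t - k * w t)) = 0" using w by simp
  then have "\<forall>i<Suc n. (\<Sum>t\<in>S. x i t * (y t - (\<Sum>j<Suc n. c' j * x j t))) = 0"
    unfolding res using orth by (simp add: less_Suc_eq)
  then show ?case by blast
qed simp

lemma proxy_eq_sum:
  assumes "r \<in> carrier_vec (K + 1)"
  shows "proxy K r Y t = (\<Sum>j<K+1. r $ j * regressor K Y t $ j)"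
  using assms by (simp add: proxy_def scalar_prod_def atLeast0LessThan mult.commute)

lemma regressor_sum:
  "(\<Sum>j<K+1. a j * regressor K Y t $ j) = a 0 + (\<Sum>j=1..K. a j * Y (t - j))"
proof -
  have "(\<Sum>j<K+1. a j * regressor K Y t $ j) = (\<Sum>j=0..K. a j * (if j = 0 then 1 else Y (t - j)))"
    by (intro sum.cong) (auto simp: regressor_def)
  also have "\<dots> = a 0 + (\<Sum>j=1..K. a j * (if j = 0 then 1 else Y (t - j)))"
    by (subst sum.atLeast_Suc_atMost) auto
  finally show ?thesis by simp
qed

lemma normal_equations_iff:
  assumes r: "r \<in> carrier_vec (K + 1)"
  shows "gram K T Y *\<^sub>v r = cross_moment K T Y \<longleftrightarrow>
    (\<forall>i<K+1. (\<Sum>t=K+1..T. regressor K Y t $ i * (Y t - proxy K r Y t)) = 0)"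
proof -
  have "(gram K T Y *\<^sub>v r) $ i = (\<Sum>t=K+1..T. regressor K Y t $ i * proxy K r Y t)" if i: "i < K + 1" for i
  proof -
    have "(gram K T Y *\<^sub>v r) $ i
        = (\<Sum>j<K+1. (\<Sum>t=K+1..T. regressor K Y t $ i * regressor K Y t $ j) * r $ j)"
      using r i by (simp add: gram_def scalar_prod_def atLeast0LessThan)
    also have "\<dots> = (\<Sum>j<K+1. \<Sum>t=K+1..T. regressor K Y t $ i * (r $ j * regressor K Y t $ j))"
      unfolding sum_distrib_right by (intro sum.cong) (simp_all add: mult_ac)
    also have "\<dots> = (\<Sum>t=K+1..T. \<Sum>j<K+1. regressor K Y t $ i * (r $ j * regressor K Y t $ j))"
      by (rule sum.swap)
    finally show ?thesis unfolding proxy_eq_sum[OF r] sum_distrib_left .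
  qed
  moreover have "cross_moment K T Y $ i = (\<Sum>t=K+1..T. regressor K Y t $ i * Y t)" if "i < K + 1" for i
    using that by (simp add: cross_moment_def)
  moreover have "gram K T Y *\<^sub>v r = cross_moment K T Y \<longleftrightarrow>
      (\<forall>i<K+1. (gram K T Y *\<^sub>v r) $ i = cross_moment K T Y $ i)"
    by (auto simp: vec_eq_iff gram_def cross_moment_def)
  ultimately show ?thesis
    by (auto simp: right_diff_distrib sum_subtractf)
qed

text \<open>For a singular Gram matrix, \<open>normal_equations_solvable\<close> supplies the
  witness for the choice in \<open>ols\<close>, so both cases of the definition end in the same
  equations.\<close>

lemma ols_normal_equations:
  shows "ols K T Y \<in> carrier_vec (K + 1)"
    and "\<forall>i<K+1. (\<Sum>t=K+1..T. regressor K Y t $ i * (Y t - proxy K (ols K T Y) Y t)) = 0"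
proof -
  have G: "gram K T Y \<in> carrier_mat (K + 1) (K + 1)" by (simp add: gram_def)
  have C: "cross_moment K T Y \<in> carrier_vec (K + 1)" by (simp add: cross_moment_def)
  have "ols K T Y \<in> carrier_vec (K + 1) \<and> gram K T Y *\<^sub>v ols K T Y = cross_moment K T Y"
  proof (cases "mat_inverse (gram K T Y)")
    case None
    obtain c where "\<forall>i<K+1. (\<Sum>t\<in>{K+1..T}. regressor K Y t $ i *
        (Y t - (\<Sum>j<K+1. c j * regressor K Y t $ j))) = 0"
      using normal_equations_solvable[of "{K+1..T}" "K + 1" "\<lambda>i t. regressor K Y t $ i" Y] by blast
    then have "gram K T Y *\<^sub>v vec (K + 1) c = cross_moment K T Y"
      by (simp add: normal_equations_iff proxy_eq_sum)
    then have "\<exists>r. r \<in> carrier_vec (K + 1) \<and> gram K T Y *\<^sub>v r = cross_moment K T Y"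
      by (intro exI[of _ "vec (K + 1) c"]) simp
    then show ?thesis unfolding ols_def None option.case by (rule someI_ex)
  next
    case (Some G')
    have G': "gram K T Y * G' = 1\<^sub>m (K + 1)" "G' \<in> carrier_mat (K + 1) (K + 1)"
      using mat_inverse(2)[OF G Some] by auto
    have "gram K T Y *\<^sub>v (G' *\<^sub>v cross_moment K T Y) = (gram K T Y * G') *\<^sub>v cross_moment K T Y"
      using assoc_mult_mat_vec[OF G G'(2) C] by simp
    then show ?thesis using G' C by (simp add: ols_def Some)
  qed
  then show "ols K T Y \<in> carrier_vec (K + 1)"
    and "\<forall>i<K+1. (\<Sum>t=K+1..T. regressor K Y t $ i * (Y t - proxy K (ols K T Y) Y t)) = 0"
    using normal_equations_iff by blast+
qed

section \<open>Bounds along a sample path\<close>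

text \<open>With the constant scaled to order one, the Gram matrix of the constant and the
  \<open>K\<close> shifts is within \<open>\<theta>\<close> of the identity in each entry, from
  below on the diagonal. The quadratic form thus loses at most the fraction
  \<open>(K + 1) \<theta> < 1 / 2\<close>. The alternative \<open>\<alpha> j = 0\<close> serves a
  constant sample, where \<open>y\<close> is 0 but so is every slope \<open>a j * s\<close>.\<close>

lemma near_orthogonal_coercive:
  fixes y \<alpha> :: "nat \<Rightarrow> real" and b \<theta> :: real and K N :: nat
  defines "\<theta> \<equiv> 1 / (2 * real K + 4)"
  assumes diag: "\<And>j. j \<in> {1..K} \<Longrightarrow> \<alpha> j = 0 \<or> (\<Sum>t=2*K+1..N. (y (t - j))\<^sup>2) \<ge> 1 - \<theta>"
    and cross: "\<And>i j. i \<in> {1..K} \<Longrightarrow> j \<in> {1..K} \<Longrightarrow> i \<noteq> j \<Longrightarrow>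
      \<bar>\<Sum>t=2*K+1..N. y (t - i) * y (t - j)\<bar> \<le> \<theta>"
    and lin: "\<And>j. j \<in> {1..K} \<Longrightarrow> \<bar>\<Sum>t=2*K+1..N. y (t - j)\<bar> \<le> \<theta> * sqrt N"
    and N: "2 * real K \<le> \<theta> * N"
  shows "N * b\<^sup>2 + (\<Sum>j=1..K. (\<alpha> j)\<^sup>2) \<le> 2 * (\<Sum>t=2*K+1..N. (b + (\<Sum>j=1..K. \<alpha> j * y (t - j)))\<^sup>2)"
proof -
  let ?S = "{2*K+1..N}"
  let ?A = "\<Sum>j=1..K. (\<alpha> j)\<^sup>2"
  have \<theta>: "\<theta> > 0" "\<theta> * (real K + 2) = 1 / 2" by (auto simp: \<theta>_def field_simps)
  have expand: "(\<Sum>t\<in>?S. (b + (\<Sum>j=1..K. \<alpha> j * y (t - j)))\<^sup>2)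
    = card ?S * b\<^sup>2 + (\<Sum>j=1..K. 2 * b * \<alpha> j * (\<Sum>t\<in>?S. y (t - j)))
      + (\<Sum>i=1..K. \<Sum>j=1..K. \<alpha> i * \<alpha> j * (\<Sum>t\<in>?S. y (t - i) * y (t - j)))"
  proof -
    have "(b + (\<Sum>j=1..K. \<alpha> j * y (t - j)))\<^sup>2 = b\<^sup>2 + (\<Sum>j=1..K. 2 * b * \<alpha> j * y (t - j))
       + (\<Sum>i=1..K. \<Sum>j=1..K. \<alpha> i * \<alpha> j * (y (t - i) * y (t - j)))" for t
    proof -
      let ?w = "\<Sum>j=1..K. \<alpha> j * y (t - j)"
      have "2 * b * ?w = (\<Sum>j=1..K. 2 * b * \<alpha> j * y (t - j))"
        by (simp add: sum_distrib_left mult.assoc)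
      moreover have "?w\<^sup>2 = (\<Sum>i=1..K. \<Sum>j=1..K. \<alpha> i * \<alpha> j * (y (t - i) * y (t - j)))"
        unfolding power2_eq_square sum_product by (intro sum.cong refl) (simp add: mult_ac)
      ultimately show ?thesis by (simp add: power2_sum)
    qed
    moreover have "(\<Sum>t\<in>?S. \<Sum>j=1..K. 2 * b * \<alpha> j * y (t - j)) = (\<Sum>j=1..K. 2 * b * \<alpha> j * (\<Sum>t\<in>?S. y (t - j)))"
      unfolding sum_distrib_left by (rule sum.swap)
    moreover have "(\<Sum>t\<in>?S. \<Sum>i=1..K. \<Sum>j=1..K. \<alpha> i * \<alpha> j * (y (t - i) * y (t - j)))
       = (\<Sum>i=1..K. \<Sum>j=1..K. \<alpha> i * \<alpha> j * (\<Sum>t\<in>?S. y (t - i) * y (t - j)))"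
      unfolding sum_distrib_left by (subst sum.swap) (intro sum.cong refl sum.swap)
    ultimately show ?thesis by (simp add: sum.distrib)
  qed
  have c: "card ?S * b\<^sup>2 \<ge> (N - \<theta> * N) * b\<^sup>2"
    using N by (intro mult_right_mono) auto
  have l: "(\<Sum>j=1..K. 2 * b * \<alpha> j * (\<Sum>t\<in>?S. y (t - j))) \<ge> (\<Sum>j=1..K. - \<theta> * (N * b\<^sup>2 + (\<alpha> j)\<^sup>2))"
  proof (rule sum_mono)
    fix j assume j: "j \<in> {1..K}"
    have "\<bar>2 * b * \<alpha> j * (\<Sum>t\<in>?S. y (t - j))\<bar> \<le> 2 * \<bar>b\<bar> * \<bar>\<alpha> j\<bar> * (\<theta> * sqrt N)"
      unfolding abs_mult using lin[OF j] by (intro mult_mono) auto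
    also have "\<dots> = \<theta> * (2 * (\<bar>b\<bar> * sqrt N) * \<bar>\<alpha> j\<bar>)" by simp
    also have "\<dots> \<le> \<theta> * ((\<bar>b\<bar> * sqrt N)\<^sup>2 + \<bar>\<alpha> j\<bar>\<^sup>2)"
      using \<theta>(1) sum_squares_bound[of "\<bar>b\<bar> * sqrt N" "\<bar>\<alpha> j\<bar>"] by (intro mult_left_mono) auto
    also have "\<dots> = \<theta> * (N * b\<^sup>2 + (\<alpha> j)\<^sup>2)" by (simp add: power_mult_distrib)
    finally show "- \<theta> * (N * b\<^sup>2 + (\<alpha> j)\<^sup>2) \<le> 2 * b * \<alpha> j * (\<Sum>t\<in>?S. y (t - j))" by linarith
  qed
  have q: "(\<Sum>i=1..K. \<Sum>j=1..K. \<alpha> i * \<alpha> j * (\<Sum>t\<in>?S. y (t - i) * y (t - j)))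
    \<ge> (\<Sum>i=1..K. \<Sum>j=1..K. (if i = j then (\<alpha> j)\<^sup>2 else 0) - \<theta> * (\<bar>\<alpha> i\<bar> * \<bar>\<alpha> j\<bar>))"
  proof (intro sum_mono)
    fix i j assume ij: "i \<in> {1..K}" "j \<in> {1..K}"
    show "(if i = j then (\<alpha> j)\<^sup>2 else 0) - \<theta> * (\<bar>\<alpha> i\<bar> * \<bar>\<alpha> j\<bar>)
      \<le> \<alpha> i * \<alpha> j * (\<Sum>t\<in>?S. y (t - i) * y (t - j))"
    proof (cases "i = j")
      case True
      show ?thesis
      proof (cases "\<alpha> j = 0")
        case False
        then have "(\<alpha> j)\<^sup>2 * (\<Sum>t\<in>?S. (y (t - j))\<^sup>2) \<ge> (\<alpha> j)\<^sup>2 * (1 - \<theta>)"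
          using diag[OF ij(2)] by (intro mult_left_mono) auto
        then show ?thesis using True by (simp add: power2_eq_square algebra_simps)
      qed (use True in simp)
    next
      case False
      have "\<bar>\<alpha> i * \<alpha> j * (\<Sum>t\<in>?S. y (t - i) * y (t - j))\<bar> \<le> \<bar>\<alpha> i\<bar> * \<bar>\<alpha> j\<bar> * \<theta>"
        unfolding abs_mult using cross[OF ij False] by (intro mult_left_mono) auto
      then show ?thesis using False by (simp add: mult_ac)
    qed
  qed
  have "(\<Sum>i=1..K. \<Sum>j=1..K. (if i = j then (\<alpha> j)\<^sup>2 else 0) - \<theta> * (\<bar>\<alpha> i\<bar> * \<bar>\<alpha> j\<bar>))
     = ?A - \<theta> * (\<Sum>i=1..K. \<bar>\<alpha> i\<bar>)\<^sup>2"
  proof -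
    have "(\<Sum>i=1..K. \<Sum>j=1..K. \<theta> * (\<bar>\<alpha> i\<bar> * \<bar>\<alpha> j\<bar>)) = \<theta> * (\<Sum>i=1..K. \<bar>\<alpha> i\<bar>)\<^sup>2"
      unfolding power2_eq_square sum_product by (simp only: sum_distrib_left)
    then show ?thesis by (simp add: sum_subtractf)
  qed
  moreover have "(\<Sum>i=1..K. \<bar>\<alpha> i\<bar>)\<^sup>2 \<le> K * ?A"
    using Cauchy_Schwarz_ineq_sum[of "\<lambda>_. 1" "\<lambda>i. \<bar>\<alpha> i\<bar>" "{1..K}"] by simp
  then have "\<theta> * (\<Sum>i=1..K. \<bar>\<alpha> i\<bar>)\<^sup>2 \<le> \<theta> * (K * ?A)" using \<theta>(1) by (intro mult_left_mono) auto
  moreover have "(\<Sum>j=1..K. - \<theta> * (N * b\<^sup>2 + (\<alpha> j)\<^sup>2)) = - \<theta> * (K * (N * b\<^sup>2) + ?A)"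
    by (simp add: sum_distrib_left[symmetric] sum.distrib sum_negf)
  ultimately have "(\<Sum>t\<in>?S. (b + (\<Sum>j=1..K. \<alpha> j * y (t - j)))\<^sup>2)
    \<ge> (N - \<theta> * N) * b\<^sup>2 - \<theta> * (K * (N * b\<^sup>2) + ?A) + ?A - \<theta> * (K * ?A)"
    unfolding expand using c l q by linarith
  \<comment> \<open>Only \<open>K + 1\<close> multiples of \<open>\<theta>\<close> are lost; the
    choice with \<open>K + 2\<close> makes the factor exactly one half and leaves a nonnegative
    remainder.\<close>
  also have "(N - \<theta> * N) * b\<^sup>2 - \<theta> * (K * (N * b\<^sup>2) + ?A) + ?A - \<theta> * (K * ?A)
    = (N * b\<^sup>2 + ?A) * (1 - \<theta> * (real K + 2)) + \<theta> * (N * b\<^sup>2 + ?A)"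
    by (simp add: algebra_simps)
  finally have "(N * b\<^sup>2 + ?A) * (1 - 1 / 2) + \<theta> * (N * b\<^sup>2 + ?A)
      \<le> (\<Sum>t\<in>?S. (b + (\<Sum>j=1..K. \<alpha> j * y (t - j)))\<^sup>2)"
    unfolding \<theta>(2) .
  moreover have "0 \<le> \<theta> * (N * b\<^sup>2 + ?A)"
    using \<theta>(1) by (intro mult_nonneg_nonneg add_nonneg_nonneg sum_nonneg) auto
  moreover have "X * (1 - 1 / 2) + Z \<le> W \<Longrightarrow> 0 \<le> Z \<Longrightarrow> X \<le> 2 * W" for X Z W :: real
    by simp
  ultimately show ?thesis by blast
qed

text \<open>
  \<open>m\<close> and \<open>s\<close> are the sample mean of the noise and its sample norm after centring, and \<open>\<psi>\<close> is the
  inverse of the lag filter. The initial values \<open>Y 1, \<dots>, Y K\<close> are unconstrained.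
\<close>

locale ar_path =
  fixes K N :: nat and r Y u y \<psi> \<beta> :: "nat \<Rightarrow> real" and m s B :: real
  assumes model: "\<And>t. t \<in> {K+1..N} \<Longrightarrow> Y t = r 0 + (\<Sum>j=1..K. r j * Y (t - j)) + u t"
    and noise: "\<And>t. t \<in> {1..N} \<Longrightarrow> u t = m + s * y t"
    and normed: "s = 0 \<or> (\<Sum>t=1..N. (y t)\<^sup>2) = 1"
    and s0: "s \<ge> 0" and N0: "N > 0"
    and r_le: "\<And>j. j \<in> {1..K} \<Longrightarrow> \<bar>r j\<bar> \<le> 2 ^ K"
    and \<psi>_le: "\<And>n. \<bar>\<psi> n\<bar> \<le> \<beta> n"
    and sum_\<beta>: "\<And>A. finite A \<Longrightarrow> sum \<beta> A \<le> B"
    and inverse: "\<And>v n. v n = (\<Sum>m\<le>n. \<psi> (n - m) * (v m - (\<Sum>j=1..min m K. r j * v (m - j))))"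
begin

lemma \<beta>_nonneg: "0 \<le> \<beta> n"
  using \<psi>_le[of n] by linarith

text \<open>The lag filter applied to the restriction of \<open>v\<close> to \<open>{K+1..}\<close>, extended by 0.\<close>

definition filtered :: "(nat \<Rightarrow> real) \<Rightarrow> nat \<Rightarrow> real" where
  "filtered v t = v t - (\<Sum>j=1..min (t - (K+1)) K. r j * v (t - j))"

text \<open>Time is restarted at \<open>K + 1\<close>, so the recovery uses no earlier value of
  \<open>v\<close>.\<close>

lemma unfilter:
  assumes "t \<ge> K + 1"
  shows "v t = (\<Sum>q=K+1..t. \<psi> (t - q) * filtered v q)"
proof -
  have "v t = v (K + 1 + (t - (K+1)))" using assms by simp
  also have "\<dots> = (\<Sum>m\<le>t - (K+1). \<psi> (t - (K+1) - m) * (v (K + 1 + m) -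
      (\<Sum>j=1..min m K. r j * v (K + 1 + (m - j)))))"
    by (rule inverse[of "\<lambda>n. v (K + 1 + n)"])
  also have "\<dots> = (\<Sum>m\<le>t - (K+1). \<psi> (t - (K+1) - m) * filtered v (K + 1 + m))"
    unfolding filtered_def by (intro sum.cong arg_cong2[where f="(*)"] arg_cong2[where f="(-)"] refl)
      (auto simp: Suc_diff_le)
  also have "\<dots> = (\<Sum>q=K+1..t. \<psi> (t - q) * filtered v q)"
    by (rule sum.reindex_bij_witness[of _ "\<lambda>q. q - (K+1)" "\<lambda>m. K + 1 + m"]) (use assms in auto)
  finally show ?thesis .
qed

definition fit :: "(nat \<Rightarrow> real) \<Rightarrow> nat \<Rightarrow> real" where
  "fit a t = a 0 + (\<Sum>j=1..K. a j * Y (t - j))"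

text \<open>The constant \<open>b\<close> of the overview: the filter multiplies the intercept by
  its value at 1 and turns each lag of \<open>Y\<close> into \<open>r 0 + m\<close> plus centred
  noise.\<close>

definition level :: "(nat \<Rightarrow> real) \<Rightarrow> real" where
  "level a = a 0 * (1 - (\<Sum>j=1..K. r j)) + (\<Sum>j=1..K. a j * (r 0 + m))"

text \<open>Filter and lags commute, and the filter turns \<open>Y (t - j)\<close> into
  \<open>r 0 + u (t - j)\<close>. This uses the model at \<open>t - j\<close> for every
  \<open>j\<close> up to \<open>K\<close>, hence the start at \<open>2 * K + 1\<close>.\<close>

lemma filtered_fit:
  assumes t: "t \<in> {2*K+1..N}"
  shows "filtered (fit a) t = level a + (\<Sum>j=1..K. (a j * s) * y (t - j))"
proof -
  have K: "min (t - (K+1)) K = K" using t by auto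
  have "(\<Sum>i=1..K. r i * fit a (t - i))
      = (\<Sum>i=1..K. r i * a 0) + (\<Sum>i=1..K. \<Sum>j=1..K. r i * (a j * Y (t - i - j)))"
    unfolding fit_def distrib_left sum.distrib sum_distrib_left ..
  also have "(\<Sum>i=1..K. \<Sum>j=1..K. r i * (a j * Y (t - i - j)))
      = (\<Sum>j=1..K. a j * (\<Sum>i=1..K. r i * Y (t - j - i)))"
    unfolding sum_distrib_left
    by (subst sum.swap) (intro sum.cong refl, simp add: diff_commute mult_ac add.commute)
  finally have "filtered (fit a) t = a 0 * (1 - (\<Sum>j=1..K. r j))
      + (\<Sum>j=1..K. a j * (Y (t - j) - (\<Sum>i=1..K. r i * Y (t - j - i))))"
    unfolding filtered_def K fit_def
    by (simp add: right_diff_distrib sum_subtractf sum_distrib_left mult.commute)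
  also have "(\<Sum>j=1..K. a j * (Y (t - j) - (\<Sum>i=1..K. r i * Y (t - j - i))))
      = (\<Sum>j=1..K. a j * (r 0 + m) + (a j * s) * y (t - j))"
  proof (intro sum.cong refl)
    fix j assume "j \<in> {1..K}"
    then have "t - j \<in> {K+1..N}" "t - j \<in> {1..N}" using t by auto
    then show "a j * (Y (t - j) - (\<Sum>i=1..K. r i * Y (t - j - i))) = a j * (r 0 + m) + (a j * s) * y (t - j)"
      using model noise by (simp add: algebra_simps)
  qed
  finally show ?thesis by (simp add: level_def sum.distrib)
qed

definition energy :: "(nat \<Rightarrow> real) \<Rightarrow> real" where
  "energy v = (\<Sum>t=K+1..N. (v t)\<^sup>2)"

lemma energy_nonneg: "0 \<le> energy v"
  by (simp add: energy_def sum_nonneg)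

text \<open>Bounds the norm of the lag filter, which has \<open>K + 1\<close> coefficients of
  modulus at most \<open>2 ^ K\<close>.\<close>

abbreviation "E \<equiv> (real K + 1) * 2 ^ K"

lemma filtered_sq_le:
  "(filtered v t)\<^sup>2 \<le> (2 ^ K)\<^sup>2 * (real K + 1) * (\<Sum>i=0..min (t - (K+1)) K. (v (t - i))\<^sup>2)"
proof -
  let ?k = "min (t - (K+1)) K"
  have "\<bar>filtered v t\<bar> \<le> \<bar>v t\<bar> + (\<Sum>j=1..?k. \<bar>r j * v (t - j)\<bar>)"
    unfolding filtered_def by (rule order_trans[OF abs_triangle_ineq4]) (simp add: sum_abs)
  also have "\<dots> \<le> 2 ^ K * \<bar>v t\<bar> + (\<Sum>j=1..?k. 2 ^ K * \<bar>v (t - j)\<bar>)"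
    unfolding abs_mult
    by (intro add_mono sum_mono mult_right_mono r_le) (auto intro: mult_right_mono[of 1 "2 ^ K" "\<bar>v t\<bar>", simplified])
  also have "\<dots> = 2 ^ K * (\<Sum>i=0..?k. \<bar>v (t - i)\<bar>)"
    by (simp add: sum.atLeast_Suc_atMost[of 0] sum_distrib_left distrib_left)
  finally have "\<bar>filtered v t\<bar>\<^sup>2 \<le> (2 ^ K * (\<Sum>i=0..?k. \<bar>v (t - i)\<bar>))\<^sup>2" by (rule power_mono) simp
  then have "(filtered v t)\<^sup>2 \<le> (2 ^ K)\<^sup>2 * (\<Sum>i=0..?k. \<bar>v (t - i)\<bar>)\<^sup>2" by (simp add: power_mult_distrib)
  also have "\<dots> \<le> (2 ^ K)\<^sup>2 * ((real ?k + 1) * (\<Sum>i=0..?k. (v (t - i))\<^sup>2))"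
    using Cauchy_Schwarz_ineq_sum[of "\<lambda>_. 1" "\<lambda>i. \<bar>v (t - i)\<bar>" "{0..?k}"]
    by (intro mult_left_mono) (simp_all add: add.commute)
  also have "\<dots> \<le> (2 ^ K)\<^sup>2 * ((real K + 1) * (\<Sum>i=0..?k. (v (t - i))\<^sup>2))"
    by (intro mult_left_mono mult_right_mono sum_nonneg) auto
  finally show ?thesis by (simp add: mult.assoc)
qed

lemma filtered_abs_le:
  assumes t: "t \<in> {K+1..N}"
  shows "\<bar>filtered v t\<bar> \<le> E * sqrt (energy v)"
proof -
  have "(\<Sum>i=0..min (t - (K+1)) K. (v (t - i))\<^sup>2) = (\<Sum>q\<in>(\<lambda>i. t - i) ` {0..min (t - (K+1)) K}. (v q)\<^sup>2)"
    by (subst sum.reindex) (use t in \<open>auto intro!: inj_onI\<close>)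
  also have "\<dots> \<le> energy v" unfolding energy_def by (rule sum_mono2) (use t in auto)
  finally have "(filtered v t)\<^sup>2 \<le> (2 ^ K)\<^sup>2 * (real K + 1) * energy v"
    using order_trans[OF filtered_sq_le] by (meson mult_left_mono mult_nonneg_nonneg zero_le_power2 of_nat_0_le_iff add_nonneg_nonneg zero_le_one)
  also have "\<dots> \<le> (2 ^ K)\<^sup>2 * (real K + 1)\<^sup>2 * energy v"
    by (intro mult_right_mono mult_left_mono energy_nonneg) (auto simp: power2_eq_square)
  also have "\<dots> = (E * sqrt (energy v))\<^sup>2"
    using energy_nonneg by (simp add: power_mult_distrib)
  finally show ?thesis
    using abs_le_square_iff[of "filtered v t" "E * sqrt (energy v)"] energy_nonneg[of v] by simp
qed

text \<open>On this range each of the shifts of \<open>v\<close> by 0 to \<open>K\<close> stays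
  inside \<open>{K+1..N}\<close> and so has at most the energy of \<open>v\<close>.\<close>

lemma filtered_energy_le: "(\<Sum>t=2*K+1..N. (filtered v t)\<^sup>2) \<le> E\<^sup>2 * energy v"
proof -
  have "(\<Sum>t=2*K+1..N. (filtered v t)\<^sup>2) \<le> (\<Sum>t=2*K+1..N. (2 ^ K)\<^sup>2 * (real K + 1) * (\<Sum>i=0..K. (v (t - i))\<^sup>2))"
    by (intro sum_mono order_trans[OF filtered_sq_le] mult_left_mono sum_mono2) auto
  also have "\<dots> = (2 ^ K)\<^sup>2 * (real K + 1) * (\<Sum>i=0..K. \<Sum>t=2*K+1..N. (v (t - i))\<^sup>2)"
    unfolding sum_distrib_left[symmetric] by (subst sum.swap) simp
  also have "\<dots> \<le> (2 ^ K)\<^sup>2 * (real K + 1) * (\<Sum>i=0..K. energy v)"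
  proof (intro mult_left_mono sum_mono)
    fix i assume i: "i \<in> {0..K}"
    have "(\<Sum>t=2*K+1..N. (v (t - i))\<^sup>2) = (\<Sum>q\<in>(\<lambda>t. t - i) ` {2*K+1..N}. (v q)\<^sup>2)"
      by (subst sum.reindex) (use i in \<open>auto intro!: inj_onI\<close>)
    also have "\<dots> \<le> energy v" unfolding energy_def by (rule sum_mono2) (use i in auto)
    finally show "(\<Sum>t=2*K+1..N. (v (t - i))\<^sup>2) \<le> energy v" .
  qed auto
  also have "\<dots> = E\<^sup>2 * energy v" by (simp add: power_mult_distrib power2_eq_square algebra_simps)
  finally show ?thesis .
qed

end

section \<open>Sample statistics of the studentized noise that control the regression error\<close>

definition lin_stat :: "nat \<Rightarrow> nat \<Rightarrow> (nat \<Rightarrow> real) \<Rightarrow> nat \<Rightarrow> real" where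
  "lin_stat K N y j = (\<Sum>t=2*K+1..N. y (t - j))"

text \<open>What lag \<open>j\<close> cuts off from the full sum of squares: unless the sample is
  constant, the diagonal Gram entry is 1 minus this. It stands in for a law of large
  numbers.\<close>

definition edge_stat :: "nat \<Rightarrow> nat \<Rightarrow> (nat \<Rightarrow> real) \<Rightarrow> nat \<Rightarrow> real" where
  "edge_stat K N y j = (\<Sum>i\<in>{1..N} - {2*K+1-j..N-j}. (y i)\<^sup>2)"

definition cross_stat :: "nat \<Rightarrow> nat \<Rightarrow> (nat \<Rightarrow> real) \<Rightarrow> nat \<Rightarrow> nat \<Rightarrow> real" where
  "cross_stat K N y i j = (\<Sum>t=2*K+1..N. y (t - i) * y (t - j))"

text \<open>Bounds the influence of the filtered values at dates \<open>K + 1\<close> to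
  \<open>2 * K\<close> on date \<open>t\<close>.\<close>

definition init_weight :: "nat \<Rightarrow> (nat \<Rightarrow> real) \<Rightarrow> nat \<Rightarrow> real" where
  "init_weight K \<beta> t = (\<Sum>q=K+1..min (2*K) t. \<beta> (t - q))"

definition init_stat :: "nat \<Rightarrow> nat \<Rightarrow> (nat \<Rightarrow> real) \<Rightarrow> (nat \<Rightarrow> real) \<Rightarrow> real" where
  "init_stat K N \<beta> y = (\<Sum>t=K+1..N. init_weight K \<beta> t * \<bar>y t\<bar>)"

text \<open>Inner product of \<open>y\<close> with the inverse filter applied to a constant.\<close>

definition level_stat :: "nat \<Rightarrow> nat \<Rightarrow> (nat \<Rightarrow> real) \<Rightarrow> (nat \<Rightarrow> real) \<Rightarrow> real" where
  "level_stat K N \<psi> y = (\<Sum>t=K+1..N. (\<Sum>q=2*K+1..t. \<psi> (t - q)) * y t)"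

text \<open>Inner product of \<open>y\<close> with its inversely filtered lag \<open>j\<close>, as
  one sum over pairs to match \<open>expectation_quadratic_form\<close>. For
  \<open>j \<ge> 1\<close> the two factors never carry the same index.\<close>

definition score_stat :: "nat \<Rightarrow> nat \<Rightarrow> (nat \<Rightarrow> real) \<Rightarrow> (nat \<Rightarrow> real) \<Rightarrow> nat \<Rightarrow> real" where
  "score_stat K N \<psi> y j =
     (\<Sum>x\<in>Sigma {K+1..N} (\<lambda>t. {2*K+1..t}). \<psi> (fst x - snd x) * y (snd x - j) * y (fst x))"

definition point_stat :: "nat \<Rightarrow> (nat \<Rightarrow> real) \<Rightarrow> (nat \<Rightarrow> real) \<Rightarrow> nat \<Rightarrow> real" where
  "point_stat K \<beta> y t = (\<Sum>x\<in>{1..K} \<times> {2*K+1..t}. \<beta> (t - snd x) * \<bar>y (snd x - fst x)\<bar>)"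

text \<open>The powers of \<open>N\<close> are chosen such that every summand has bounded expectation.\<close>

definition total_stat ::
  "nat \<Rightarrow> nat \<Rightarrow> (nat \<Rightarrow> real) \<Rightarrow> (nat \<Rightarrow> real) \<Rightarrow> nat \<Rightarrow> (nat \<Rightarrow> real) \<Rightarrow> real" where
  "total_stat K N \<psi> \<beta> t y =
     (\<Sum>j=1..K. (lin_stat K N y j)\<^sup>2) + N * (\<Sum>j=1..K. edge_stat K N y j)
     + N * (\<Sum>x\<in>{x \<in> {1..K} \<times> {1..K}. fst x \<noteq> snd x}. (cross_stat K N y (fst x) (snd x))\<^sup>2)
     + N * (init_stat K N \<beta> y)\<^sup>2 + (level_stat K N \<psi> y)\<^sup>2
     + N * (\<Sum>j=1..K. (score_stat K N \<psi> y j)\<^sup>2) + N * (point_stat K \<beta> y t)\<^sup>2"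

lemma edge_stat_nonneg: "0 \<le> edge_stat K N y j"
  by (simp add: edge_stat_def sum_nonneg)

lemma total_stat_ge:
  shows "0 \<le> total_stat K N \<psi> \<beta> t y"
    and "j \<in> {1..K} \<Longrightarrow> (lin_stat K N y j)\<^sup>2 \<le> total_stat K N \<psi> \<beta> t y"
    and "j \<in> {1..K} \<Longrightarrow> N * edge_stat K N y j \<le> total_stat K N \<psi> \<beta> t y"
    and "i \<in> {1..K} \<Longrightarrow> j \<in> {1..K} \<Longrightarrow> i \<noteq> j \<Longrightarrow> N * (cross_stat K N y i j)\<^sup>2 \<le> total_stat K N \<psi> \<beta> t y"
    and "N * (init_stat K N \<beta> y)\<^sup>2 \<le> total_stat K N \<psi> \<beta> t y"
    and "(level_stat K N \<psi> y)\<^sup>2 \<le> total_stat K N \<psi> \<beta> t y"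
    and "j \<in> {1..K} \<Longrightarrow> N * (score_stat K N \<psi> y j)\<^sup>2 \<le> total_stat K N \<psi> \<beta> t y"
    and "N * (point_stat K \<beta> y t)\<^sup>2 \<le> total_stat K N \<psi> \<beta> t y"
proof -
  define a where "a = (\<Sum>j=1..K. (lin_stat K N y j)\<^sup>2)"
  define b where "b = (\<Sum>j=1..K. edge_stat K N y j)"
  define c where "c = (\<Sum>x\<in>{x \<in> {1..K} \<times> {1..K}. fst x \<noteq> snd x}. (cross_stat K N y (fst x) (snd x))\<^sup>2)"
  define d where "d = (\<Sum>j=1..K. (score_stat K N \<psi> y j)\<^sup>2)"
  have nn: "0 \<le> a" "0 \<le> N * b" "0 \<le> N * c" "0 \<le> N * d" "0 \<le> N * (init_stat K N \<beta> y)\<^sup>2"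
    "0 \<le> (level_stat K N \<psi> y)\<^sup>2" "0 \<le> N * (point_stat K \<beta> y t)\<^sup>2"
    by (auto simp: a_def b_def c_def d_def edge_stat_nonneg intro!: sum_nonneg mult_nonneg_nonneg)
  have T: "total_stat K N \<psi> \<beta> t y = a + N * b + N * c + N * (init_stat K N \<beta> y)\<^sup>2
      + (level_stat K N \<psi> y)\<^sup>2 + N * d + N * (point_stat K \<beta> y t)\<^sup>2"
    unfolding total_stat_def a_def b_def c_def d_def ..
  show "0 \<le> total_stat K N \<psi> \<beta> t y" "N * (init_stat K N \<beta> y)\<^sup>2 \<le> total_stat K N \<psi> \<beta> t y"
    "(level_stat K N \<psi> y)\<^sup>2 \<le> total_stat K N \<psi> \<beta> t y" "N * (point_stat K \<beta> y t)\<^sup>2 \<le> total_stat K N \<psi> \<beta> t y"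
    unfolding T using nn by linarith+
  show "(lin_stat K N y j)\<^sup>2 \<le> total_stat K N \<psi> \<beta> t y" if "j \<in> {1..K}"
  proof -
    have "(lin_stat K N y j)\<^sup>2 \<le> a" unfolding a_def by (rule member_le_sum) (use that in auto)
    then show ?thesis unfolding T using nn by linarith
  qed
  show "N * edge_stat K N y j \<le> total_stat K N \<psi> \<beta> t y" if "j \<in> {1..K}"
  proof -
    have "edge_stat K N y j \<le> b"
      unfolding b_def by (rule member_le_sum) (use that edge_stat_nonneg in auto)
    then have "N * edge_stat K N y j \<le> N * b" by (intro mult_left_mono) auto
    then show ?thesis unfolding T using nn by linarith
  qed
  show "N * (cross_stat K N y i j)\<^sup>2 \<le> total_stat K N \<psi> \<beta> t y"
    if "i \<in> {1..K}" "j \<in> {1..K}" "i \<noteq> j"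
  proof -
    have "(cross_stat K N y (fst (i, j)) (snd (i, j)))\<^sup>2 \<le> c"
      unfolding c_def by (rule member_le_sum) (use that in auto)
    then have "N * (cross_stat K N y i j)\<^sup>2 \<le> N * c" by (intro mult_left_mono) auto
    then show ?thesis unfolding T using nn by linarith
  qed
  show "N * (score_stat K N \<psi> y j)\<^sup>2 \<le> total_stat K N \<psi> \<beta> t y" if "j \<in> {1..K}"
  proof -
    have "(score_stat K N \<psi> y j)\<^sup>2 \<le> d" unfolding d_def by (rule member_le_sum) (use that in auto)
    then have "N * (score_stat K N \<psi> y j)\<^sup>2 \<le> N * d" by (intro mult_left_mono) auto
    then show ?thesis unfolding T using nn by linarith
  qed
qed

section \<open>Deterministic bounds on the event where the statistics are at most
  \<open>k\<close>\<close>

lemma abs_le_sqrt_div: "n > 0 \<Longrightarrow> n * x\<^sup>2 \<le> k \<Longrightarrow> \<bar>x\<bar> \<le> sqrt k / sqrt n" for n x k :: real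
proof -
  assume n: "n > 0" and x: "n * x\<^sup>2 \<le> k"
  have "\<bar>x\<bar> * sqrt n = sqrt (n * x\<^sup>2)" by (simp add: real_sqrt_mult)
  also have "\<dots> \<le> sqrt k" using x by simp
  finally show ?thesis using n by (simp add: pos_le_divide_eq)
qed

lemma collect_terms: "c + c + a * c = c * (a + 2)" for a c :: real
  by (simp add: algebra_simps)

lemma sqrt_scaling_cancel:
  "x \<noteq> 0 \<Longrightarrow> q * q = k \<Longrightarrow> q / x * (w * x) + q * x * (w * (c * (q * d / x))) = w * (q + c * k * d)"
  for x q k w c d :: real
proof -
  assume x: "x \<noteq> 0" and q: "q * q = k"
  have "q / x * (w * x) = w * q" using x by simp
  moreover have "q * x * (w * (c * (q * d / x))) = w * (c * (q * q) * d)" using x by simp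
  ultimately show ?thesis unfolding q by (simp add: distrib_left)
qed

context ar_path
begin

context
  fixes t0 :: nat and k :: real
  assumes stat: "s\<^sup>2 / N + N * m\<^sup>2 + total_stat K N \<psi> \<beta> t0 y \<le> k"
    and large: "(k + 2 * K) * (2 * K + 4)\<^sup>2 \<le> N"
begin

abbreviation "W a \<equiv> sqrt (energy (fit a))"

lemma k0: "0 \<le> k" and s_le: "s\<^sup>2 / N \<le> k" and m_le: "N * m\<^sup>2 \<le> k"
  and total_le: "total_stat K N \<psi> \<beta> t0 y \<le> k"
proof -
  have "0 \<le> s\<^sup>2 / N" "0 \<le> N * m\<^sup>2" by auto
  then show "0 \<le> k" "s\<^sup>2 / N \<le> k" "N * m\<^sup>2 \<le> k" "total_stat K N \<psi> \<beta> t0 y \<le> k"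
    using stat total_stat_ge(1)[of K N \<psi> \<beta> t0 y] by linarith+
qed

text \<open>Coercivity with \<open>\<alpha> j = a j * s\<close> bounds the coefficients by the
  filtered energy, and the filter norm leads back to the energy of \<open>fit a\<close>. The
  statistics do not involve \<open>a\<close>, so all coefficient vectors are covered at
  once.\<close>

lemma coefficients_le:
  "N * (level a)\<^sup>2 + (\<Sum>j=1..K. (a j * s)\<^sup>2) \<le> 2 * (E\<^sup>2 * energy (fit a))"
proof -
  define \<theta> where "\<theta> = 1 / (2 * real K + 4)"
  have \<theta>: "0 < \<theta>" "\<theta> \<le> 1" by (auto simp: \<theta>_def)
  \<comment> \<open>The factor \<open>(2 * K + 4)\<^sup>2\<close> in \<open>large\<close> is
    \<open>1 / \<theta>\<^sup>2\<close>: this one inequality makes edges, sums and cross products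
    small enough for \<open>\<theta>\<close>.\<close>
  have kN: "k + 2 * K \<le> \<theta>\<^sup>2 * N"
    using large by (simp add: \<theta>_def field_simps power_divide add_pos_nonneg)
  have \<theta>2: "\<theta>\<^sup>2 * N \<le> \<theta> * N"
    using \<theta> by (intro mult_right_mono) (auto simp: power2_eq_square mult_left_le)
  have "N * (level a)\<^sup>2 + (\<Sum>j=1..K. (a j * s)\<^sup>2)
     \<le> 2 * (\<Sum>t=2*K+1..N. (level a + (\<Sum>j=1..K. (a j * s) * y (t - j)))\<^sup>2)"
  proof (rule near_orthogonal_coercive; unfold \<theta>_def[symmetric])
    show "2 * real K \<le> \<theta> * N" using kN \<theta>2 k0 by linarith
  next
    fix j assume j: "j \<in> {1..K}"
    show "a j * s = 0 \<or> 1 - \<theta> \<le> (\<Sum>t = 2 * K + 1..N. (y (t - j))\<^sup>2)"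
    proof (cases "s = 0")
      case False
      have "N * edge_stat K N y j \<le> N * \<theta>"
        using total_stat_ge(3)[OF j, of N y \<psi> \<beta> t0] total_le kN \<theta>2 k0 by (simp add: mult.commute)
      then have e: "edge_stat K N y j \<le> \<theta>" using N0 by simp
      have "1 = (\<Sum>t=1..N. (y t)\<^sup>2)" using normed False by simp
      also have "\<dots> = edge_stat K N y j + (\<Sum>t\<in>{2*K+1-j..N-j}. (y t)\<^sup>2)"
        unfolding edge_stat_def by (rule sum.subset_diff) (use j in auto)
      also have "(\<Sum>t\<in>{2*K+1-j..N-j}. (y t)\<^sup>2) = (\<Sum>t=2*K+1..N. (y (t - j))\<^sup>2)"
        by (rule sum.reindex_bij_witness[of _ "\<lambda>t. t - j" "\<lambda>t. t + j"]) (use j in auto)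
      finally show ?thesis using e by linarith
    qed simp
    have "(lin_stat K N y j)\<^sup>2 \<le> \<theta>\<^sup>2 * N"
      using total_stat_ge(2)[OF j, of N y \<psi> \<beta> t0] total_le kN k0 by linarith
    then have "\<bar>lin_stat K N y j\<bar> \<le> sqrt (\<theta>\<^sup>2 * N)" by (simp add: real_le_rsqrt)
    then show "\<bar>\<Sum>t = 2 * K + 1..N. y (t - j)\<bar> \<le> \<theta> * sqrt N"
      using \<theta> by (simp add: lin_stat_def real_sqrt_mult)
  next
    fix i j assume ij: "i \<in> {1..K}" "j \<in> {1..K}" "i \<noteq> j"
    have "N * (cross_stat K N y i j)\<^sup>2 \<le> N * \<theta>\<^sup>2"
      using total_stat_ge(4)[OF ij, of N y \<psi> \<beta> t0] total_le kN k0 by (simp add: mult.commute)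
    then have "(cross_stat K N y i j)\<^sup>2 \<le> \<theta>\<^sup>2" using N0 by simp
    then show "\<bar>\<Sum>t = 2 * K + 1..N. y (t - i) * y (t - j)\<bar> \<le> \<theta>"
      using \<theta> abs_le_square_iff[of "cross_stat K N y i j" \<theta>] by (simp add: cross_stat_def)
  qed
  also have "(\<Sum>t=2*K+1..N. (level a + (\<Sum>j=1..K. (a j * s) * y (t - j)))\<^sup>2)
      = (\<Sum>t=2*K+1..N. (filtered (fit a) t)\<^sup>2)"
    by (intro sum.cong refl) (simp only: filtered_fit)
  also have "2 * \<dots> \<le> 2 * (E\<^sup>2 * energy (fit a))" using filtered_energy_le by (intro mult_left_mono) auto
  finally show ?thesis .
qed

lemma sqrt_energy_bound: "2 * (E\<^sup>2 * energy (fit a)) \<le> (2 * E * W a)\<^sup>2"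
  using energy_nonneg[of "fit a"] by (simp add: power_mult_distrib mult_right_mono)

lemma level_le: "\<bar>level a\<bar> \<le> 2 * E * W a / sqrt N"
proof -
  have "N * (level a)\<^sup>2 \<le> (2 * E * W a)\<^sup>2"
    using coefficients_le[of a] sqrt_energy_bound[of a] sum_nonneg[of "{1..K}" "\<lambda>j. (a j * s)\<^sup>2"] by auto
  then have "\<bar>level a\<bar> \<le> sqrt ((2 * E * W a)\<^sup>2) / sqrt N"
    using N0 by (intro abs_le_sqrt_div) auto
  moreover have "0 \<le> 2 * E * W a" using energy_nonneg by simp
  ultimately show ?thesis unfolding real_sqrt_abs by simp
qed

text \<open>Bounded is \<open>a j * s\<close> and not \<open>a j\<close>, on which nothing is said
  if \<open>s = 0\<close>. That is enough, since lags of \<open>y\<close> enter the filtered vector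
  only with this factor.\<close>

lemma slope_le: "j \<in> {1..K} \<Longrightarrow> \<bar>a j * s\<bar> \<le> 2 * E * W a"
proof -
  assume j: "j \<in> {1..K}"
  have "(a j * s)\<^sup>2 \<le> (\<Sum>j=1..K. (a j * s)\<^sup>2)" by (rule member_le_sum) (use j in auto)
  also have "\<dots> \<le> (2 * E * W a)\<^sup>2"
  proof -
    have "0 \<le> N * (level a)\<^sup>2" by simp
    then show ?thesis using coefficients_le[of a] sqrt_energy_bound[of a] by linarith
  qed
  finally show ?thesis
    using abs_le_square_iff[of "a j * s" "2 * E * W a"] energy_nonneg[of "fit a"] by simp
qed

text \<open>For fixed \<open>a\<close>, the initial values of the process enter
  \<open>fit_decomp\<close> only here.\<close>

definition init_part :: "(nat \<Rightarrow> real) \<Rightarrow> nat \<Rightarrow> real" where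
  "init_part a t = (\<Sum>q=K+1..min (2*K) t. \<psi> (t - q) * filtered (fit a) q)"

lemma init_part_le:
  assumes "t \<in> {K+1..N}"
  shows "\<bar>init_part a t\<bar> \<le> E * W a * init_weight K \<beta> t"
proof -
  have "\<bar>init_part a t\<bar> \<le> (\<Sum>q=K+1..min (2*K) t. \<beta> (t - q) * (E * W a))"
    unfolding init_part_def
  proof (rule order_trans[OF sum_abs], unfold abs_mult, intro sum_mono mult_mono \<psi>_le)
    fix q assume "q \<in> {K+1..min (2*K) t}"
    then show "\<bar>filtered (fit a) q\<bar> \<le> E * W a" using assms by (intro filtered_abs_le) auto
  qed (auto simp: \<beta>_nonneg)
  then show ?thesis by (simp add: init_weight_def sum_distrib_right[symmetric] mult.commute)
qed

lemma fit_decomp: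
  assumes t: "t \<in> {K+1..N}"
  shows "fit a t = init_part a t + level a * (\<Sum>q=2*K+1..t. \<psi> (t - q))
    + (\<Sum>j=1..K. (a j * s) * (\<Sum>q=2*K+1..t. \<psi> (t - q) * y (q - j)))"
proof -
  have "fit a t = (\<Sum>q=K+1..t. \<psi> (t - q) * filtered (fit a) q)"
    using unfilter[of t "fit a"] t by simp
  \<comment> \<open>For \<open>t \<le> 2 * K\<close> the second range is empty, and the
    \<open>min\<close> keeps the split valid.\<close>
  also have "{K+1..t} = {K+1..min (2*K) t} \<union> {2*K+1..t}" using t by auto
  also have "(\<Sum>q\<in>{K+1..min (2*K) t} \<union> {2*K+1..t}. \<psi> (t - q) * filtered (fit a) q)
      = init_part a t + (\<Sum>q=2*K+1..t. \<psi> (t - q) * filtered (fit a) q)"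
    unfolding init_part_def by (rule sum.union_disjoint) auto
  also have "(\<Sum>q=2*K+1..t. \<psi> (t - q) * filtered (fit a) q)
      = (\<Sum>q=2*K+1..t. \<psi> (t - q) * level a + (\<Sum>j=1..K. (a j * s) * (\<psi> (t - q) * y (q - j))))"
  proof (intro sum.cong refl)
    fix q assume "q \<in> {2*K+1..t}"
    then have "filtered (fit a) q = level a + (\<Sum>j=1..K. (a j * s) * y (q - j))"
      using t by (intro filtered_fit) auto
    then show "\<psi> (t - q) * filtered (fit a) q
        = \<psi> (t - q) * level a + (\<Sum>j=1..K. (a j * s) * (\<psi> (t - q) * y (q - j)))"
      by (simp add: distrib_left sum_distrib_left mult.left_commute)
  qed
  also have "\<dots> = level a * (\<Sum>q=2*K+1..t. \<psi> (t - q))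
     + (\<Sum>j=1..K. (a j * s) * (\<Sum>q=2*K+1..t. \<psi> (t - q) * y (q - j)))"
    unfolding sum.distrib sum_distrib_left by (subst sum.swap) (simp add: mult.commute)
  finally show ?thesis by (simp add: add.assoc)
qed

lemma abs_sum_\<psi>_le: "\<bar>\<Sum>q=c..t. \<psi> (t - q)\<bar> \<le> B"
proof -
  have "\<bar>\<Sum>q=c..t. \<psi> (t - q)\<bar> \<le> (\<Sum>q=c..t. \<beta> (t - q))"
    by (rule order_trans[OF sum_abs]) (intro sum_mono \<psi>_le)
  also have "\<dots> = sum \<beta> ((\<lambda>q. t - q) ` {c..t})"
    by (subst sum.reindex) (auto intro!: inj_onI)
  also have "\<dots> \<le> B" by (rule sum_\<beta>) simp
  finally show ?thesis .
qed

text \<open>Each part of \<open>fit_decomp\<close> is bounded by a multiple of \<open>W a\<close>: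
  the initial part with the factor \<open>init_weight\<close>, level and slopes with factors of
  order \<open>1 / sqrt N\<close>.\<close>

lemma fit_le:
  assumes t0: "t0 \<in> {K+1..N}"
  shows "\<bar>fit a t0\<bar> \<le> W a * (2 * E * (init_weight K \<beta> t0 + (B + sqrt k) / sqrt N))"
proof -
  have W0: "0 \<le> W a" using energy_nonneg by simp
  have i: "\<bar>init_part a t0\<bar> \<le> 2 * E * W a * init_weight K \<beta> t0"
  proof -
    have "0 \<le> E * W a * init_weight K \<beta> t0"
      using W0 \<beta>_nonneg by (intro mult_nonneg_nonneg) (auto simp: init_weight_def intro!: sum_nonneg)
    then show ?thesis using init_part_le[OF t0, of a] by simp
  qed
  have l: "\<bar>level a * (\<Sum>q=2*K+1..t0. \<psi> (t0 - q))\<bar> \<le> 2 * E * W a / sqrt N * B"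
    unfolding abs_mult using level_le[of a] abs_sum_\<psi>_le W0
    by (intro mult_mono) auto
  have p: "\<bar>\<Sum>j=1..K. (a j * s) * (\<Sum>q=2*K+1..t0. \<psi> (t0 - q) * y (q - j))\<bar>
     \<le> 2 * E * W a * (sqrt k / sqrt N)"
  proof -
    have "\<bar>\<Sum>j=1..K. (a j * s) * (\<Sum>q=2*K+1..t0. \<psi> (t0 - q) * y (q - j))\<bar>
       \<le> (\<Sum>j=1..K. 2 * E * W a * (\<Sum>q=2*K+1..t0. \<beta> (t0 - q) * \<bar>y (q - j)\<bar>))"
    proof (rule order_trans[OF sum_abs], rule sum_mono)
      fix j assume j: "j \<in> {1..K}"
      have "\<bar>\<Sum>q=2*K+1..t0. \<psi> (t0 - q) * y (q - j)\<bar> \<le> (\<Sum>q=2*K+1..t0. \<beta> (t0 - q) * \<bar>y (q - j)\<bar>)"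
        by (rule order_trans[OF sum_abs]) (auto simp: abs_mult intro!: sum_mono mult_right_mono \<psi>_le)
      then show "\<bar>(a j * s) * (\<Sum>q=2*K+1..t0. \<psi> (t0 - q) * y (q - j))\<bar>
          \<le> 2 * E * W a * (\<Sum>q=2*K+1..t0. \<beta> (t0 - q) * \<bar>y (q - j)\<bar>)"
        using slope_le[OF j, of a] W0 unfolding abs_mult[of "a j * s"] by (intro mult_mono) auto
    qed
    also have "\<dots> = 2 * E * W a * point_stat K \<beta> y t0"
      unfolding sum_distrib_left[symmetric] point_stat_def by (simp add: sum.cartesian_product split_def)
    also have "\<dots> \<le> 2 * E * W a * (sqrt k / sqrt N)"
    proof (rule mult_left_mono)
      have "N * (point_stat K \<beta> y t0)\<^sup>2 \<le> k" using total_stat_ge(8) total_le by (rule order_trans)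
      then show "point_stat K \<beta> y t0 \<le> sqrt k / sqrt N"
        using abs_le_sqrt_div[of "real N" "point_stat K \<beta> y t0" k] N0 by auto
    qed (use W0 in auto)
    finally show ?thesis .
  qed
  have "\<bar>fit a t0\<bar> \<le> 2 * E * W a * init_weight K \<beta> t0 + 2 * E * W a / sqrt N * B + 2 * E * W a * (sqrt k / sqrt N)"
    unfolding fit_decomp[OF t0, of a] using i l p by linarith
  also have "\<dots> = W a * (2 * E * (init_weight K \<beta> t0 + (B + sqrt k) / sqrt N))"
    by (simp add: algebra_simps add_divide_distrib)
  finally show ?thesis .
qed

text \<open>Exchanging sums puts \<open>level a\<close> and \<open>a j * s\<close> in front of
  statistics of \<open>y\<close> alone, and \<open>init_part_le\<close> does the same for the
  initial part. Each product is then \<open>W a\<close> times order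
  \<open>1 / sqrt N\<close>.\<close>

lemma fit_inner_y_le:
  "\<bar>\<Sum>t=K+1..N. fit a t * y t\<bar> \<le> W a * (2 * E * (sqrt k * (K + 2) / sqrt N))"
proof -
  have W0: "0 \<le> W a" using energy_nonneg by simp
  let ?x = "sqrt k / sqrt N"
  have x0: "0 \<le> ?x" using k0 by simp
  have Nr: "real N > 0" using N0 by simp
  have "(\<Sum>t=K+1..N. fit a t * y t) = (\<Sum>t=K+1..N. init_part a t * y t)
    + level a * level_stat K N \<psi> y + (\<Sum>j=1..K. (a j * s) * score_stat K N \<psi> y j)"
  proof -
    have "(\<Sum>t=K+1..N. fit a t * y t) = (\<Sum>t=K+1..N. init_part a t * y t
        + level a * ((\<Sum>q=2*K+1..t. \<psi> (t - q)) * y t)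
        + (\<Sum>j=1..K. (a j * s) * (\<Sum>q=2*K+1..t. \<psi> (t - q) * y (q - j) * y t)))"
      by (intro sum.cong refl) (simp add: fit_decomp distrib_right sum_distrib_right mult.assoc)
    also have "\<dots> = (\<Sum>t=K+1..N. init_part a t * y t) + level a * level_stat K N \<psi> y
        + (\<Sum>t=K+1..N. \<Sum>j=1..K. (a j * s) * (\<Sum>q=2*K+1..t. \<psi> (t - q) * y (q - j) * y t))"
      by (simp add: sum.distrib level_stat_def sum_distrib_left)
    also have "(\<Sum>t=K+1..N. \<Sum>j=1..K. (a j * s) * (\<Sum>q=2*K+1..t. \<psi> (t - q) * y (q - j) * y t))
       = (\<Sum>j=1..K. (a j * s) * score_stat K N \<psi> y j)"
      unfolding score_stat_def by (subst sum.swap) (simp add: sum_distrib_left[symmetric] sum.Sigma split_def)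
    finally show ?thesis .
  qed
  moreover have "\<bar>\<Sum>t=K+1..N. init_part a t * y t\<bar> \<le> 2 * E * W a * ?x"
  proof -
    have "\<bar>\<Sum>t=K+1..N. init_part a t * y t\<bar> \<le> (\<Sum>t=K+1..N. E * W a * (init_weight K \<beta> t * \<bar>y t\<bar>))"
      unfolding mult.assoc[symmetric]
      by (rule order_trans[OF sum_abs], unfold abs_mult, intro sum_mono mult_right_mono)
        (use init_part_le in \<open>auto simp: mult.assoc\<close>)
    also have "\<dots> = E * W a * init_stat K N \<beta> y" by (simp add: init_stat_def sum_distrib_left)
    also have "\<dots> \<le> E * W a * ?x"
    proof (rule mult_left_mono)
      have "N * (init_stat K N \<beta> y)\<^sup>2 \<le> k" using total_stat_ge(5) total_le by (rule order_trans)
      then show "init_stat K N \<beta> y \<le> ?x"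
        using abs_le_sqrt_div[OF Nr, of "init_stat K N \<beta> y" k] by auto
    qed (use W0 in auto)
    also have "\<dots> \<le> 2 * E * W a * ?x" using W0 x0 by (intro mult_right_mono) auto
    finally show ?thesis .
  qed
  moreover have "\<bar>level a * level_stat K N \<psi> y\<bar> \<le> 2 * E * W a * ?x"
  proof -
    have "(level_stat K N \<psi> y)\<^sup>2 \<le> k" using total_stat_ge(6) total_le by (rule order_trans)
    then have "\<bar>level_stat K N \<psi> y\<bar> \<le> sqrt k" by (simp add: real_le_rsqrt)
    then have "\<bar>level a * level_stat K N \<psi> y\<bar> \<le> 2 * E * W a / sqrt N * sqrt k"
      unfolding abs_mult using level_le[of a] W0 by (intro mult_mono) auto
    then show ?thesis by simp
  qed
  moreover have "\<bar>\<Sum>j=1..K. (a j * s) * score_stat K N \<psi> y j\<bar> \<le> K * (2 * E * W a * ?x)"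
  proof -
    have "\<bar>\<Sum>j=1..K. (a j * s) * score_stat K N \<psi> y j\<bar> \<le> (\<Sum>j=1..K. 2 * E * W a * ?x)"
    proof (rule order_trans[OF sum_abs], rule sum_mono)
      fix j assume j: "j \<in> {1..K}"
      have "N * (score_stat K N \<psi> y j)\<^sup>2 \<le> k" using total_stat_ge(7)[OF j] total_le by (rule order_trans)
      then have "\<bar>score_stat K N \<psi> y j\<bar> \<le> ?x" by (rule abs_le_sqrt_div[OF Nr])
      then show "\<bar>(a j * s) * score_stat K N \<psi> y j\<bar> \<le> 2 * E * W a * ?x"
        unfolding abs_mult[of "a j * s"] using slope_le[OF j, of a] W0 by (intro mult_mono) auto
    qed
    then show ?thesis by simp
  qed
  ultimately have "\<bar>\<Sum>t=K+1..N. fit a t * y t\<bar> \<le> 2 * E * W a * ?x + 2 * E * W a * ?x + K * (2 * E * W a * ?x)"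
    by linarith
  also have "\<dots> = 2 * E * W a * ?x * (real K + 2)"
    by (rule collect_terms)
  also have "\<dots> = W a * (2 * E * (sqrt k * (K + 2) / sqrt N))" by simp
  finally show ?thesis .
qed

text \<open>The powers of \<open>N\<close> cancel: the mean is at most
  \<open>sqrt k / sqrt N\<close> against \<open>sqrt N\<close> from Cauchy-Schwarz with the
  constant, and \<open>s\<close> is at most \<open>sqrt k * sqrt N\<close> against
  \<open>1 / sqrt N\<close> from \<open>fit_inner_y_le\<close>.\<close>

lemma fit_inner_noise_le:
  "\<bar>\<Sum>t=K+1..N. fit a t * u t\<bar> \<le> W a * (sqrt k + 2 * E * k * (K + 2))"
proof -
  have W0: "0 \<le> W a" using energy_nonneg by simp
  have Nr: "real N > 0" using N0 by simp
  have "(\<Sum>t=K+1..N. fit a t * u t) = (\<Sum>t=K+1..N. m * (fit a t * 1) + s * (fit a t * y t))"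
    by (intro sum.cong refl) (simp add: noise algebra_simps)
  also have "\<dots> = m * (\<Sum>t=K+1..N. fit a t * 1) + s * (\<Sum>t=K+1..N. fit a t * y t)"
    by (simp only: sum.distrib sum_distrib_left)
  finally have "\<bar>\<Sum>t=K+1..N. fit a t * u t\<bar>
      \<le> \<bar>m\<bar> * \<bar>\<Sum>t=K+1..N. fit a t * 1\<bar> + s * \<bar>\<Sum>t=K+1..N. fit a t * y t\<bar>"
    using abs_triangle_ineq[of "m * (\<Sum>t=K+1..N. fit a t * 1)" "s * (\<Sum>t=K+1..N. fit a t * y t)"]
    unfolding abs_mult abs_of_nonneg[OF s0] by simp
  also have "\<dots> \<le> sqrt k / sqrt N * (W a * sqrt N)
      + sqrt k * sqrt N * (W a * (2 * E * (sqrt k * (K + 2) / sqrt N)))"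
  proof (intro add_mono mult_mono fit_inner_y_le)
    show "\<bar>m\<bar> \<le> sqrt k / sqrt N" using abs_le_sqrt_div[OF Nr m_le] .
    have "(\<Sum>t=K+1..N. fit a t * 1)\<^sup>2 \<le> energy (fit a) * (\<Sum>t=K+1..N. 1\<^sup>2)"
      unfolding energy_def by (rule Cauchy_Schwarz_ineq_sum)
    also have "\<dots> \<le> energy (fit a) * N" using energy_nonneg by (intro mult_left_mono) auto
    finally show "\<bar>\<Sum>t=K+1..N. fit a t * 1\<bar> \<le> W a * sqrt N"
      unfolding real_sqrt_mult[symmetric] by (intro real_le_rsqrt) (simp only: power2_abs)
    have "s\<^sup>2 \<le> k * N" using s_le Nr by (simp add: pos_divide_le_eq)
    then show "s \<le> sqrt k * sqrt N" unfolding real_sqrt_mult[symmetric] by (rule real_le_rsqrt)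
  qed (use W0 s0 k0 in auto)
  also have "\<dots> = W a * (sqrt k + 2 * E * k * (K + 2))"
    using Nr k0 by (intro sqrt_scaling_cancel) auto
  finally show ?thesis .
qed

text \<open>Orthogonality gives \<open>W a * W a \<le> W a * H\<close>; cancelling
  \<open>W a\<close> leaves a bound without \<open>N\<close>, which is then fed into
  \<open>fit_le\<close>.\<close>

lemma residual_bounds:
  assumes orth: "energy (fit a) = (\<Sum>t=K+1..N. fit a t * u t)"
  defines "H \<equiv> sqrt k + 2 * E * k * (K + 2)"
  shows "energy (fit a) \<le> H\<^sup>2"
    and "t0 \<in> {K+1..N} \<Longrightarrow> \<bar>fit a t0\<bar> \<le> H * (2 * E * (init_weight K \<beta> t0 + (B + sqrt k) / sqrt N))"
proof -
  have W0: "0 \<le> W a" using energy_nonneg by simp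
  have H0: "0 \<le> H" using k0 by (simp add: H_def)
  have "W a * W a = energy (fit a)" using energy_nonneg by simp
  also have "\<dots> \<le> \<bar>\<Sum>t=K+1..N. fit a t * u t\<bar>" unfolding orth by (rule abs_ge_self)
  also have "\<dots> \<le> W a * H" unfolding H_def by (rule fit_inner_noise_le)
  finally have *: "W a * W a \<le> W a * H" .
  have WH: "W a \<le> H"
  proof (cases "W a = 0")
    case True
    then show ?thesis using H0 by (simp only:)
  next
    case False
    then have "0 < W a" using W0 by linarith
    with * show ?thesis by (rule mult_left_le_imp_le)
  qed
  then have "(W a)\<^sup>2 \<le> H\<^sup>2" using W0 by (rule power_mono)
  then show "energy (fit a) \<le> H\<^sup>2" using energy_nonneg by simp
  assume t0: "t0 \<in> {K+1..N}"
  have "0 \<le> B" using sum_\<beta>[of "{}"] by simp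
  then have "0 \<le> 2 * E * (init_weight K \<beta> t0 + (B + sqrt k) / sqrt N)"
    using k0 \<beta>_nonneg by (intro mult_nonneg_nonneg add_nonneg_nonneg divide_nonneg_nonneg)
      (auto simp: init_weight_def intro!: sum_nonneg)
  then show "\<bar>fit a t0\<bar> \<le> H * (2 * E * (init_weight K \<beta> t0 + (B + sqrt k) / sqrt N))"
    by (rule order_trans[OF fit_le[OF t0] mult_right_mono[OF WH]])
qed

end

end

section \<open>Expectations of the error statistics\<close>

text \<open>For \<open>q \<le> t\<close> truncated subtraction is injective in either argument, so
  both sums are subsums of \<open>\<beta>\<close>.\<close>

lemma sum_shifted_le:
  fixes \<beta> :: "nat \<Rightarrow> real"
  assumes b: "\<And>n. 0 \<le> \<beta> n" and B: "\<And>A. finite A \<Longrightarrow> sum \<beta> A \<le> B"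
    and A: "finite A"
  shows "(\<Sum>t | t \<in> A \<and> q \<le> t. \<beta> (t - q)) \<le> B" "(\<Sum>q | q \<in> A \<and> q \<le> t. \<beta> (t - q)) \<le> B"
proof -
  have "(\<Sum>t | t \<in> A \<and> q \<le> t. \<beta> (t - q)) = sum \<beta> ((\<lambda>t. t - q) ` {t. t \<in> A \<and> q \<le> t})"
    by (subst sum.reindex) (auto intro!: inj_onI)
  also have "\<dots> \<le> B" using A by (intro B) auto
  finally show "(\<Sum>t | t \<in> A \<and> q \<le> t. \<beta> (t - q)) \<le> B" .
  have "(\<Sum>q | q \<in> A \<and> q \<le> t. \<beta> (t - q)) = sum \<beta> ((\<lambda>q. t - q) ` {q. q \<in> A \<and> q \<le> t})"
    by (subst sum.reindex) (auto intro!: inj_onI)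
  also have "\<dots> \<le> B" using A by (intro B) auto
  finally show "(\<Sum>q | q \<in> A \<and> q \<le> t. \<beta> (t - q)) \<le> B" .
qed

locale exchangeable_path = exchangeable M "{1..n}" y for M and n :: nat and y +
  fixes K :: nat and \<psi> \<beta> :: "nat \<Rightarrow> real" and B :: real
  assumes n_large: "2 * K \<le> n"
    and \<psi>_le: "\<And>i. \<bar>\<psi> i\<bar> \<le> \<beta> i" and sum_\<beta>: "\<And>A. finite A \<Longrightarrow> sum \<beta> A \<le> B"
begin

lemma \<beta>0: "0 \<le> \<beta> i" using \<psi>_le[of i] by linarith
lemma B0: "0 \<le> B" using sum_\<beta>[of "{}"] by simp
lemma n0: "0 < real n" using card4 by simp

lemmas shifted = sum_shifted_le[of \<beta>, OF \<beta>0 sum_\<beta>]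

lemma expectation_lin:
  assumes j: "j \<in> {1..K}"
  shows "integrable M (\<lambda>\<omega>. (lin_stat K n (\<lambda>i. y i \<omega>) j)\<^sup>2)"
    and "expectation (\<lambda>\<omega>. (lin_stat K n (\<lambda>i. y i \<omega>) j)\<^sup>2) \<le> 3"
proof -
  have a: "finite {2*K+1..n}" "inj_on (\<lambda>t. t - j) {2*K+1..n}"
    "\<And>t. t \<in> {2*K+1..n} \<Longrightarrow> t - j \<in> {1..n}" "\<And>t. t \<in> {2*K+1..n} \<Longrightarrow> \<bar>1::real\<bar> \<le> 1"
    using j by (auto intro!: inj_onI)
  show "integrable M (\<lambda>\<omega>. (lin_stat K n (\<lambda>i. y i \<omega>) j)\<^sup>2)"
    and "expectation (\<lambda>\<omega>. (lin_stat K n (\<lambda>i. y i \<omega>) j)\<^sup>2) \<le> 3"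
    using expectation_linear_combination[OF a] by (simp_all add: lin_stat_def)
qed

lemma expectation_edge:
  assumes j: "j \<in> {1..K}"
  shows "integrable M (\<lambda>\<omega>. edge_stat K n (\<lambda>i. y i \<omega>) j)"
    and "n * expectation (\<lambda>\<omega>. edge_stat K n (\<lambda>i. y i \<omega>) j) \<le> 2 * K"
proof -
  let ?J = "{1..n} - {2*K+1-j..n-j}"
  show "integrable M (\<lambda>\<omega>. edge_stat K n (\<lambda>i. y i \<omega>) j)"
    unfolding edge_stat_def by (intro Bochner_Integration.integrable_sum integrable_sq) auto
  \<comment> \<open>The removed window has \<open>n - 2 * K\<close> dates, whatever the lag.\<close>
  have c: "card ?J = 2 * K"
    using j n_large by (subst card_Diff_subset) auto
  have "expectation (\<lambda>\<omega>. edge_stat K n (\<lambda>i. y i \<omega>) j) = (\<Sum>i\<in>?J. expectation (\<lambda>\<omega>. (y i \<omega>)\<^sup>2))"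
    unfolding edge_stat_def by (intro Bochner_Integration.integral_sum integrable_sq) auto
  also have "\<dots> \<le> (\<Sum>i\<in>?J. 1 / n)"
    by (rule sum_mono) (use moment2 in simp)
  also have "\<dots> = 2 * K / n" using c by simp
  finally show "n * expectation (\<lambda>\<omega>. edge_stat K n (\<lambda>i. y i \<omega>) j) \<le> 2 * K"
    using n0 by (simp add: pos_le_divide_eq mult.commute)
qed

lemma expectation_cross:
  assumes ij: "i \<in> {1..K}" "j \<in> {1..K}" "i \<noteq> j"
  shows "integrable M (\<lambda>\<omega>. (cross_stat K n (\<lambda>i. y i \<omega>) i j)\<^sup>2)"
    and "n * expectation (\<lambda>\<omega>. (cross_stat K n (\<lambda>i. y i \<omega>) i j)\<^sup>2) \<le> 32"
proof -
  \<comment> \<open>Each index \<open>p\<close> comes from at most one \<open>t\<close>, so the row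
    bound is 1.\<close>
  have row: "(\<Sum>t | t \<in> {2*K+1..n} \<and> t - l = p. \<bar>1::real\<bar>) \<le> 1" if "l \<in> {1..K}" for l p
  proof -
    have "card {t. t \<in> {2*K+1..n} \<and> t - l = p} \<le> card {p + l}"
      by (rule card_mono) (use that in auto)
    then show ?thesis by simp
  qed
  note Q = expectation_quadratic_form[of "{2*K+1..n}" "\<lambda>t. t - i" "\<lambda>t. t - j" 1 "\<lambda>_. 1"]
  have a: "finite {2*K+1..n}" "\<And>t. t \<in> {2*K+1..n} \<Longrightarrow> t - i \<in> {1..n}"
    "\<And>t. t \<in> {2*K+1..n} \<Longrightarrow> t - j \<in> {1..n}" "\<And>t. t \<in> {2*K+1..n} \<Longrightarrow> t - i \<noteq> t - j"
    using ij by auto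
  show "integrable M (\<lambda>\<omega>. (cross_stat K n (\<lambda>i. y i \<omega>) i j)\<^sup>2)"
    using Q(1)[OF a] row[OF ij(1)] row[OF ij(2)] by (simp add: cross_stat_def)
  show "n * expectation (\<lambda>\<omega>. (cross_stat K n (\<lambda>i. y i \<omega>) i j)\<^sup>2) \<le> 32"
    using Q(2)[OF a] row[OF ij(1)] row[OF ij(2)] n0
    by (simp add: cross_stat_def pos_le_divide_eq mult.commute)
qed

text \<open>The total weight is found by exchanging sums: there are \<open>K\<close> early dates,
  and the influence of each on all later dates adds up to at most \<open>B\<close>.\<close>

lemma expectation_init:
  shows "integrable M (\<lambda>\<omega>. (init_stat K n \<beta> (\<lambda>i. y i \<omega>))\<^sup>2)"
    and "n * expectation (\<lambda>\<omega>. (init_stat K n \<beta> (\<lambda>i. y i \<omega>))\<^sup>2) \<le> (K * B)\<^sup>2"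
proof -
  have w: "(\<Sum>t\<in>{K+1..n}. init_weight K \<beta> t) \<le> K * B"
  proof -
    have "(\<Sum>t\<in>{K+1..n}. init_weight K \<beta> t) = (\<Sum>t\<in>{K+1..n}. \<Sum>q | q \<in> {K+1..2*K} \<and> q \<le> t. \<beta> (t - q))"
      unfolding init_weight_def by (intro sum.cong refl) auto
    also have "\<dots> = (\<Sum>q\<in>{K+1..2*K}. \<Sum>t | t \<in> {K+1..n} \<and> q \<le> t. \<beta> (t - q))"
      by (rule sum.swap_restrict) auto
    also have "\<dots> \<le> (\<Sum>q\<in>{K+1..2*K}. B)" by (intro sum_mono shifted) auto
    finally show ?thesis by simp
  qed
  have "0 \<le> init_weight K \<beta> t" for t by (simp add: init_weight_def sum_nonneg \<beta>0)
  note S = expectation_abs_combination[of "{K+1..n}" "init_weight K \<beta>" "\<lambda>t. t", OF this _ w]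
  show "integrable M (\<lambda>\<omega>. (init_stat K n \<beta> (\<lambda>i. y i \<omega>))\<^sup>2)"
    unfolding init_stat_def by (rule S(1)) auto
  have "expectation (\<lambda>\<omega>. (init_stat K n \<beta> (\<lambda>i. y i \<omega>))\<^sup>2) \<le> (K * B)\<^sup>2 / real (card {1..n})"
    unfolding init_stat_def by (rule S(2)) auto
  then show "n * expectation (\<lambda>\<omega>. (init_stat K n \<beta> (\<lambda>i. y i \<omega>))\<^sup>2) \<le> (K * B)\<^sup>2"
    using n0 by (simp add: pos_le_divide_eq mult.commute)
qed

lemma expectation_level:
  shows "integrable M (\<lambda>\<omega>. (level_stat K n \<psi> (\<lambda>i. y i \<omega>))\<^sup>2)"
    and "expectation (\<lambda>\<omega>. (level_stat K n \<psi> (\<lambda>i. y i \<omega>))\<^sup>2) \<le> 3 * B\<^sup>2"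
proof -
  have "\<bar>\<Sum>q=2*K+1..t. \<psi> (t - q)\<bar> \<le> B" for t
  proof -
    have "\<bar>\<Sum>q=2*K+1..t. \<psi> (t - q)\<bar> \<le> (\<Sum>q | q \<in> {2*K+1..t} \<and> q \<le> t. \<beta> (t - q))"
      by (rule order_trans[OF sum_abs]) (auto intro!: sum_mono2 order_trans[OF sum_mono[OF \<psi>_le]] simp: \<beta>0)
    also have "\<dots> \<le> B" by (rule shifted) auto
    finally show ?thesis .
  qed
  note S = expectation_linear_combination[of "{K+1..n}" "\<lambda>t. t" "\<lambda>t. \<Sum>q=2*K+1..t. \<psi> (t - q)" B, OF _ _ _ this]
  show "integrable M (\<lambda>\<omega>. (level_stat K n \<psi> (\<lambda>i. y i \<omega>))\<^sup>2)"
    unfolding level_stat_def by (rule S(1)) auto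
  show "expectation (\<lambda>\<omega>. (level_stat K n \<psi> (\<lambda>i. y i \<omega>))\<^sup>2) \<le> 3 * B\<^sup>2"
    unfolding level_stat_def by (rule S(2)) auto
qed

text \<open>Fixing the lagged index fixes \<open>q\<close>, fixing the leading index fixes
  \<open>t\<close>; what remains is a sum of shifted filter coefficients, at most \<open>B\<close>
  in both cases.\<close>

lemma expectation_score:
  assumes j: "j \<in> {1..K}"
  shows "integrable M (\<lambda>\<omega>. (score_stat K n \<psi> (\<lambda>i. y i \<omega>) j)\<^sup>2)"
    and "n * expectation (\<lambda>\<omega>. (score_stat K n \<psi> (\<lambda>i. y i \<omega>) j)\<^sup>2) \<le> 32 * B\<^sup>2"
proof -
  let ?J = "Sigma {K+1..n} (\<lambda>t. {2*K+1..t})"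
  have f: "(\<Sum>x | x \<in> ?J \<and> snd x - j = p. \<bar>\<psi> (fst x - snd x)\<bar>) \<le> B" for p
  proof -
    let ?X = "{x \<in> ?J. snd x - j = p}"
    have X: "?X \<subseteq> (\<lambda>t. (t, p + j)) ` {t. t \<in> {K+1..n} \<and> p + j \<le> t}" using j by force
    have "(\<Sum>x\<in>?X. \<bar>\<psi> (fst x - snd x)\<bar>) \<le> (\<Sum>x\<in>(\<lambda>t. (t, p + j)) ` {t. t \<in> {K+1..n} \<and> p + j \<le> t}. \<bar>\<psi> (fst x - snd x)\<bar>)"
      by (rule sum_mono2[OF _ X]) auto
    also have "\<dots> = (\<Sum>t | t \<in> {K+1..n} \<and> p + j \<le> t. \<bar>\<psi> (t - (p + j))\<bar>)"
      by (subst sum.reindex) (auto intro!: inj_onI)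
    also have "\<dots> \<le> (\<Sum>t | t \<in> {K+1..n} \<and> p + j \<le> t. \<beta> (t - (p + j)))" by (rule sum_mono[OF \<psi>_le])
    also have "\<dots> \<le> B" by (rule shifted) auto
    finally show ?thesis by simp
  qed
  have h: "(\<Sum>x | x \<in> ?J \<and> fst x = p. \<bar>\<psi> (fst x - snd x)\<bar>) \<le> B" for p
  proof -
    let ?X = "{x \<in> ?J. fst x = p}"
    have X: "?X \<subseteq> (\<lambda>q. (p, q)) ` {q. q \<in> {2*K+1..n} \<and> q \<le> p}" by force
    have "(\<Sum>x\<in>?X. \<bar>\<psi> (fst x - snd x)\<bar>) \<le> (\<Sum>x\<in>(\<lambda>q. (p, q)) ` {q. q \<in> {2*K+1..n} \<and> q \<le> p}. \<bar>\<psi> (fst x - snd x)\<bar>)"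
      by (rule sum_mono2[OF _ X]) auto
    also have "\<dots> = (\<Sum>q | q \<in> {2*K+1..n} \<and> q \<le> p. \<bar>\<psi> (p - q)\<bar>)"
      by (subst sum.reindex) (auto intro!: inj_onI)
    also have "\<dots> \<le> (\<Sum>q | q \<in> {2*K+1..n} \<and> q \<le> p. \<beta> (p - q))" by (rule sum_mono[OF \<psi>_le])
    also have "\<dots> \<le> B" by (rule shifted) auto
    finally show ?thesis by simp
  qed
  have J: "finite ?J" "\<And>x. x \<in> ?J \<Longrightarrow> snd x - j \<in> {1..n}" "\<And>x. x \<in> ?J \<Longrightarrow> fst x \<in> {1..n}"
    "\<And>x. x \<in> ?J \<Longrightarrow> snd x - j \<noteq> fst x" using j by auto
  note Q = expectation_quadratic_form[of ?J "\<lambda>x. snd x - j" fst B "\<lambda>x. \<psi> (fst x - snd x)", OF J B0 f h]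
  show "integrable M (\<lambda>\<omega>. (score_stat K n \<psi> (\<lambda>i. y i \<omega>) j)\<^sup>2)"
    using Q(1) unfolding score_stat_def .
  show "n * expectation (\<lambda>\<omega>. (score_stat K n \<psi> (\<lambda>i. y i \<omega>) j)\<^sup>2) \<le> 32 * B\<^sup>2"
    using Q(2) n0 unfolding score_stat_def by (simp add: pos_le_divide_eq mult.commute)
qed

lemma expectation_point:
  assumes t: "t \<le> n"
  shows "integrable M (\<lambda>\<omega>. (point_stat K \<beta> (\<lambda>i. y i \<omega>) t)\<^sup>2)"
    and "n * expectation (\<lambda>\<omega>. (point_stat K \<beta> (\<lambda>i. y i \<omega>) t)\<^sup>2) \<le> (K * B)\<^sup>2"
proof -
  let ?J = "{1..K} \<times> {2*K+1..t}"
  have w: "(\<Sum>x\<in>?J. \<beta> (t - snd x)) \<le> K * B"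
  proof -
    have "(\<Sum>q\<in>{2*K+1..t}. \<beta> (t - q)) = (\<Sum>q | q \<in> {2*K+1..t} \<and> q \<le> t. \<beta> (t - q))"
      by (rule sum.cong) auto
    also have "\<dots> \<le> B" by (rule shifted) auto
    finally have "(\<Sum>i\<in>{1..K}. \<Sum>q\<in>{2*K+1..t}. \<beta> (t - q)) \<le> (\<Sum>i\<in>{1..K}. B)" by (intro sum_mono)
    also have "(\<Sum>i\<in>{1..K}. \<Sum>q\<in>{2*K+1..t}. \<beta> (t - q)) = (\<Sum>x\<in>?J. \<beta> (t - snd x))"
      by (simp only: sum.cartesian_product split_def)
    finally show ?thesis by simp
  qed
  have f: "snd x - fst x \<in> {1..n}" if "x \<in> ?J" for x using that t by auto
  note S = expectation_abs_combination[of ?J "\<lambda>x. \<beta> (t - snd x)" "\<lambda>x. snd x - fst x", OF \<beta>0 f w]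
  show "integrable M (\<lambda>\<omega>. (point_stat K \<beta> (\<lambda>i. y i \<omega>) t)\<^sup>2)"
    using S(1) unfolding point_stat_def .
  show "n * expectation (\<lambda>\<omega>. (point_stat K \<beta> (\<lambda>i. y i \<omega>) t)\<^sup>2) \<le> (K * B)\<^sup>2"
    using S(2) n0 unfolding point_stat_def by (simp add: pos_le_divide_eq mult.commute)
qed

lemma expectation_total:
  assumes t: "t \<le> n"
  shows "integrable M (\<lambda>\<omega>. total_stat K n \<psi> \<beta> t (\<lambda>i. y i \<omega>))"
    and "expectation (\<lambda>\<omega>. total_stat K n \<psi> \<beta> t (\<lambda>i. y i \<omega>))
      \<le> K * 3 + K * (2 * K) + real K * K * 32 + (K * B)\<^sup>2 + 3 * B\<^sup>2 + K * (32 * B\<^sup>2) + (K * B)\<^sup>2"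
proof -
  let ?P = "{x \<in> {1..K} \<times> {1..K}. fst x \<noteq> snd x}"
  define L where "L \<omega> = (\<Sum>j=1..K. (lin_stat K n (\<lambda>i. y i \<omega>) j)\<^sup>2)" for \<omega>
  define D where "D \<omega> = (\<Sum>j=1..K. edge_stat K n (\<lambda>i. y i \<omega>) j)" for \<omega>
  define C where "C \<omega> = (\<Sum>x\<in>?P. (cross_stat K n (\<lambda>i. y i \<omega>) (fst x) (snd x))\<^sup>2)" for \<omega>
  define S where "S \<omega> = (\<Sum>j=1..K. (score_stat K n \<psi> (\<lambda>i. y i \<omega>) j)\<^sup>2)" for \<omega>
  have iL: "integrable M L" and iD: "integrable M D" and iC: "integrable M C" and iS: "integrable M S"
    unfolding L_def D_def C_def S_def
    by (auto intro!: Bochner_Integration.integrable_sum expectation_lin expectation_edge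
        expectation_cross expectation_score)
  have T: "total_stat K n \<psi> \<beta> t (\<lambda>i. y i \<omega>) = L \<omega> + n * D \<omega> + n * C \<omega>
     + n * (init_stat K n \<beta> (\<lambda>i. y i \<omega>))\<^sup>2 + (level_stat K n \<psi> (\<lambda>i. y i \<omega>))\<^sup>2
     + n * S \<omega> + n * (point_stat K \<beta> (\<lambda>i. y i \<omega>) t)\<^sup>2" for \<omega>
    unfolding total_stat_def L_def D_def C_def S_def ..
  note i = iL iD iC iS expectation_init(1) expectation_level(1) expectation_point(1)[OF t]
  show "integrable M (\<lambda>\<omega>. total_stat K n \<psi> \<beta> t (\<lambda>i. y i \<omega>))"
    unfolding T by (intro Bochner_Integration.integrable_add integrable_mult_right i)
  have "expectation (\<lambda>\<omega>. total_stat K n \<psi> \<beta> t (\<lambda>i. y i \<omega>)) = expectation L + n * expectation D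
     + n * expectation C + n * expectation (\<lambda>\<omega>. (init_stat K n \<beta> (\<lambda>i. y i \<omega>))\<^sup>2)
     + expectation (\<lambda>\<omega>. (level_stat K n \<psi> (\<lambda>i. y i \<omega>))\<^sup>2) + n * expectation S
     + n * expectation (\<lambda>\<omega>. (point_stat K \<beta> (\<lambda>i. y i \<omega>) t)\<^sup>2)"
    unfolding T using i by (simp add: Bochner_Integration.integral_add)
  moreover have "expectation L \<le> K * 3"
  proof -
    have "expectation L = (\<Sum>j=1..K. expectation (\<lambda>\<omega>. (lin_stat K n (\<lambda>i. y i \<omega>) j)\<^sup>2))"
      unfolding L_def by (intro Bochner_Integration.integral_sum expectation_lin)
    also have "\<dots> \<le> (\<Sum>j=1..K. 3)" by (intro sum_mono expectation_lin)
    finally show ?thesis by simp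
  qed
  moreover have "n * expectation D \<le> K * (2 * K)"
  proof -
    have "n * expectation D = (\<Sum>j=1..K. n * expectation (\<lambda>\<omega>. edge_stat K n (\<lambda>i. y i \<omega>) j))"
      unfolding D_def sum_distrib_left[symmetric]
      by (intro arg_cong2[where f="(*)"] refl Bochner_Integration.integral_sum expectation_edge)
    also have "\<dots> \<le> (\<Sum>j=1..K. real (2 * K))" by (intro sum_mono expectation_edge)
    finally show ?thesis by simp
  qed
  moreover have "n * expectation C \<le> real K * K * 32"
  proof -
    have "n * expectation C
        = (\<Sum>x\<in>?P. n * expectation (\<lambda>\<omega>. (cross_stat K n (\<lambda>i. y i \<omega>) (fst x) (snd x))\<^sup>2))"
      unfolding C_def sum_distrib_left[symmetric]
      by (intro arg_cong2[where f="(*)"] refl Bochner_Integration.integral_sum expectation_cross) auto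
    also have "\<dots> \<le> (\<Sum>x\<in>?P. 32)" by (intro sum_mono expectation_cross) auto
    also have "\<dots> \<le> real (card ({1..K} \<times> {1..K})) * 32"
    proof -
      have "card ?P \<le> card ({1..K} \<times> {1..K})" by (rule card_mono) auto
      then have "real (card ?P) \<le> real (card ({1..K} \<times> {1..K}))" by (rule of_nat_mono)
      then show ?thesis unfolding sum_constant by (rule mult_right_mono) simp
    qed
    finally show ?thesis by (simp add: card_cartesian_product)
  qed
  moreover have "n * expectation S \<le> K * (32 * B\<^sup>2)"
  proof -
    have "n * expectation S = (\<Sum>j=1..K. n * expectation (\<lambda>\<omega>. (score_stat K n \<psi> (\<lambda>i. y i \<omega>) j)\<^sup>2))"
      unfolding S_def sum_distrib_left[symmetric]
      by (intro arg_cong2[where f="(*)"] refl Bochner_Integration.integral_sum expectation_score)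
    also have "\<dots> \<le> (\<Sum>j=1..K. 32 * B\<^sup>2)" by (intro sum_mono expectation_score)
    finally show ?thesis by simp
  qed
  moreover note expectation_init(2) expectation_level(2) expectation_point(2)[OF t]
  ultimately show "expectation (\<lambda>\<omega>. total_stat K n \<psi> \<beta> t (\<lambda>i. y i \<omega>))
      \<le> K * 3 + K * (2 * K) + real K * K * 32 + (K * B)\<^sup>2 + 3 * B\<^sup>2 + K * (32 * B\<^sup>2) + (K * B)\<^sup>2"
    by linarith
qed

end

section \<open>Second moments of the original noise and a criterion for
  \<open>small_oP1\<close>\<close>

context prob_space
begin

lemma iid_vars_integral_eq:
  fixes X :: "'i \<Rightarrow> 'a \<Rightarrow> real" and f :: "real \<Rightarrow> real"
  assumes iid: "iid_vars X I" and st: "s \<in> I" "t \<in> I" and f: "f \<in> borel_measurable borel"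
  shows "integrable M (\<lambda>\<omega>. f (X s \<omega>)) \<longleftrightarrow> integrable M (\<lambda>\<omega>. f (X t \<omega>))"
    and "expectation (\<lambda>\<omega>. f (X s \<omega>)) = expectation (\<lambda>\<omega>. f (X t \<omega>))"
proof -
  have rv: "\<And>i. i \<in> I \<Longrightarrow> random_variable borel (X i)" and d: "distr M borel (X s) = distr M borel (X t)"
    using iid st unfolding iid_vars_def indep_vars_def by blast+
  show "integrable M (\<lambda>\<omega>. f (X s \<omega>)) \<longleftrightarrow> integrable M (\<lambda>\<omega>. f (X t \<omega>))"
    using integrable_distr_eq[OF rv[OF st(1)] f] integrable_distr_eq[OF rv[OF st(2)] f] d by simp
  show "expectation (\<lambda>\<omega>. f (X s \<omega>)) = expectation (\<lambda>\<omega>. f (X t \<omega>))"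
    using integral_distr[OF rv[OF st(1)] f] integral_distr[OF rv[OF st(2)] f] d by simp
qed

text \<open>\<open>x\<^sup>2 \<le> 1 + x ^ 4\<close> turns the fourth moment into a second one, and
  cross products vanish by independence and zero mean. Divided by \<open>n\<close>, the first sum
  dominates \<open>s\<^sup>2 / n\<close> and the second equals \<open>n * m\<^sup>2\<close>.\<close>

lemma iid_vars_sq_moments:
  fixes X :: "nat \<Rightarrow> 'a \<Rightarrow> real"
  assumes iid: "iid_vars X {1..n}" and n: "n \<ge> 1"
    and mean: "integrable M (X 1)" "expectation (X 1) = 0"
    and m4: "integrable M (\<lambda>\<omega>. X 1 \<omega> ^ 4)" "expectation (\<lambda>\<omega>. X 1 \<omega> ^ 4) \<le> C"
  shows "integrable M (\<lambda>\<omega>. (\<Sum>t=1..n. (X t \<omega>)\<^sup>2))" "integrable M (\<lambda>\<omega>. (\<Sum>t=1..n. X t \<omega>)\<^sup>2)"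
    and "expectation (\<lambda>\<omega>. (\<Sum>t=1..n. (X t \<omega>)\<^sup>2)) \<le> n * (1 + C)"
    and "expectation (\<lambda>\<omega>. (\<Sum>t=1..n. X t \<omega>)\<^sup>2) \<le> n * (1 + C)"
proof -
  have 1: "1 \<in> {1..n}" using n by simp
  have rv: "\<And>i. i \<in> {1..n} \<Longrightarrow> random_variable borel (X i)" and indep: "indep_vars (\<lambda>_. borel) X {1..n}"
    using iid unfolding iid_vars_def indep_vars_def by blast+
  have le: "x\<^sup>2 \<le> 1 + x ^ 4" for x :: real
  proof -
    have "2 * x\<^sup>2 \<le> x ^ 4 + 1" using sum_squares_bound[of "x\<^sup>2" 1] by (simp add: power_mult[symmetric])
    then show ?thesis using zero_le_power2[of x] by linarith
  qed
  have i1: "integrable M (\<lambda>\<omega>. (X 1 \<omega>)\<^sup>2)"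
  proof (rule Bochner_Integration.integrable_bound)
    show "integrable M (\<lambda>\<omega>. 1 + X 1 \<omega> ^ 4)" using m4 by simp
    show "AE \<omega> in M. norm ((X 1 \<omega>)\<^sup>2) \<le> norm (1 + X 1 \<omega> ^ 4)"
      using le by (intro AE_I2) simp
  qed (use rv[OF 1] in measurable)
  have isq: "integrable M (\<lambda>\<omega>. (X t \<omega>)\<^sup>2)" if "t \<in> {1..n}" for t
    using iid_vars_integral_eq(1)[OF iid that 1, of "\<lambda>x. x\<^sup>2"] i1 by simp
  have e1: "expectation (\<lambda>\<omega>. (X 1 \<omega>)\<^sup>2) \<le> 1 + C"
  proof -
    have "expectation (\<lambda>\<omega>. (X 1 \<omega>)\<^sup>2) \<le> expectation (\<lambda>\<omega>. 1 + X 1 \<omega> ^ 4)"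
      using le m4 i1 by (intro integral_mono) auto
    also have "\<dots> \<le> 1 + C" using m4 by (simp add: prob_space)
    finally show ?thesis .
  qed
  have esq: "expectation (\<lambda>\<omega>. (X t \<omega>)\<^sup>2) \<le> 1 + C" if "t \<in> {1..n}" for t
    using iid_vars_integral_eq(2)[OF iid that 1, of "\<lambda>x. x\<^sup>2"] e1 by simp
  have iX: "integrable M (X t)" "expectation (X t) = 0" if "t \<in> {1..n}" for t
    using iid_vars_integral_eq[OF iid that 1, of "\<lambda>x. x"] mean by simp_all
  have prod: "integrable M (\<lambda>\<omega>. X s \<omega> * X t \<omega>)" "expectation (\<lambda>\<omega>. X s \<omega> * X t \<omega>) = 0"
    if st: "s \<in> {1..n}" "t \<in> {1..n}" "s \<noteq> t" for s t
  proof -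
    have ind: "indep_vars (\<lambda>_. borel) X {s, t}" using indep st by (intro indep_vars_subset[OF indep]) auto
    show "integrable M (\<lambda>\<omega>. X s \<omega> * X t \<omega>)"
      using indep_vars_integrable[OF _ ind] iX st by auto
    show "expectation (\<lambda>\<omega>. X s \<omega> * X t \<omega>) = 0"
      using indep_vars_lebesgue_integral[OF _ ind] iX st by auto
  qed
  have iprod: "integrable M (\<lambda>\<omega>. X s \<omega> * X t \<omega>)" if "s \<in> {1..n}" "t \<in> {1..n}" for s t
    using prod[OF that] isq[OF that(1)] by (cases "s = t") (simp_all add: power2_eq_square)
  show "integrable M (\<lambda>\<omega>. (\<Sum>t=1..n. (X t \<omega>)\<^sup>2))"
    by (intro Bochner_Integration.integrable_sum isq)
  have "expectation (\<lambda>\<omega>. (\<Sum>t=1..n. (X t \<omega>)\<^sup>2)) = (\<Sum>t=1..n. expectation (\<lambda>\<omega>. (X t \<omega>)\<^sup>2))"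
    by (intro Bochner_Integration.integral_sum isq)
  also have sq: "\<dots> \<le> (\<Sum>t=1..n. 1 + C)" by (intro sum_mono esq)
  finally show "expectation (\<lambda>\<omega>. (\<Sum>t=1..n. (X t \<omega>)\<^sup>2)) \<le> n * (1 + C)" by simp
  have eq: "(\<Sum>t=1..n. X t \<omega>)\<^sup>2 = (\<Sum>s=1..n. \<Sum>t=1..n. X s \<omega> * X t \<omega>)" for \<omega>
    unfolding power2_eq_square sum_product ..
  show "integrable M (\<lambda>\<omega>. (\<Sum>t=1..n. X t \<omega>)\<^sup>2)"
    unfolding eq by (intro Bochner_Integration.integrable_sum iprod)
  have "expectation (\<lambda>\<omega>. (\<Sum>t=1..n. X t \<omega>)\<^sup>2)
      = (\<Sum>s=1..n. expectation (\<lambda>\<omega>. \<Sum>t=1..n. X s \<omega> * X t \<omega>))"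
    unfolding eq by (rule Bochner_Integration.integral_sum) (intro Bochner_Integration.integrable_sum iprod)
  also have "\<dots> = (\<Sum>s=1..n. \<Sum>t=1..n. expectation (\<lambda>\<omega>. X s \<omega> * X t \<omega>))"
    by (intro sum.cong refl Bochner_Integration.integral_sum iprod)
  also have "\<dots> = (\<Sum>s=1..n. \<Sum>t=1..n. if t = s then expectation (\<lambda>\<omega>. (X s \<omega>)\<^sup>2) else 0)"
    by (intro sum.cong refl) (auto simp: prod power2_eq_square)
  also have "\<dots> = (\<Sum>s=1..n. expectation (\<lambda>\<omega>. (X s \<omega>)\<^sup>2))" by simp
  also have "\<dots> \<le> (\<Sum>s=1..n. 1 + C)" by (rule sq)
  finally show "expectation (\<lambda>\<omega>. (\<Sum>t=1..n. X t \<omega>)\<^sup>2) \<le> n * (1 + C)" by simp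
qed

end

text \<open>For given \<open>k\<close> the deviation probability is only bounded by
  \<open>D / k\<close>. A target fixes \<open>k\<close> first, and the index is taken large
  afterwards.\<close>

lemma small_oP1_I:
  assumes "\<And>\<epsilon> k. \<epsilon> > 0 \<Longrightarrow> k > 0 \<Longrightarrow> \<forall>\<^sub>F n in sequentially.
    outer_measure_of (M n) {\<omega> \<in> space (M n). \<bar>X n \<omega>\<bar> > \<epsilon>} \<le> ennreal (D / k)"
  shows "small_oP1 M X"
  unfolding small_oP1_def
proof (intro allI impI order_tendstoI)
  fix \<epsilon> :: real and a :: ennreal
  assume \<epsilon>: "\<epsilon> > 0" and a: "a > 0"
  have "((\<lambda>k. D / k) \<longlongrightarrow> 0) at_top" by real_asymp
  then have "((\<lambda>k. ennreal (D / k)) \<longlongrightarrow> ennreal 0) at_top" by (rule tendsto_ennrealI)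
  then have "\<forall>\<^sub>F k in at_top. ennreal (D / k) < a" using a by (intro order_tendstoD) auto
  then have "\<forall>\<^sub>F k in at_top. ennreal (D / k) < a \<and> k > 0"
    using eventually_gt_at_top[of "0::real"] by eventually_elim simp
  then obtain k where k: "ennreal (D / k) < a" "k > 0"
    using eventually_happens[of _ "at_top :: real filter"] by auto
  show "\<forall>\<^sub>F n in sequentially. outer_measure_of (M n) {\<omega> \<in> space (M n). \<bar>X n \<omega>\<bar> > \<epsilon>} < a"
    using assms[OF \<epsilon> k(2)] by eventually_elim (use k(1) in auto)
qed simp

text \<open>Deviation sets are not shown to be measurable; a measurable exceptional event covers
  them.\<close>

lemma outer_measure_of_le_emeasure:
  "A \<in> sets M \<Longrightarrow> S \<subseteq> A \<Longrightarrow> outer_measure_of M S \<le> emeasure M A"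
  unfolding outer_measure_of_def by (rule INF_lower) auto

lemma tendsto_init_weight:
  assumes "\<beta> \<longlonglongrightarrow> 0"
  shows "init_weight K \<beta> \<longlonglongrightarrow> 0"
proof -
  have "(\<lambda>t. \<Sum>q=K+1..2*K. \<beta> (t - q)) \<longlonglongrightarrow> (\<Sum>q=K+1..2*K. 0)"
    by (intro tendsto_sum filterlim_compose[OF assms filterlim_minus_const_nat_at_top])
  moreover have "\<forall>\<^sub>F t in sequentially. (\<Sum>q=K+1..2*K. \<beta> (t - q)) = init_weight K \<beta> t"
    using eventually_ge_at_top[of "2 * K"]
    by eventually_elim (simp add: init_weight_def min_absorb1)
  ultimately have "init_weight K \<beta> \<longlonglongrightarrow> (\<Sum>q=K+1..2*K. 0)" by (rule Lim_transform_eventually)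
  then show ?thesis by simp
qed

section \<open>Consistency of the fitted proxies\<close>

lemma summable_poly_geometric:
  fixes x :: real
  assumes "0 \<le> x" "x < 1"
  shows "summable (\<lambda>n. real (n + 1) ^ K * x ^ n)"
proof (cases "x = 0")
  case True
  then have "(\<lambda>n. real (n + 1) ^ K * x ^ n) = (\<lambda>n. if n \<in> {0} then 1 else 0)" by (auto simp: fun_eq_iff)
  then show ?thesis using summable_If_finite_set[of "{0::nat}" "\<lambda>_. 1::real"] by simp
next
  case False
  then have x: "0 < x" using assms by simp
  have "(\<lambda>n. (real (Suc n + 1) / real (n + 1)) ^ K * x) \<longlonglongrightarrow> 1 ^ K * x"
    by (intro tendsto_intros) real_asymp
  then have lim: "(\<lambda>n. (real (Suc n + 1) / real (n + 1)) ^ K * x) \<longlonglongrightarrow> x" by simp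
  obtain c where c: "x < c" "c < 1" using dense assms(2) by blast
  have "\<forall>\<^sub>F n in sequentially. (real (Suc n + 1) / real (n + 1)) ^ K * x < c"
    using lim c(1) by (rule order_tendstoD)
  then obtain n0 where n0: "\<And>n. n \<ge> n0 \<Longrightarrow> (real (Suc n + 1) / real (n + 1)) ^ K * x < c"
    unfolding eventually_sequentially by blast
  show ?thesis
  proof (rule summable_ratio_test[OF c(2)])
    fix n assume "n \<ge> n0"
    have "real (Suc n + 1) ^ K * x ^ Suc n
        = ((real (Suc n + 1) / real (n + 1)) ^ K * x) * (real (n + 1) ^ K * x ^ n)"
      by (simp add: power_divide)
    also have "\<dots> \<le> c * (real (n + 1) ^ K * x ^ n)"
      using n0[OF \<open>n \<ge> n0\<close>] x by (intro mult_right_mono) auto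
    finally show "norm (real (Suc n + 1) ^ K * x ^ Suc n) \<le> c * norm (real (n + 1) ^ K * x ^ n)"
      using x by simp
  qed
qed

text \<open>The regression residual is \<open>u - e\<close>. It is orthogonal to every regressor,
  hence to their combination \<open>e\<close>.\<close>

lemma ols_residual:
  fixes K n :: nat and Y u :: "nat \<Rightarrow> real" and r :: "real vec"
  assumes r: "r \<in> carrier_vec (K + 1)"
    and model: "\<And>t. t \<in> {K+1..n} \<Longrightarrow> Y t = r $ 0 + (\<Sum>j=1..K. r $ j * Y (t - j)) + u t"
  defines "a \<equiv> \<lambda>j. ols K n Y $ j - r $ j"
  defines "e \<equiv> \<lambda>t. a 0 + (\<Sum>j=1..K. a j * Y (t - j))"
  shows "proxy K (ols K n Y) Y t - proxy K r Y t = e t"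
    and "(\<Sum>t=K+1..n. (e t)\<^sup>2) = (\<Sum>t=K+1..n. e t * u t)"
proof -
  let ?x = "regressor K Y"
  have ex: "e t = (\<Sum>i<K+1. a i * ?x t $ i)" for t
    unfolding e_def regressor_sum ..
  show e: "proxy K (ols K n Y) Y t - proxy K r Y t = e t" for t
    unfolding ex a_def proxy_eq_sum[OF r] proxy_eq_sum[OF ols_normal_equations(1)]
    by (simp only: left_diff_distrib sum_subtractf)
  have res: "Y t - proxy K (ols K n Y) Y t = u t - e t" if "t \<in> {K+1..n}" for t
  proof -
    have "Y t = proxy K r Y t + u t"
      using model[OF that] unfolding proxy_eq_sum[OF r] regressor_sum .
    then show ?thesis using e[of t] by linarith
  qed
  have "(\<Sum>t=K+1..n. e t * (u t - e t)) = (\<Sum>t=K+1..n. \<Sum>i<K+1. a i * (?x t $ i * (u t - e t)))"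
    unfolding ex[of t for t] sum_distrib_right by (simp only: mult.assoc)
  also have "\<dots> = (\<Sum>i<K+1. a i * (\<Sum>t=K+1..n. ?x t $ i * (u t - e t)))"
    unfolding sum_distrib_left by (rule sum.swap)
  also have "\<dots> = (\<Sum>i<K+1. a i * (\<Sum>t=K+1..n. ?x t $ i * (Y t - proxy K (ols K n Y) Y t)))"
    using res by (intro sum.cong arg_cong2[where f="(*)"] refl) simp
  also have "\<dots> = 0"
    using ols_normal_equations(2)[where K=K and T=n and Y=Y] by (intro sum.neutral) auto
  finally show "(\<Sum>t=K+1..n. (e t)\<^sup>2) = (\<Sum>t=K+1..n. e t * u t)"
    by (simp add: right_diff_distrib sum_subtractf power2_eq_square)
qed

text \<open>Bounds the expectation of \<open>Z\<close> in \<open>ols_error_bound\<close>: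
  \<open>1 + C\<close> for each of the two noise moments, the rest from
  \<open>expectation_total\<close>.\<close>

definition stat_bound :: "nat \<Rightarrow> real \<Rightarrow> real \<Rightarrow> real" where
  "stat_bound K B C = 2 * (1 + C) + (K * 3 + K * (2 * K) + real K * K * 32 + (K * B)\<^sup>2 + 3 * B\<^sup>2
     + K * (32 * B\<^sup>2) + (K * B)\<^sup>2)"

text \<open>A single Markov inequality for the sum of all statistics. The event depends on
  \<open>t0\<close> through \<open>point_stat\<close>, its probability bound does not; the inverse
  filter enters the constants only through \<open>\<beta>\<close> and \<open>B\<close>.\<close>

lemma (in prob_space) ols_error_bound:
  fixes K n t0 :: nat and u Y :: "nat \<Rightarrow> 'a \<Rightarrow> real" and r :: "real vec"
    and \<psi> \<beta> :: "nat \<Rightarrow> real" and B C k :: real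
  assumes n: "4 \<le> n" "2 * K \<le> n" and t0: "t0 \<le> n"
    and r: "r \<in> carrier_vec (K + 1)"
    and model: "\<And>t \<omega>. t \<in> {K+1..n} \<Longrightarrow> \<omega> \<in> space M \<Longrightarrow>
        Y t \<omega> = r $ 0 + (\<Sum>j=1..K. r $ j * Y (t - j) \<omega>) + u t \<omega>"
    and iid: "iid_vars u {1..n}"
    and mean: "integrable M (u 1)" "expectation (u 1) = 0"
    and m4: "integrable M (\<lambda>\<omega>. u 1 \<omega> ^ 4)" "expectation (\<lambda>\<omega>. u 1 \<omega> ^ 4) \<le> C"
    and r_le: "\<And>j. j \<in> {1..K} \<Longrightarrow> \<bar>r $ j\<bar> \<le> 2 ^ K"
    and \<psi>_le: "\<And>i. \<bar>\<psi> i\<bar> \<le> \<beta> i" and sum_\<beta>: "\<And>A. finite A \<Longrightarrow> sum \<beta> A \<le> B"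
    and inverse: "\<And>v i. v i = (\<Sum>m\<le>i. \<psi> (i - m) * (v m - (\<Sum>j=1..min m K. r $ j * v (m - j))))"
    and k: "k > 0" and large: "(k + 2 * K) * (2 * K + 4)\<^sup>2 \<le> n"
  defines "E \<equiv> (real K + 1) * 2 ^ K"
  defines "H \<equiv> sqrt k + 2 * E * k * (K + 2)"
  defines "e \<equiv> \<lambda>t \<omega>. proxy K (ols K n (\<lambda>s. Y s \<omega>)) (\<lambda>s. Y s \<omega>) t - proxy K r (\<lambda>s. Y s \<omega>) t"
  obtains A where "A \<in> events" "emeasure M A \<le> ennreal (stat_bound K B C / k)"
    "\<And>\<omega>. \<omega> \<in> space M - A \<Longrightarrow> (\<Sum>t=K+1..n. (e t \<omega>)\<^sup>2) \<le> H\<^sup>2"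
    "\<And>\<omega>. \<omega> \<in> space M - A \<Longrightarrow> t0 \<in> {K+1..n} \<Longrightarrow>
      \<bar>e t0 \<omega>\<bar> \<le> H * (2 * E * (init_weight K \<beta> t0 + (B + sqrt k) / sqrt n))"
proof -
  have n0: "0 < real n" and n1: "1 \<le> n" using n by auto
  define m where "m \<omega> = (\<Sum>t=1..n. u t \<omega>) / n" for \<omega>
  define Q where "Q \<omega> = (\<Sum>t=1..n. (u t \<omega> - m \<omega>)\<^sup>2)" for \<omega>
  define y where "y t \<omega> = studentized {1..n} (\<lambda>j. u j \<omega>) t" for t \<omega>
  have "exchangeable M {1..n} y"
    unfolding y_def by (rule exchangeable_studentized[OF iid]) (use n in auto)
  then interpret ex: exchangeable_path M n y K \<psi> \<beta> B
    unfolding exchangeable_path_def exchangeable_path_axioms_def using n \<psi>_le sum_\<beta> by auto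
  define Z where "Z \<omega> = (\<Sum>t=1..n. (u t \<omega>)\<^sup>2) / n + (\<Sum>t=1..n. u t \<omega>)\<^sup>2 / n
      + total_stat K n \<psi> \<beta> t0 (\<lambda>i. y i \<omega>)" for \<omega>
  note mom = iid_vars_sq_moments[OF iid n1 mean m4]
  have Zint: "integrable M Z"
    unfolding Z_def by (intro Bochner_Integration.integrable_add integrable_divide_zero mom ex.expectation_total t0 impI)
  have Z0: "0 \<le> Z \<omega>" for \<omega>
    unfolding Z_def using total_stat_ge(1) by (intro add_nonneg_nonneg divide_nonneg_nonneg sum_nonneg) auto
  have "expectation Z = expectation (\<lambda>\<omega>. (\<Sum>t=1..n. (u t \<omega>)\<^sup>2)) / n + expectation (\<lambda>\<omega>. (\<Sum>t=1..n. u t \<omega>)\<^sup>2) / n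
      + expectation (\<lambda>\<omega>. total_stat K n \<psi> \<beta> t0 (\<lambda>i. y i \<omega>))"
    unfolding Z_def using mom(1,2) ex.expectation_total(1)[OF t0] by simp
  also have "\<dots> \<le> (1 + C) + (1 + C) + expectation (\<lambda>\<omega>. total_stat K n \<psi> \<beta> t0 (\<lambda>i. y i \<omega>))"
    using mom(3,4) n0 by (intro add_mono) (simp_all add: pos_divide_le_eq mult.commute)
  also have "\<dots> \<le> stat_bound K B C"
    using ex.expectation_total(2)[OF t0] unfolding stat_bound_def by simp
  finally have EZ: "expectation Z \<le> stat_bound K B C" .
  define A where "A = {\<omega> \<in> space M. k \<le> Z \<omega>}"
  have A: "A \<in> events" unfolding A_def using Zint by measurable
  have "emeasure M A \<le> ennreal (1 / k * expectation Z)"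
    unfolding A_def by (rule integral_Markov_inequality[OF Zint _ k]) (use Z0 in simp)
  also have "\<dots> \<le> ennreal (stat_bound K B C / k)"
    using EZ k by (intro ennreal_leI) (simp add: divide_right_mono)
  finally have PA: "emeasure M A \<le> ennreal (stat_bound K B C / k)" .
  have path: "(\<Sum>t=K+1..n. (e t \<omega>)\<^sup>2) \<le> H\<^sup>2 \<and> (t0 \<in> {K+1..n} \<longrightarrow>
      \<bar>e t0 \<omega>\<bar> \<le> H * (2 * E * (init_weight K \<beta> t0 + (B + sqrt k) / sqrt n)))"
    if \<omega>: "\<omega> \<in> space M - A" for \<omega>
  proof -
    have scale: "u t \<omega> = m \<omega> + sqrt (Q \<omega>) * y t \<omega>" if "t \<in> {1..n}" for t
      using studentized_scale[of "{1..n}" t "\<lambda>j. u j \<omega>"] that by (simp add: m_def Q_def y_def)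
    \<comment> \<open>In the second alternative all noise values equal their mean, so the scale is
      0.\<close>
    have normed: "sqrt (Q \<omega>) = 0 \<or> (\<Sum>t=1..n. (y t \<omega>)\<^sup>2) = 1"
      using sum_studentized_sq[OF finite_atLeastAtMost, of 1 n "\<lambda>j. u j \<omega>"]
    proof
      assume c: "\<forall>t\<in>{1..n}. u t \<omega> = (\<Sum>j=1..n. u j \<omega>) / card {1..n}"
      have "u t \<omega> - m \<omega> = 0" if "t \<in> {1..n}" for t
        using bspec[OF c that] by (simp only: m_def card_atLeastAtMost) simp
      then have "Q \<omega> = 0" unfolding Q_def by (intro sum.neutral ballI) (simp only: zero_power2)
      then show ?thesis by simp
    qed (simp add: y_def)
    have Q0: "0 \<le> Q \<omega>" by (simp add: Q_def sum_nonneg)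
    interpret p: ar_path K n "\<lambda>j. r $ j" "\<lambda>t. Y t \<omega>" "\<lambda>t. u t \<omega>" "\<lambda>t. y t \<omega>" \<psi> \<beta> "m \<omega>" "sqrt (Q \<omega>)" B
      using model \<omega> scale normed Q0 n r_le \<psi>_le sum_\<beta> inverse by unfold_locales auto
    have stat: "(sqrt (Q \<omega>))\<^sup>2 / n + n * (m \<omega>)\<^sup>2 + total_stat K n \<psi> \<beta> t0 (\<lambda>t. y t \<omega>) \<le> k"
    proof -
      \<comment> \<open>Centring lowers the sum of squares, so the moment bound for the raw noise
        carries over to \<open>Q\<close>.\<close>
      have "Q \<omega> = (\<Sum>t=1..n. (u t \<omega>)\<^sup>2) - n * (m \<omega>)\<^sup>2"
      proof -
        have "Q \<omega> = (\<Sum>t=1..n. (u t \<omega>)\<^sup>2) - 2 * m \<omega> * (\<Sum>t=1..n. u t \<omega>) + n * (m \<omega>)\<^sup>2"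
          unfolding Q_def power2_diff by (simp add: sum.distrib sum_subtractf sum_distrib_left mult_ac)
        also have "(\<Sum>t=1..n. u t \<omega>) = n * m \<omega>" using n0 by (simp add: m_def)
        finally show ?thesis by (simp add: power2_eq_square)
      qed
      then have "Q \<omega> \<le> (\<Sum>t=1..n. (u t \<omega>)\<^sup>2)" by simp
      then have "(sqrt (Q \<omega>))\<^sup>2 / n \<le> (\<Sum>t=1..n. (u t \<omega>)\<^sup>2) / n"
        using Q0 by (intro divide_right_mono) auto
      moreover have "n * (m \<omega>)\<^sup>2 = (\<Sum>t=1..n. u t \<omega>)\<^sup>2 / n"
        using n0 by (simp add: m_def power2_eq_square)
      moreover have "Z \<omega> < k" using \<omega> by (auto simp: A_def)
      ultimately show ?thesis unfolding Z_def by linarith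
    qed
    define a where "a = (\<lambda>j. ols K n (\<lambda>s. Y s \<omega>) $ j - r $ j)"
    have fit: "p.fit a t = e t \<omega>" for t
      using ols_residual(1)[OF r, of n "\<lambda>s. Y s \<omega>" "\<lambda>t. u t \<omega>" t] model \<omega>
      unfolding p.fit_def e_def a_def by simp
    have "p.energy (p.fit a) = (\<Sum>t=K+1..n. p.fit a t * u t \<omega>)"
      using ols_residual(2)[OF r, of n "\<lambda>s. Y s \<omega>" "\<lambda>t. u t \<omega>"] model \<omega>
      unfolding p.energy_def p.fit_def a_def by simp
    note bd = p.residual_bounds[OF stat large this, unfolded fit p.energy_def, folded E_def, folded H_def]
    show ?thesis using bd by blast
  qed
  show ?thesis by (rule that[OF A PA]) (use path in blast)+
qed

theorem lemma5:
  fixes M :: "nat \<Rightarrow> 'a measure"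
    and K :: nat
    and Tstar T :: "nat \<Rightarrow> nat"
    and \<rho> :: "nat \<Rightarrow> real vec"
    and u Y :: "nat \<Rightarrow> nat \<Rightarrow> 'a \<Rightarrow> real"
    and C \<delta> :: real
  assumes prob: "\<And>T0. prob_space (M T0)"
    and T: "\<And>T0. T T0 = T0 + Tstar T0"
    and rho: "\<And>T0. \<rho> T0 \<in> carrier_vec (K + 1)"
    and Y_rv: "\<And>T0 t. t \<in> {1..T T0} \<Longrightarrow> Y T0 t \<in> borel_measurable (M T0)"
    and model: "\<And>T0 t \<omega>. t \<in> {K + 1..T T0} \<Longrightarrow> \<omega> \<in> space (M T0) \<Longrightarrow>
        Y T0 t \<omega> = \<rho> T0 $ 0 + (\<Sum>j=1..K. \<rho> T0 $ j * Y T0 (t - j) \<omega>) + u T0 t \<omega>"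
    and iid: "\<And>T0. prob_space.iid_vars (M T0) (u T0) {1..T T0}"
    and mean: "\<And>T0. T T0 \<ge> 1 \<Longrightarrow>
        integrable (M T0) (u T0 1) \<and> prob_space.expectation (M T0) (u T0 1) = 0"
    and moment4: "\<And>T0. T T0 \<ge> 1 \<Longrightarrow> integrable (M T0) (\<lambda>\<omega>. u T0 1 \<omega> ^ 4) \<and>
        prob_space.expectation (M T0) (\<lambda>\<omega>. u T0 1 \<omega> ^ 4) \<le> C"
    and delta: "\<delta> > 0"
    and roots: "\<And>T0 z :: complex.
        1 - (\<Sum>j=1..K. complex_of_real (\<rho> T0 $ j) * z ^ j) = 0 \<Longrightarrow> cmod z \<ge> 1 + \<delta>"
  shows "(\<forall>t. (\<forall>\<^sub>F T0 in sequentially. T0 + 1 \<le> t T0 \<and> t T0 \<le> T T0) \<longrightarrow>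
            small_oP1 M (\<lambda>T0 \<omega>.
              proxy K (ols K (T T0) (\<lambda>s. Y T0 s \<omega>)) (\<lambda>s. Y T0 s \<omega>) (t T0)
              - proxy K (\<rho> T0) (\<lambda>s. Y T0 s \<omega>) (t T0)))
       \<and> small_oP1 M (\<lambda>T0 \<omega>. 1 / real (T T0) *
            (\<Sum>t=K+1..T T0.
              (proxy K (ols K (T T0) (\<lambda>s. Y T0 s \<omega>)) (\<lambda>s. Y T0 s \<omega>) t
               - proxy K (\<rho> T0) (\<lambda>s. Y T0 s \<omega>) t)\<^sup>2))"
proof -
  \<comment> \<open>\<open>\<beta>\<close>, \<open>B\<close> and \<open>H k\<close> involve at most
    \<open>K\<close>, \<open>\<delta>\<close> and \<open>k\<close>, whereas \<open>\<rho> T0\<close>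
    and its inverse filter vary with \<open>T0\<close>.\<close>
  define \<beta> where "\<beta> n = real (n + 1) ^ K * (1 / (1 + \<delta>)) ^ n" for n
  define B where "B = suminf \<beta>"
  define E where "E = (real K + 1) * 2 ^ K"
  define H where "H k = sqrt k + 2 * E * k * (K + 2)" for k
  define e where "e T0 t \<omega> = proxy K (ols K (T T0) (\<lambda>s. Y T0 s \<omega>)) (\<lambda>s. Y T0 s \<omega>) t
      - proxy K (\<rho> T0) (\<lambda>s. Y T0 s \<omega>) t" for T0 t \<omega>
  have \<beta>_nonneg: "0 \<le> \<beta> n" for n using delta by (simp add: \<beta>_def)
  have summable: "summable \<beta>" unfolding \<beta>_def using delta by (intro summable_poly_geometric) auto
  have sum_\<beta>: "sum \<beta> A \<le> B" if "finite A" for A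
    unfolding B_def using that by (intro sum_le_suminf summable \<beta>_nonneg)
  have \<beta>0: "\<beta> \<longlonglongrightarrow> 0" using summable by (rule summable_LIMSEQ_zero)
  have T_top: "filterlim T at_top sequentially"
    by (rule filterlim_at_top_mono[OF filterlim_ident]) (simp add: T)
  have inv_T: "(\<lambda>T0. c / sqrt (T T0)) \<longlonglongrightarrow> 0" "(\<lambda>T0. c / T T0) \<longlonglongrightarrow> 0" for c :: real
  proof -
    have "(\<lambda>n. c / sqrt (real n)) \<longlonglongrightarrow> 0" "(\<lambda>n. c / real n) \<longlonglongrightarrow> 0" by real_asymp+
    then show "(\<lambda>T0. c / sqrt (T T0)) \<longlonglongrightarrow> 0" "(\<lambda>T0. c / T T0) \<longlonglongrightarrow> 0"
      using filterlim_compose[OF _ T_top] by blast+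
  qed
  have good: "\<exists>A\<in>sets (M T0). emeasure (M T0) A \<le> ennreal (stat_bound K B C / k) \<and>
      (\<forall>\<omega>\<in>space (M T0) - A. (\<Sum>t=K+1..T T0. (e T0 t \<omega>)\<^sup>2) \<le> (H k)\<^sup>2 \<and>
        (t0 \<in> {K+1..T T0} \<longrightarrow> \<bar>e T0 t0 \<omega>\<bar> \<le> H k * (2 * E * (init_weight K \<beta> t0 + (B + sqrt k) / sqrt (T T0)))))"
    if k: "k > 0" and n: "4 \<le> T T0" "2 * K \<le> T T0" "(k + 2 * K) * (2 * K + 4)\<^sup>2 \<le> T T0" and t0: "t0 \<le> T T0"
    for k :: real and T0 t0 :: nat
  proof -
    interpret prob_space "M T0" by (rule prob)
    have n1: "1 \<le> T T0" using n by simp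
    obtain \<psi> :: "nat \<Rightarrow> real" where \<psi>: "\<And>n. \<bar>\<psi> n\<bar> \<le> real (n + 1) ^ K * (1 / (1 + \<delta>)) ^ n"
      "\<And>j. j \<in> {1..K} \<Longrightarrow> \<bar>\<rho> T0 $ j\<bar> \<le> 2 ^ K"
      "\<And>v n. v n = (\<Sum>m\<le>n. \<psi> (n - m) * (v m - (\<Sum>j=1..min m K. \<rho> T0 $ j * v (m - j))))"
      using lag_polynomial_inverse[OF delta roots[of T0]] by blast
    obtain A where A: "A \<in> events" "emeasure (M T0) A \<le> ennreal (stat_bound K B C / k)"
      "\<And>\<omega>. \<omega> \<in> space (M T0) - A \<Longrightarrow> (\<Sum>t=K+1..T T0. (e T0 t \<omega>)\<^sup>2) \<le> (H k)\<^sup>2"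
      "\<And>\<omega>. \<omega> \<in> space (M T0) - A \<Longrightarrow> t0 \<in> {K+1..T T0} \<Longrightarrow>
        \<bar>e T0 t0 \<omega>\<bar> \<le> H k * (2 * E * (init_weight K \<beta> t0 + (B + sqrt k) / sqrt (T T0)))"
      using ols_error_bound[OF n(1,2) t0 rho model iid conjunct1[OF mean[OF n1]] conjunct2[OF mean[OF n1]]
        conjunct1[OF moment4[OF n1]] conjunct2[OF moment4[OF n1]] \<psi>(2) \<psi>(1)[folded \<beta>_def] sum_\<beta> \<psi>(3) k n(3),
        folded E_def, folded H_def e_def] by blast
    then show ?thesis by blast
  qed
  have large: "\<forall>\<^sub>F T0 in sequentially. 4 \<le> T T0 \<and> 2 * K \<le> T T0 \<and> (k + 2 * K) * (2 * K + 4)\<^sup>2 \<le> T T0" for k :: real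
  proof -
    have "\<forall>\<^sub>F T0 in sequentially. max (max 4 (2 * K)) (nat \<lceil>(k + 2 * K) * (2 * K + 4)\<^sup>2\<rceil>) \<le> T T0"
      using T_top unfolding filterlim_at_top by blast
    then show ?thesis by eventually_elim linarith
  qed
  show ?thesis unfolding e_def[symmetric]
  proof (intro conjI allI impI)
    fix t :: "nat \<Rightarrow> nat"
    assume t: "\<forall>\<^sub>F T0 in sequentially. T0 + 1 \<le> t T0 \<and> t T0 \<le> T T0"
    \<comment> \<open>The date diverges with \<open>T0\<close>, which is what makes the initial
      values fade.\<close>
    have t_top: "filterlim t at_top sequentially"
      by (rule filterlim_at_top_mono[OF filterlim_ident]) (use t in eventually_elim, simp)
    show "small_oP1 M (\<lambda>T0. e T0 (t T0))"
    proof (rule small_oP1_I[where D = "stat_bound K B C"])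
      fix \<epsilon> k :: real assume \<epsilon>: "\<epsilon> > 0" and k: "k > 0"
      have "(\<lambda>T0. H k * (2 * E * (init_weight K \<beta> (t T0) + (B + sqrt k) / sqrt (T T0)))) \<longlonglongrightarrow> H k * (2 * E * (0 + 0))"
        by (intro tendsto_intros inv_T filterlim_compose[OF tendsto_init_weight[OF \<beta>0] t_top])
      then have "\<forall>\<^sub>F T0 in sequentially. H k * (2 * E * (init_weight K \<beta> (t T0) + (B + sqrt k) / sqrt (T T0))) < \<epsilon>"
        by (rule order_tendstoD) (use \<epsilon> in simp)
      then show "\<forall>\<^sub>F T0 in sequentially.
          outer_measure_of (M T0) {\<omega> \<in> space (M T0). \<bar>e T0 (t T0) \<omega>\<bar> > \<epsilon>} \<le> ennreal (stat_bound K B C / k)"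
        \<comment> \<open>\<open>K \<le> T0\<close> places \<open>t T0\<close> in the regression
          range, which starts at \<open>K + 1\<close>.\<close>
        using t large[of k] eventually_ge_at_top[of K]
      proof eventually_elim
        case (elim T0)
        obtain A where A: "A \<in> sets (M T0)" "emeasure (M T0) A \<le> ennreal (stat_bound K B C / k)"
          "\<And>\<omega>. \<omega> \<in> space (M T0) - A \<Longrightarrow> \<bar>e T0 (t T0) \<omega>\<bar>
            \<le> H k * (2 * E * (init_weight K \<beta> (t T0) + (B + sqrt k) / sqrt (T T0)))"
          using good[OF k, of T0 "t T0"] elim by fastforce
        have "{\<omega> \<in> space (M T0). \<bar>e T0 (t T0) \<omega>\<bar> > \<epsilon>} \<subseteq> A"
          using A(3) elim(1) by fastforce
        then show ?case using outer_measure_of_le_emeasure[OF A(1)] A(2) order_trans by blast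
      qed
    qed
  next
    show "small_oP1 M (\<lambda>T0 \<omega>. 1 / real (T T0) * (\<Sum>t=K+1..T T0. (e T0 t \<omega>)\<^sup>2))"
    proof (rule small_oP1_I[where D = "stat_bound K B C"])
      fix \<epsilon> k :: real assume \<epsilon>: "\<epsilon> > 0" and k: "k > 0"
      have "\<forall>\<^sub>F T0 in sequentially. (H k)\<^sup>2 / T T0 < \<epsilon>"
        using inv_T(2)[of "(H k)\<^sup>2"] by (rule order_tendstoD) (use \<epsilon> in simp)
      then show "\<forall>\<^sub>F T0 in sequentially.
          outer_measure_of (M T0) {\<omega> \<in> space (M T0). \<bar>1 / real (T T0) * (\<Sum>t=K+1..T T0. (e T0 t \<omega>)\<^sup>2)\<bar> > \<epsilon>}
          \<le> ennreal (stat_bound K B C / k)"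
        using large[of k]
      proof eventually_elim
        case (elim T0)
        obtain A where A: "A \<in> sets (M T0)" "emeasure (M T0) A \<le> ennreal (stat_bound K B C / k)"
          "\<And>\<omega>. \<omega> \<in> space (M T0) - A \<Longrightarrow> (\<Sum>t=K+1..T T0. (e T0 t \<omega>)\<^sup>2) \<le> (H k)\<^sup>2"
          \<comment> \<open>Date 0 is a placeholder outside the regression range; only the energy
            bound is taken.\<close>
          using good[OF k, of T0 0] elim by auto
        have "\<bar>1 / real (T T0) * (\<Sum>t=K+1..T T0. (e T0 t \<omega>)\<^sup>2)\<bar> < \<epsilon>" if "\<omega> \<in> space (M T0) - A" for \<omega>
        proof -
          have "\<bar>1 / real (T T0) * (\<Sum>t=K+1..T T0. (e T0 t \<omega>)\<^sup>2)\<bar> = (\<Sum>t=K+1..T T0. (e T0 t \<omega>)\<^sup>2) / T T0"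
            by (simp add: sum_nonneg)
          also have "\<dots> \<le> (H k)\<^sup>2 / T T0" using A(3)[OF that] by (rule divide_right_mono) simp
          finally show ?thesis using elim(1) by linarith
        qed
        then have "{\<omega> \<in> space (M T0). \<bar>1 / real (T T0) * (\<Sum>t=K+1..T T0. (e T0 t \<omega>)\<^sup>2)\<bar> > \<epsilon>} \<subseteq> A"
          by fastforce
        then show ?case using outer_measure_of_le_emeasure[OF A(1)] A(2) order_trans by blast
      qed
    qed
  qed
qed

end
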